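(* Let $F$ be a field of characteristic $2$ and let $\varphi,\psi$ be totally singular quadratic forms over $F$ such that the anisotropic part $\varphi_{\mathrm{an}}$ is minimal over $F$. If $\varphi$ and $\psi$ are weakly Vishik equivalent, then they are similar.
   Context: A totally singular quadratic form over a field $F$ of characteristic $2$ is a map $\varphi:V\to F$ on a finite-dimensional $F$-vector space $V$ with $\varphi(av)=a^2\varphi(v)$ and $\varphi(v+w)=\varphi(v)+\varphi(w)$ for all $a\in F$, $v,w\in V$; $\dim\varphi=\dim V$. Write $\langle a_1,\dots,a_n\rangle$ for the form $(x_1,\dots,x_n)\mapsto\sum a_ix_i^2$ on $F^n$. Isometry $\varphi\simeq\psi$ means there is a bijective linear map $f$ with $\varphi(v)=\psi(f(v))$ for all $v$; $\varphi,\psi$ are similar if $\varphi\simeq c\psi$ for some $c\in F^*$. A form is isotropic if it vanishes at some nonzero vector, anisotropic otherwise. Every form decomposes as $\varphi\simeq\varphi_{\mathrm{an}}\perp k\times\langle0\rangle$ with $\varphi_{\mathrm{an}}$ anisotropic, unique up to isometry (the anisotropic part); $\mathfrak{i}_{\mathrm d}(\varphi):=k$ is the defect. For a field extension $E/F$, $\varphi_E$ is the form on $E\otimes_F V$ with $\varphi_E(e\otimes v)=e^2\varphi(v)$. Weak Vishik equivalence of $\varphi,\psi$: $\dim\varphi=\dim\psi$ and $\mathfrak{i}_{\mathrm d}(\varphi_{F(\sqrt a)})=\mathfrak{i}_{\mathrm d}(\psi_{F(\sqrt a)})$ for every $a\in F$. Let $D_F^*(\varphi)=\{\varphi(v)\mid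 v\in V\}\setminus\{0\}$. The norm field is $N_F(\varphi)=F^2(a/b\mid a,b\in D_F^*(\varphi))$, and the norm degree is $\mathrm{ndeg}_F\varphi=[N_F(\varphi):F^2]$ (finite). An anisotropic form $\varphi$ is minimal over $F$ if $\mathrm{ndeg}_F\varphi=2^{\dim\varphi-1}$. *)

theory Defs
  imports "Jordan_Normal_Form.Missing_VectorSpace" "HOL-Algebra.Generated_Fields"
    "HOL-Algebra.Embedded_Algebras"
begin

section \<open>Totally singular quadratic forms\<close>

text \<open>A form on the \<open>K\<close>-vector space \<open>V\<close> is a function on the carrier of \<open>V\<close>; its values
  outside the carrier are irrelevant.\<close>

locale ts_form = vectorspace K V
  for K :: "('k, 'm) ring_scheme" (structure) and V :: "('k, 'v, 'n) module_scheme" +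
  fixes \<phi> :: "'v \<Rightarrow> 'k"
  assumes char_two: "\<one> \<oplus> \<one> = \<zero>"
    and finite_dim: "fin_dim"
    and form_closed: "v \<in> carrier V \<Longrightarrow> \<phi> v \<in> carrier K"
    and form_smult: "\<lbrakk>a \<in> carrier K; v \<in> carrier V\<rbrakk> \<Longrightarrow> \<phi> (a \<odot>\<^bsub>V\<^esub> v) = (a \<otimes> a) \<otimes> \<phi> v"
    and form_add: "\<lbrakk>v \<in> carrier V; w \<in> carrier V\<rbrakk> \<Longrightarrow> \<phi> (v \<oplus>\<^bsub>V\<^esub> w) = \<phi> v \<oplus> \<phi> w"

definition isometric ::
  "('k, 'm) ring_scheme \<Rightarrow> ('k, 'v, 'n) module_scheme \<Rightarrow> ('v \<Rightarrow> 'k) \<Rightarrow>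
   ('k, 'w, 'p) module_scheme \<Rightarrow> ('w \<Rightarrow> 'k) \<Rightarrow> bool" where
  "isometric K V \<phi> W \<psi> \<longleftrightarrow>
     (\<exists>f. linear_map K V W f \<and> bij_betw f (carrier V) (carrier W) \<and>
          (\<forall>v\<in>carrier V. \<phi> v = \<psi> (f v)))"

definition similar ::
  "('k, 'm) ring_scheme \<Rightarrow> ('k, 'v, 'n) module_scheme \<Rightarrow> ('v \<Rightarrow> 'k) \<Rightarrow>
   ('k, 'w, 'p) module_scheme \<Rightarrow> ('w \<Rightarrow> 'k) \<Rightarrow> bool" where
  "similar K V \<phi> W \<psi> \<longleftrightarrow>
     (\<exists>c\<in>carrier K - {\<zero>\<^bsub>K\<^esub>}. isometric K V \<phi> W (\<lambda>w. c \<otimes>\<^bsub>K\<^esub> \<psi> w))"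

definition isotropic ::
  "('k, 'm) ring_scheme \<Rightarrow> ('k, 'v, 'n) module_scheme \<Rightarrow> ('v \<Rightarrow> 'k) \<Rightarrow> bool" where
  "isotropic K V \<phi> \<longleftrightarrow> (\<exists>v\<in>carrier V - {\<zero>\<^bsub>V\<^esub>}. \<phi> v = \<zero>\<^bsub>K\<^esub>)"

abbreviation anisotropic ::
  "('k, 'm) ring_scheme \<Rightarrow> ('k, 'v, 'n) module_scheme \<Rightarrow> ('v \<Rightarrow> 'k) \<Rightarrow> bool" where
  "anisotropic K V \<phi> \<equiv> \<not> isotropic K V \<phi>"


subsection \<open>Anisotropic part and defect\<close>

text \<open>The space \<open>K\<^sup>n\<close> is \<open>ring.func_space K {..<n}\<close>, and
  \<open>diag_form K n a\<close> is the form \<open>\<langle>a 0, \<dots>, a (n - 1)\<rangle>\<close> on it.\<close>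

definition diag_form :: "('k, 'm) ring_scheme \<Rightarrow> nat \<Rightarrow> (nat \<Rightarrow> 'k) \<Rightarrow> (nat \<Rightarrow> 'k) \<Rightarrow> 'k" where
  "diag_form K n a = (\<lambda>x. \<Oplus>\<^bsub>K\<^esub>i\<in>{..<n}. a i \<otimes>\<^bsub>K\<^esub> (x i \<otimes>\<^bsub>K\<^esub> x i))"

text \<open>The orthogonal sum of two forms lives on \<^const>\<open>direct_sum\<close> of the underlying spaces.\<close>

definition orth_sum :: "('k, 'm) ring_scheme \<Rightarrow> ('v \<Rightarrow> 'k) \<Rightarrow> ('w \<Rightarrow> 'k) \<Rightarrow> 'v \<times> 'w \<Rightarrow> 'k" where
  "orth_sum K \<phi> \<psi> = (\<lambda>(v, w). \<phi> v \<oplus>\<^bsub>K\<^esub> \<psi> w)"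

text \<open>\<open>\<phi> \<simeq> \<sigma> \<bottom> k \<times> \<langle>0\<rangle>\<close> with \<open>\<sigma>\<close> an anisotropic form on \<open>U\<close>.\<close>

definition an_decomposition ::
  "('k, 'm) ring_scheme \<Rightarrow> ('k, 'v, 'n) module_scheme \<Rightarrow> ('v \<Rightarrow> 'k) \<Rightarrow>
   ('k, 'u, 'p) module_scheme \<Rightarrow> ('u \<Rightarrow> 'k) \<Rightarrow> nat \<Rightarrow> bool" where
  "an_decomposition K V \<phi> U \<sigma> k \<longleftrightarrow>
     ts_form K U \<sigma> \<and> anisotropic K U \<sigma> \<and>
     isometric K V \<phi> (direct_sum U (ring.func_space K {..<k}))
       (orth_sum K \<sigma> (diag_form K k (\<lambda>_. \<zero>\<^bsub>K\<^esub>)))"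

definition anisotropic_part ::
  "('k, 'm) ring_scheme \<Rightarrow> ('k, 'v, 'n) module_scheme \<Rightarrow> ('v \<Rightarrow> 'k) \<Rightarrow>
   ('k, 'u, 'p) module_scheme \<Rightarrow> ('u \<Rightarrow> 'k) \<Rightarrow> bool" where
  "anisotropic_part K V \<phi> U \<sigma> \<longleftrightarrow> (\<exists>k. an_decomposition K V \<phi> U \<sigma> k)"

text \<open>In the defect, the anisotropic part may be taken on the type of \<open>V\<close>, since it is
  isometric to the restriction of \<open>\<phi>\<close> to a subspace of \<open>V\<close>.\<close>

definition defect ::
  "('k, 'm) ring_scheme \<Rightarrow> ('k, 'v, 'n) module_scheme \<Rightarrow> ('v \<Rightarrow> 'k) \<Rightarrow> nat" where
  "defect K V \<phi> =
     (THE k. \<exists>(U :: ('k, 'v) module) \<sigma>. an_decomposition K V \<phi> U \<sigma> k)"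


subsection \<open>Norm field and minimal forms\<close>

definition squares :: "('k, 'm) ring_scheme \<Rightarrow> 'k set" where
  "squares K = {x \<otimes>\<^bsub>K\<^esub> x | x. x \<in> carrier K}"

definition nonzero_values ::
  "('k, 'm) ring_scheme \<Rightarrow> ('k, 'v, 'n) module_scheme \<Rightarrow> ('v \<Rightarrow> 'k) \<Rightarrow> 'k set" where
  "nonzero_values K V \<phi> = \<phi> ` carrier V - {\<zero>\<^bsub>K\<^esub>}"

definition norm_field ::
  "('k, 'm) ring_scheme \<Rightarrow> ('k, 'v, 'n) module_scheme \<Rightarrow> ('v \<Rightarrow> 'k) \<Rightarrow> 'k set" where
  "norm_field K V \<phi> = generate_field K
     (squares K \<union>
      {a \<otimes>\<^bsub>K\<^esub> inv\<^bsub>K\<^esub> b | a b. a \<in> nonzero_values K V \<phi> \<and> b \<in> nonzero_values K V \<phi>})"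

definition norm_degree ::
  "('k, 'm) ring_scheme \<Rightarrow> ('k, 'v, 'n) module_scheme \<Rightarrow> ('v \<Rightarrow> 'k) \<Rightarrow> nat" where
  "norm_degree K V \<phi> = (ring.dim K over squares K) (norm_field K V \<phi>)"

text \<open>The condition on the dimension excludes the form on the zero space, for which
  \<open>2\<close> to the power \<open>dim - 1\<close> would be \<open>1/2\<close>, but is \<open>1\<close> with the truncated subtraction
  on \<^typ>\<open>nat\<close>.\<close>

definition minimal_form ::
  "('k, 'm) ring_scheme \<Rightarrow> ('k, 'v, 'n) module_scheme \<Rightarrow> ('v \<Rightarrow> 'k) \<Rightarrow> bool" where
  "minimal_form K V \<phi> \<longleftrightarrow>
     ts_form K V \<phi> \<and> anisotropic K V \<phi> \<and> 1 \<le> vectorspace.dim K V \<and>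
     norm_degree K V \<phi> = 2 ^ (vectorspace.dim K V - 1)"


section \<open>Extension of scalars\<close>

text \<open>The free module on a set \<open>S\<close> consists of the finitely supported functions.\<close>

definition free_module :: "('k, 'm) ring_scheme \<Rightarrow> 's set \<Rightarrow> ('k, 's \<Rightarrow> 'k) module" where
  "free_module K S = (ring.func_space K S)
     \<lparr>carrier := {f \<in> S \<rightarrow>\<^sub>E carrier K. finite {s \<in> S. f s \<noteq> \<zero>\<^bsub>K\<^esub>}}\<rparr>"

definition free_gen :: "('k, 'm) ring_scheme \<Rightarrow> 's set \<Rightarrow> 's \<Rightarrow> 's \<Rightarrow> 'k" where
  "free_gen K S s = (\<lambda>t\<in>S. if t = s then \<one>\<^bsub>K\<^esub> else \<zero>\<^bsub>K\<^esub>)"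

text \<open>As in \<^const>\<open>direct_sum\<close>, the fields \<^const>\<open>mult\<close> and \<^const>\<open>one\<close> carry no meaning.\<close>

definition quotient_module ::
  "('k, 'v, 'n) module_scheme \<Rightarrow> 'v set \<Rightarrow> ('k, 'v set) module" where
  "quotient_module M N =
     \<lparr>carrier = a_rcosets\<^bsub>M\<^esub> N, mult = (\<lambda>X Y. N), one = N, zero = N, add = set_add M,
      smult = (\<lambda>c X. \<Union>x\<in>X. N +>\<^bsub>M\<^esub> (c \<odot>\<^bsub>M\<^esub> x))\<rparr>"

text \<open>For a field extension given by an embedding \<open>h\<close> of \<open>F\<close> into \<open>E\<close>, the \<open>E\<close>-vector space
  \<open>E \<otimes>\<^sub>F V\<close> is presented by generators \<open>1 \<otimes> v\<close> for \<open>v \<in> V\<close>, and relations saying that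
  \<open>v \<mapsto> 1 \<otimes> v\<close> is \<open>F\<close>-linear.\<close>

definition tensor_relations ::
  "('e, 'q) ring_scheme \<Rightarrow> ('k \<Rightarrow> 'e) \<Rightarrow> ('k, 'm) ring_scheme \<Rightarrow> ('k, 'v, 'n) module_scheme \<Rightarrow>
   ('v \<Rightarrow> 'e) set" where
  "tensor_relations E h F V =
     (let M = free_module E (carrier V); \<delta> = free_gen E (carrier V) in
      LinearCombinations.module.span E M
        ({\<delta> (v \<oplus>\<^bsub>V\<^esub> w) \<ominus>\<^bsub>M\<^esub> (\<delta> v \<oplus>\<^bsub>M\<^esub> \<delta> w) | v w. v \<in> carrier V \<and> w \<in> carrier V} \<union>
         {\<delta> (c \<odot>\<^bsub>V\<^esub> v) \<ominus>\<^bsub>M\<^esub> h c \<odot>\<^bsub>M\<^esub> \<delta> v | c v. c \<in> carrier F \<and> v \<in> carrier V}))"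

definition ext_space ::
  "('e, 'q) ring_scheme \<Rightarrow> ('k \<Rightarrow> 'e) \<Rightarrow> ('k, 'm) ring_scheme \<Rightarrow> ('k, 'v, 'n) module_scheme \<Rightarrow>
   ('e, ('v \<Rightarrow> 'e) set) module" where
  "ext_space E h F V =
     quotient_module (free_module E (carrier V)) (tensor_relations E h F V)"

definition pure_tensor ::
  "('e, 'q) ring_scheme \<Rightarrow> ('k \<Rightarrow> 'e) \<Rightarrow> ('k, 'm) ring_scheme \<Rightarrow> ('k, 'v, 'n) module_scheme \<Rightarrow>
   'e \<Rightarrow> 'v \<Rightarrow> ('v \<Rightarrow> 'e) set" where
  "pure_tensor E h F V e v =
     tensor_relations E h F V +>\<^bsub>free_module E (carrier V)\<^esub>
       (e \<odot>\<^bsub>free_module E (carrier V)\<^esub> free_gen E (carrier V) v)"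

definition ext_form ::
  "('e, 'q) ring_scheme \<Rightarrow> ('k \<Rightarrow> 'e) \<Rightarrow> ('k, 'm) ring_scheme \<Rightarrow> ('k, 'v, 'n) module_scheme \<Rightarrow>
   ('v \<Rightarrow> 'k) \<Rightarrow> ('v \<Rightarrow> 'e) set \<Rightarrow> 'e" where
  "ext_form E h F V \<phi> =
     (THE q. ts_form E (ext_space E h F V) q \<and> q \<in> extensional (carrier (ext_space E h F V)) \<and>
       (\<forall>e\<in>carrier E. \<forall>v\<in>carrier V.
          q (pure_tensor E h F V e v) = (e \<otimes>\<^bsub>E\<^esub> e) \<otimes>\<^bsub>E\<^esub> h (\<phi> v)))"


section \<open>Weak Vishik equivalence\<close>

text \<open>The field \<open>F(\<surd>a)\<close>, where the pair \<open>(x, y)\<close> stands for \<open>x + y \<surd>a\<close>; if \<open>a\<close> is a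
  square in \<open>F\<close>, then \<open>F(\<surd>a) = F\<close>, and only the pairs \<open>(x, 0)\<close> are used.\<close>

definition adjoin_sqrt :: "('k, 'm) ring_scheme \<Rightarrow> 'k \<Rightarrow> ('k \<times> 'k) ring" where
  "adjoin_sqrt F a =
     \<lparr>carrier = (if a \<in> squares F then carrier F \<times> {\<zero>\<^bsub>F\<^esub>} else carrier F \<times> carrier F),
      mult = (\<lambda>(x, y) (x', y'). (x \<otimes>\<^bsub>F\<^esub> x' \<oplus>\<^bsub>F\<^esub> a \<otimes>\<^bsub>F\<^esub> (y \<otimes>\<^bsub>F\<^esub> y'), x \<otimes>\<^bsub>F\<^esub> y' \<oplus>\<^bsub>F\<^esub> y \<otimes>\<^bsub>F\<^esub> x')),
      one = (\<one>\<^bsub>F\<^esub>, \<zero>\<^bsub>F\<^esub>),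
      zero = (\<zero>\<^bsub>F\<^esub>, \<zero>\<^bsub>F\<^esub>),
      add = (\<lambda>(x, y) (x', y'). (x \<oplus>\<^bsub>F\<^esub> x', y \<oplus>\<^bsub>F\<^esub> y'))\<rparr>"

definition sqrt_embed :: "('k, 'm) ring_scheme \<Rightarrow> 'k \<Rightarrow> 'k \<times> 'k" where
  "sqrt_embed F x = (x, \<zero>\<^bsub>F\<^esub>)"

definition weakly_vishik_equivalent ::
  "('k, 'm) ring_scheme \<Rightarrow> ('k, 'v, 'n) module_scheme \<Rightarrow> ('v \<Rightarrow> 'k) \<Rightarrow>
   ('k, 'w, 'p) module_scheme \<Rightarrow> ('w \<Rightarrow> 'k) \<Rightarrow> bool" where
  "weakly_vishik_equivalent F V \<phi> W \<psi> \<longleftrightarrow>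
     vectorspace.dim F V = vectorspace.dim F W \<and>
     (\<forall>a\<in>carrier F.
        let E = adjoin_sqrt F a; h = sqrt_embed F in
        defect E (ext_space E h F V) (ext_form E h F V \<phi>) =
        defect E (ext_space E h F W) (ext_form E h F W \<psi>))"


section \<open>The constructions are well defined\<close>

subsection \<open>\<open>F(\<surd>a)\<close> is generated by \<open>F\<close> and a square root of \<open>a\<close>\<close>

context field begin

lemma char_two_neg:
  assumes "\<one> \<oplus> \<one> = \<zero>" "x \<in> carrier R"
  shows "x \<oplus> x = \<zero>"
proof -
  have "x \<oplus> x = (\<one> \<oplus> \<one>) \<otimes> x" using assms(2) by (simp add: l_distr)
  thus ?thesis using assms by simp
qed

lemma adjoin_sqrt_aux:
  assumes c: "\<one> \<oplus> \<one> = \<zero>" and a: "a \<in> carrier R" "a \<notin> squares R"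
    and xy: "x \<in> carrier R" "y \<in> carrier R" "x \<otimes> x \<oplus> a \<otimes> (y \<otimes> y) = \<zero>"
  shows "y = \<zero>" "x = \<zero>"
proof -
  have eq: "a \<otimes> (y \<otimes> y) = x \<otimes> x"
  proof -
    have "x \<otimes> x = x \<otimes> x \<oplus> (x \<otimes> x \<oplus> a \<otimes> (y \<otimes> y))" using xy by simp
    also have "\<dots> = (x \<otimes> x \<oplus> x \<otimes> x) \<oplus> a \<otimes> (y \<otimes> y)" using xy(1,2) a by (simp add: a_assoc)
    finally show ?thesis using char_two_neg[OF c, of "x \<otimes> x"] xy(1,2) a by simp
  qed
  show y0: "y = \<zero>"
  proof (rule ccontr)
    assume "y \<noteq> \<zero>"
    hence u: "y \<in> Units R" using xy by (simp add: field_Units)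
    have "a = a \<otimes> ((y \<otimes> inv y) \<otimes> (y \<otimes> inv y))" using a u by simp
    also have "\<dots> = a \<otimes> (y \<otimes> y) \<otimes> (inv y \<otimes> inv y)" using a u xy by (simp add: m_ac del: Units_r_inv Units_l_inv)
    also have "\<dots> = (x \<otimes> inv y) \<otimes> (x \<otimes> inv y)" unfolding eq using u xy by (simp add: m_ac)
    finally show False using a u xy unfolding squares_def by blast
  qed
  show "x = \<zero>" using eq y0 xy a integral[of x x] by simp
qed

lemma adjoin_sqrt_cring:
  assumes a: "a \<in> carrier R"
  shows "cring (adjoin_sqrt R a)"
proof (intro cringI abelian_groupI comm_monoidI)
  fix x assume x: "x \<in> carrier (adjoin_sqrt R a)"
  show "\<exists>y\<in>carrier (adjoin_sqrt R a). y \<oplus>\<^bsub>adjoin_sqrt R a\<^esub> x = \<zero>\<^bsub>adjoin_sqrt R a\<^esub>"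
    using x by (intro bexI[of _ "(\<ominus> fst x, \<ominus> snd x)"])
      (auto simp: adjoin_sqrt_def l_neg split: if_splits)
next
  fix x y z
  assume "x \<in> carrier (adjoin_sqrt R a)" "y \<in> carrier (adjoin_sqrt R a)" "z \<in> carrier (adjoin_sqrt R a)"
  then obtain x1 x2 y1 y2 z1 z2 where xyz: "x = (x1, x2)" "y = (y1, y2)" "z = (z1, z2)"
    "x1 \<in> carrier R" "x2 \<in> carrier R" "y1 \<in> carrier R" "y2 \<in> carrier R" "z1 \<in> carrier R" "z2 \<in> carrier R"
    by (auto simp: adjoin_sqrt_def split: if_splits)
  show "(x \<otimes>\<^bsub>adjoin_sqrt R a\<^esub> y) \<otimes>\<^bsub>adjoin_sqrt R a\<^esub> z = x \<otimes>\<^bsub>adjoin_sqrt R a\<^esub> (y \<otimes>\<^bsub>adjoin_sqrt R a\<^esub> z)"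
    using xyz(4-9) a unfolding xyz(1-3) adjoin_sqrt_def by (auto; algebra)
  show "(x \<oplus>\<^bsub>adjoin_sqrt R a\<^esub> y) \<otimes>\<^bsub>adjoin_sqrt R a\<^esub> z
      = x \<otimes>\<^bsub>adjoin_sqrt R a\<^esub> z \<oplus>\<^bsub>adjoin_sqrt R a\<^esub> y \<otimes>\<^bsub>adjoin_sqrt R a\<^esub> z"
    using xyz(4-9) a unfolding xyz(1-3) adjoin_sqrt_def by (auto; algebra)
  show "(x \<oplus>\<^bsub>adjoin_sqrt R a\<^esub> y) \<oplus>\<^bsub>adjoin_sqrt R a\<^esub> z
      = x \<oplus>\<^bsub>adjoin_sqrt R a\<^esub> (y \<oplus>\<^bsub>adjoin_sqrt R a\<^esub> z)"
    using xyz(4-9) a unfolding xyz(1-3) adjoin_sqrt_def by (auto simp: a_ac)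
qed (use a in \<open>auto simp: adjoin_sqrt_def a_ac m_ac split: if_splits\<close>)

lemma adjoin_sqrt_field:
  assumes c: "\<one> \<oplus> \<one> = \<zero>" and a: "a \<in> carrier R"
  shows "field (adjoin_sqrt R a)"
proof -
  interpret E: cring "adjoin_sqrt R a" by (rule adjoin_sqrt_cring[OF a])
  show ?thesis
  proof (rule E.cring_fieldI2)
    show "\<zero>\<^bsub>adjoin_sqrt R a\<^esub> \<noteq> \<one>\<^bsub>adjoin_sqrt R a\<^esub>" by (simp add: adjoin_sqrt_def)
    fix z assume z: "z \<in> carrier (adjoin_sqrt R a)" "z \<noteq> \<zero>\<^bsub>adjoin_sqrt R a\<^esub>"
    obtain x y where xy: "z = (x, y)" "x \<in> carrier R" "y \<in> carrier R" "a \<in> squares R \<Longrightarrow> y = \<zero>"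
      using z by (auto simp: adjoin_sqrt_def split: if_splits)
    define n where "n = x \<otimes> x \<oplus> a \<otimes> (y \<otimes> y)"
    have n: "n \<in> carrier R" using xy a by (simp add: n_def)
    have "n \<noteq> \<zero>"
    proof
      assume "n = \<zero>"
      show False
      proof (cases "a \<in> squares R")
        case True thus False using z xy a \<open>n = \<zero>\<close> integral[of x x] by (auto simp: n_def adjoin_sqrt_def)
      next
        case False thus False using adjoin_sqrt_aux[OF c a False xy(2,3)] \<open>n = \<zero>\<close> z xy
          by (auto simp: n_def adjoin_sqrt_def)
      qed
    qed
    hence u: "n \<in> Units R" using n by (simp add: field_Units)
    have 1: "x \<otimes> (x \<otimes> inv n) \<oplus> a \<otimes> (y \<otimes> (y \<otimes> inv n)) = \<one>"
    proof -
      have "n \<otimes> i = x \<otimes> (x \<otimes> i) \<oplus> a \<otimes> (y \<otimes> (y \<otimes> i))" if "i \<in> carrier R" for i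
        using xy a that unfolding n_def by (simp add: l_distr r_distr m_ac)
      from this[of "inv n"] show ?thesis using u by simp
    qed
    have 2: "x \<otimes> (y \<otimes> inv n) \<oplus> y \<otimes> (x \<otimes> inv n) = \<zero>"
      using char_two_neg[OF c, of "x \<otimes> y \<otimes> inv n"] xy Units_inv_closed[OF u] by (simp add: m_ac)
    show "\<exists>w\<in>carrier (adjoin_sqrt R a). z \<otimes>\<^bsub>adjoin_sqrt R a\<^esub> w = \<one>\<^bsub>adjoin_sqrt R a\<^esub>"
      using xy u 1 2 by (intro bexI[of _ "(x \<otimes> inv n, y \<otimes> inv n)"]) (auto simp: adjoin_sqrt_def)
  qed
qed

lemma sqrt_embed_hom:
  assumes "a \<in> carrier R"
  shows "sqrt_embed R \<in> ring_hom R (adjoin_sqrt R a)"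
  using assms by (auto simp: ring_hom_def sqrt_embed_def adjoin_sqrt_def)

lemma adjoin_sqrt_generated:
  assumes c: "\<one> \<oplus> \<one> = \<zero>" and a: "a \<in> carrier R"
  shows "\<exists>s\<in>carrier (adjoin_sqrt R a). s \<otimes>\<^bsub>adjoin_sqrt R a\<^esub> s = sqrt_embed R a \<and>
    carrier (adjoin_sqrt R a) = generate_field (adjoin_sqrt R a) (insert s (sqrt_embed R ` carrier R))"
proof -
  interpret E: field "adjoin_sqrt R a" by (rule adjoin_sqrt_field[OF c a])
  have gen: "carrier (adjoin_sqrt R a) = generate_field (adjoin_sqrt R a) (insert s (sqrt_embed R ` carrier R))"
    if s: "s \<in> carrier (adjoin_sqrt R a)" and "a \<notin> squares R \<Longrightarrow> s = (\<zero>, \<one>)" for s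
  proof
    let ?G = "generate_field (adjoin_sqrt R a) (insert s (sqrt_embed R ` carrier R))"
    have "sqrt_embed R ` carrier R \<subseteq> carrier (adjoin_sqrt R a)"
      by (auto simp: sqrt_embed_def adjoin_sqrt_def)
    thus "?G \<subseteq> carrier (adjoin_sqrt R a)" using s by (intro E.generate_field_incl) auto
    show "carrier (adjoin_sqrt R a) \<subseteq> ?G"
    proof
      fix z assume z: "z \<in> carrier (adjoin_sqrt R a)"
      obtain x y where xy: "z = (x, y)" "x \<in> carrier R" "y \<in> carrier R" "a \<in> squares R \<Longrightarrow> y = \<zero>"
        using z by (auto simp: adjoin_sqrt_def split: if_splits)
      have e: "sqrt_embed R t \<in> ?G" if "t \<in> carrier R" for t
        using that by (intro generate_field.incl) auto
      show "z \<in> ?G"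
      proof (cases "a \<in> squares R")
        case True thus ?thesis using e[OF xy(2)] xy by (simp add: sqrt_embed_def)
      next
        case False
        have "sqrt_embed R x \<oplus>\<^bsub>adjoin_sqrt R a\<^esub> (sqrt_embed R y \<otimes>\<^bsub>adjoin_sqrt R a\<^esub> s) \<in> ?G"
          using xy by (intro generate_field.eng_add generate_field.eng_mult e)
            (auto intro: generate_field.incl)
        thus ?thesis using xy a that(2)[OF False] by (simp add: sqrt_embed_def adjoin_sqrt_def)
      qed
    qed
  qed
  show ?thesis
  proof (cases "a \<in> squares R")
    case True
    then obtain b where b: "b \<in> carrier R" "a = b \<otimes> b" by (auto simp: squares_def)
    show ?thesis using True b gen[of "(b, \<zero>)"]
      by (intro bexI[of _ "(b, \<zero>)"]) (auto simp: adjoin_sqrt_def sqrt_embed_def)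
  next
    case False
    show ?thesis using False a gen[of "(\<zero>, \<one>)"]
      by (intro bexI[of _ "(\<zero>, \<one>)"]) (auto simp: adjoin_sqrt_def sqrt_embed_def)
  qed
qed

end


subsection \<open>Existence and uniqueness of the form on \<open>E \<otimes>\<^sub>F V\<close>\<close>

lemma quotient_abelian_subgroup:
  assumes "LinearCombinations.submodule K N M"
  shows "abelian_subgroup N M"
proof -
  interpret Module.module K M using assms by (simp add: LinearCombinations.submodule_def)
  interpret N: LinearCombinations.submodule K N M by fact
  have "\<ominus>\<^bsub>M\<^esub> x \<in> N" if "x \<in> N" for x
  proof -
    have "x \<in> carrier M" using that N.subset by auto
    hence "\<ominus>\<^bsub>M\<^esub> x = (\<ominus>\<^bsub>K\<^esub> \<one>\<^bsub>K\<^esub>) \<odot>\<^bsub>M\<^esub> x" by (simp add: smult_l_minus)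
    thus ?thesis using N.smult_closed[of "\<ominus>\<^bsub>K\<^esub> \<one>\<^bsub>K\<^esub>" x] that by simp
  qed
  moreover have "additive_subgroup N M"
    using N.subset calculation
    by (intro additive_subgroup.intro M.add.subgroupI) (auto simp: N.m_closed intro: N.zero_closed)
  ultimately show ?thesis by (intro abelian_subgroupI3) (auto intro: abelian_group_axioms)
qed

lemma quotient_smult:
  assumes "LinearCombinations.submodule K N M" "c \<in> carrier K" "x \<in> carrier M"
  shows "c \<odot>\<^bsub>quotient_module M N\<^esub> (N +>\<^bsub>M\<^esub> x) = N +>\<^bsub>M\<^esub> (c \<odot>\<^bsub>M\<^esub> x)"
proof -
  interpret Module.module K M using assms by (simp add: LinearCombinations.submodule_def)
  interpret N: LinearCombinations.submodule K N M by fact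
  interpret A: abelian_subgroup N M by (rule quotient_abelian_subgroup[OF assms(1)])
  have "N +>\<^bsub>M\<^esub> (c \<odot>\<^bsub>M\<^esub> y) = N +>\<^bsub>M\<^esub> (c \<odot>\<^bsub>M\<^esub> x)" if yN: "y \<in> N +>\<^bsub>M\<^esub> x" for y
  proof -
    obtain n where n: "n \<in> N" "y = n \<oplus>\<^bsub>M\<^esub> x" using yN by (auto simp: a_r_coset_def r_coset_def)
    have "c \<odot>\<^bsub>M\<^esub> y = (c \<odot>\<^bsub>M\<^esub> n) \<oplus>\<^bsub>M\<^esub> (c \<odot>\<^bsub>M\<^esub> x)"
      using n N.subset assms by (auto simp: smult_r_distr)
    hence "c \<odot>\<^bsub>M\<^esub> y \<in> N +>\<^bsub>M\<^esub> (c \<odot>\<^bsub>M\<^esub> x)"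
      using n assms by (auto simp: a_r_coset_def r_coset_def)
    from A.a_repr_independence'[OF this smult_closed[OF assms(2,3)]] show ?thesis by simp
  qed
  moreover have "x \<in> N +>\<^bsub>M\<^esub> x" using A.a_rcos_self assms by auto
  ultimately have "(\<Union>y\<in>N +>\<^bsub>M\<^esub> x. N +>\<^bsub>M\<^esub> (c \<odot>\<^bsub>M\<^esub> y)) = N +>\<^bsub>M\<^esub> (c \<odot>\<^bsub>M\<^esub> x)" by blast
  thus ?thesis by (simp add: quotient_module_def)
qed

lemma quotient_module_module:
  assumes s: "LinearCombinations.submodule K N M"
  shows "Module.module K (quotient_module M N)"
proof -
  interpret Module.module K M using assms by (simp add: LinearCombinations.submodule_def)
  interpret N: LinearCombinations.submodule K N M by fact
  interpret A: abelian_subgroup N M by (rule quotient_abelian_subgroup[OF assms(1)])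
  let ?Q = "quotient_module M N"
  have rep: "\<exists>x\<in>carrier M. X = N +>\<^bsub>M\<^esub> x" if "X \<in> carrier ?Q" for X
    using that by (auto simp: quotient_module_def A_RCOSETS_def RCOSETS_def a_r_coset_def)
  have mem: "N +>\<^bsub>M\<^esub> x \<in> carrier ?Q" if "x \<in> carrier M" for x
    using that by (auto simp: quotient_module_def A_RCOSETS_def RCOSETS_def a_r_coset_def)
  have add: "(N +>\<^bsub>M\<^esub> x) \<oplus>\<^bsub>?Q\<^esub> (N +>\<^bsub>M\<^esub> y) = N +>\<^bsub>M\<^esub> (x \<oplus>\<^bsub>M\<^esub> y)"
    if "x \<in> carrier M" "y \<in> carrier M" for x y
    using A.a_rcos_sum[OF that] by (simp add: quotient_module_def)
  have z: "\<zero>\<^bsub>?Q\<^esub> = N +>\<^bsub>M\<^esub> \<zero>\<^bsub>M\<^esub>"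
    using M.a_coset_add_zero[OF N.subset] by (simp add: quotient_module_def)
  note sm = quotient_smult[OF s]
  show ?thesis
  proof (rule module_criteria)
    show "cring K" by (rule is_cring)
    show "\<zero>\<^bsub>?Q\<^esub> \<in> carrier ?Q" unfolding z by (rule mem) simp
    show "\<forall>v\<in>carrier ?Q. \<exists>w\<in>carrier ?Q. v \<oplus>\<^bsub>?Q\<^esub> w = \<zero>\<^bsub>?Q\<^esub>"
    proof
      fix v assume "v \<in> carrier ?Q"
      then obtain x where x: "x \<in> carrier M" "v = N +>\<^bsub>M\<^esub> x" using rep by auto
      show "\<exists>w\<in>carrier ?Q. v \<oplus>\<^bsub>?Q\<^esub> w = \<zero>\<^bsub>?Q\<^esub>"
        using x by (intro bexI[of _ "N +>\<^bsub>M\<^esub> (\<ominus>\<^bsub>M\<^esub> x)"]) (auto simp: z add M.r_neg intro: mem)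
    qed
  next
    have two: "\<forall>v w. v \<in> carrier ?Q \<and> w \<in> carrier ?Q \<longrightarrow> P v w"
      if "\<And>x y. x \<in> carrier M \<Longrightarrow> y \<in> carrier M \<Longrightarrow> P (N +>\<^bsub>M\<^esub> x) (N +>\<^bsub>M\<^esub> y)" for P
      using that rep by metis
    show "\<forall>v w. v \<in> carrier ?Q \<and> w \<in> carrier ?Q \<longrightarrow> v \<oplus>\<^bsub>?Q\<^esub> w \<in> carrier ?Q"
      by (rule two) (simp add: add mem)
    show "\<forall>v w. v \<in> carrier ?Q \<and> w \<in> carrier ?Q \<longrightarrow> v \<oplus>\<^bsub>?Q\<^esub> w = w \<oplus>\<^bsub>?Q\<^esub> v"
      by (rule two) (simp add: add M.a_comm)
    show "\<forall>v\<in>carrier ?Q. v \<oplus>\<^bsub>?Q\<^esub> \<zero>\<^bsub>?Q\<^esub> = v"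
    proof
      fix v assume "v \<in> carrier ?Q"
      then obtain x where "x \<in> carrier M" "v = N +>\<^bsub>M\<^esub> x" using rep by auto
      thus "v \<oplus>\<^bsub>?Q\<^esub> \<zero>\<^bsub>?Q\<^esub> = v" unfolding z by (simp only: add M.zero_closed M.r_zero)
    qed
    show "\<forall>v\<in>carrier ?Q. \<one>\<^bsub>K\<^esub> \<odot>\<^bsub>?Q\<^esub> v = v"
    proof
      fix v assume "v \<in> carrier ?Q"
      then obtain x where "x \<in> carrier M" "v = N +>\<^bsub>M\<^esub> x" using rep by auto
      thus "\<one>\<^bsub>K\<^esub> \<odot>\<^bsub>?Q\<^esub> v = v" by (simp add: sm)
    qed
    show "\<forall>c v. c \<in> carrier K \<and> v \<in> carrier ?Q \<longrightarrow> c \<odot>\<^bsub>?Q\<^esub> v \<in> carrier ?Q"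
    proof (intro allI impI)
      fix c v assume cv: "c \<in> carrier K \<and> v \<in> carrier ?Q"
      then obtain x where "x \<in> carrier M" "v = N +>\<^bsub>M\<^esub> x" using rep by auto
      thus "c \<odot>\<^bsub>?Q\<^esub> v \<in> carrier ?Q" using cv by (simp add: sm mem)
    qed
    show "\<forall>v w x. v \<in> carrier ?Q \<and> w \<in> carrier ?Q \<and> x \<in> carrier ?Q \<longrightarrow>
        (v \<oplus>\<^bsub>?Q\<^esub> w) \<oplus>\<^bsub>?Q\<^esub> x = v \<oplus>\<^bsub>?Q\<^esub> (w \<oplus>\<^bsub>?Q\<^esub> x)"
    proof (intro allI impI)
      fix v w x assume "v \<in> carrier ?Q \<and> w \<in> carrier ?Q \<and> x \<in> carrier ?Q"
      then obtain v' w' x' where "v' \<in> carrier M" "v = N +>\<^bsub>M\<^esub> v'" "w' \<in> carrier M" "w = N +>\<^bsub>M\<^esub> w'"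
        "x' \<in> carrier M" "x = N +>\<^bsub>M\<^esub> x'" using rep by metis
      thus "(v \<oplus>\<^bsub>?Q\<^esub> w) \<oplus>\<^bsub>?Q\<^esub> x = v \<oplus>\<^bsub>?Q\<^esub> (w \<oplus>\<^bsub>?Q\<^esub> x)" by (simp add: add M.a_assoc)
    qed
    show "\<forall>a b v. a \<in> carrier K \<and> b \<in> carrier K \<and> v \<in> carrier ?Q \<longrightarrow>
        (a \<otimes>\<^bsub>K\<^esub> b) \<odot>\<^bsub>?Q\<^esub> v = a \<odot>\<^bsub>?Q\<^esub> (b \<odot>\<^bsub>?Q\<^esub> v)"
    proof (intro allI impI)
      fix a b v assume ab: "a \<in> carrier K \<and> b \<in> carrier K \<and> v \<in> carrier ?Q"
      then obtain x where "x \<in> carrier M" "v = N +>\<^bsub>M\<^esub> x" using rep by auto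
      thus "(a \<otimes>\<^bsub>K\<^esub> b) \<odot>\<^bsub>?Q\<^esub> v = a \<odot>\<^bsub>?Q\<^esub> (b \<odot>\<^bsub>?Q\<^esub> v)" using ab by (simp add: sm smult_assoc1)
    qed
    show "\<forall>a b v. a \<in> carrier K \<and> b \<in> carrier K \<and> v \<in> carrier ?Q \<longrightarrow>
        (a \<oplus>\<^bsub>K\<^esub> b) \<odot>\<^bsub>?Q\<^esub> v = (a \<odot>\<^bsub>?Q\<^esub> v) \<oplus>\<^bsub>?Q\<^esub> (b \<odot>\<^bsub>?Q\<^esub> v)"
    proof (intro allI impI)
      fix a b v assume ab: "a \<in> carrier K \<and> b \<in> carrier K \<and> v \<in> carrier ?Q"
      then obtain x where "x \<in> carrier M" "v = N +>\<^bsub>M\<^esub> x" using rep by auto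
      thus "(a \<oplus>\<^bsub>K\<^esub> b) \<odot>\<^bsub>?Q\<^esub> v = (a \<odot>\<^bsub>?Q\<^esub> v) \<oplus>\<^bsub>?Q\<^esub> (b \<odot>\<^bsub>?Q\<^esub> v)"
        using ab by (simp add: sm add smult_l_distr)
    qed
    show "\<forall>a v w. a \<in> carrier K \<and> v \<in> carrier ?Q \<and> w \<in> carrier ?Q \<longrightarrow>
        a \<odot>\<^bsub>?Q\<^esub> (v \<oplus>\<^bsub>?Q\<^esub> w) = (a \<odot>\<^bsub>?Q\<^esub> v) \<oplus>\<^bsub>?Q\<^esub> (a \<odot>\<^bsub>?Q\<^esub> w)"
    proof (intro allI impI)
      fix a v w assume ab: "a \<in> carrier K \<and> v \<in> carrier ?Q \<and> w \<in> carrier ?Q"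
      then obtain x y where "x \<in> carrier M" "v = N +>\<^bsub>M\<^esub> x" "y \<in> carrier M" "w = N +>\<^bsub>M\<^esub> y" using rep by metis
      thus "a \<odot>\<^bsub>?Q\<^esub> (v \<oplus>\<^bsub>?Q\<^esub> w) = (a \<odot>\<^bsub>?Q\<^esub> v) \<oplus>\<^bsub>?Q\<^esub> (a \<odot>\<^bsub>?Q\<^esub> w)"
        using ab by (simp add: sm add smult_r_distr)
    qed
  qed
qed

lemma free_module_submodule:
  assumes "cring K"
  shows "LinearCombinations.submodule K (carrier (free_module K S)) (ring.func_space K S)"
proof -
  interpret cring K by fact
  have fin: "finite {s \<in> S. f s \<oplus>\<^bsub>K\<^esub> g s \<noteq> \<zero>\<^bsub>K\<^esub>}"
    if "finite {s \<in> S. f s \<noteq> \<zero>\<^bsub>K\<^esub>}" "finite {s \<in> S. g s \<noteq> \<zero>\<^bsub>K\<^esub>}" for f g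
    by (rule finite_subset[OF _ finite_UnI[OF that]]) auto
  have fin2: "finite {s \<in> S. c \<otimes>\<^bsub>K\<^esub> f s \<noteq> \<zero>\<^bsub>K\<^esub>}"
    if "finite {s \<in> S. f s \<noteq> \<zero>\<^bsub>K\<^esub>}" "c \<in> carrier K" for f c
    by (rule finite_subset[OF _ that(1)]) (use that(2) in auto)
  have mem: "f \<in> carrier (free_module K S) \<longleftrightarrow> f \<in> S \<rightarrow>\<^sub>E carrier K \<and> finite {s \<in> S. f s \<noteq> \<zero>\<^bsub>K\<^esub>}" for f
    by (simp add: free_module_def)
  show ?thesis
  proof (intro LinearCombinations.submodule.intro func_space_is_module)
    show "carrier (free_module K S) \<subseteq> carrier (func_space S)"
      by (auto simp: mem func_space_def)
    show "\<zero>\<^bsub>func_space S\<^esub> \<in> carrier (free_module K S)"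
      by (simp add: mem func_space_def cong: conj_cong)
  next
    fix f g assume "f \<in> carrier (free_module K S)" "g \<in> carrier (free_module K S)"
    thus "f \<oplus>\<^bsub>func_space S\<^esub> g \<in> carrier (free_module K S)"
      using fin[of f g] by (simp add: mem func_space_def PiE_iff cong: conj_cong)
  next
    fix c f assume "c \<in> carrier K" "f \<in> carrier (free_module K S)"
    thus "c \<odot>\<^bsub>func_space S\<^esub> f \<in> carrier (free_module K S)"
      using fin2[of f c] by (simp add: mem func_space_def PiE_iff cong: conj_cong)
  qed
qed

lemma free_module_module:
  assumes "cring K"
  shows "Module.module K (free_module K S)"
proof -
  interpret cring K by fact
  interpret F: Module.module K "ring.func_space K S" by (rule func_space_is_module)
  have "Module.module K ((ring.func_space K S)\<lparr>carrier := carrier (free_module K S)\<rparr>)"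
    by (rule F.submodule_is_module[OF free_module_submodule[OF assms]])
  thus ?thesis by (simp add: free_module_def)
qed

lemma free_gen_closed:
  assumes "cring K"
  shows "free_gen K S s \<in> carrier (free_module K S)"
proof -
  interpret cring K by fact
  have "finite {t \<in> S. free_gen K S s t \<noteq> \<zero>\<^bsub>K\<^esub>}"
    by (rule finite_subset[of _ "{s}"]) (auto simp: free_gen_def)
  thus ?thesis by (auto simp: free_module_def free_gen_def)
qed

locale scalar_extension = f: ts_form F V \<phi> + E: field E
  for F :: "('k, 'm) ring_scheme" and V :: "('k, 'v, 'n) module_scheme" and \<phi> :: "'v \<Rightarrow> 'k"
    and E :: "('e, 'q) ring_scheme" +
  fixes h
  assumes h: "h \<in> ring_hom F E"
begin

abbreviation "S \<equiv> carrier V"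
abbreviation "M \<equiv> free_module E S"
abbreviation "\<delta> \<equiv> free_gen E S"
abbreviation "T \<equiv> tensor_relations E h F V"
abbreviation "X \<equiv> ext_space E h F V"
definition "supp f = {v \<in> S. f v \<noteq> \<zero>\<^bsub>E\<^esub>}"
definition "Q f = (\<Oplus>\<^bsub>E\<^esub>v\<in>supp f. (f v \<otimes>\<^bsub>E\<^esub> f v) \<otimes>\<^bsub>E\<^esub> h (\<phi> v))"

sublocale M: Module.module E M by (rule free_module_module) (rule E.is_cring)

lemma hc [simp]: "x \<in> carrier F \<Longrightarrow> h x \<in> carrier E" using h by (auto simp: ring_hom_def)
lemma hadd: "x \<in> carrier F \<Longrightarrow> y \<in> carrier F \<Longrightarrow> h (x \<oplus>\<^bsub>F\<^esub> y) = h x \<oplus>\<^bsub>E\<^esub> h y" using h by (auto simp: ring_hom_def)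
lemma hmul: "x \<in> carrier F \<Longrightarrow> y \<in> carrier F \<Longrightarrow> h (x \<otimes>\<^bsub>F\<^esub> y) = h x \<otimes>\<^bsub>E\<^esub> h y" using h by (auto simp: ring_hom_def)
lemma hone: "h \<one>\<^bsub>F\<^esub> = \<one>\<^bsub>E\<^esub>" using h by (auto simp: ring_hom_def)

lemma hzero: "h \<zero>\<^bsub>F\<^esub> = \<zero>\<^bsub>E\<^esub>"
  by (rule ring_hom_zero[OF h f.is_ring E.is_ring])

lemma E2: "x \<in> carrier E \<Longrightarrow> x \<oplus>\<^bsub>E\<^esub> x = \<zero>\<^bsub>E\<^esub>"
proof -
  assume x: "x \<in> carrier E"
  have "\<one>\<^bsub>E\<^esub> \<oplus>\<^bsub>E\<^esub> \<one>\<^bsub>E\<^esub> = h (\<one>\<^bsub>F\<^esub> \<oplus>\<^bsub>F\<^esub> \<one>\<^bsub>F\<^esub>)" by (simp add: hadd hone)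
  hence one: "\<one>\<^bsub>E\<^esub> \<oplus>\<^bsub>E\<^esub> \<one>\<^bsub>E\<^esub> = \<zero>\<^bsub>E\<^esub>" using f.char_two hzero by simp
  have "x \<oplus>\<^bsub>E\<^esub> x = (\<one>\<^bsub>E\<^esub> \<oplus>\<^bsub>E\<^esub> \<one>\<^bsub>E\<^esub>) \<otimes>\<^bsub>E\<^esub> x" using x by (simp add: E.l_distr)
  thus ?thesis using one x by simp
qed

lemma E2': "x \<in> carrier E \<Longrightarrow> y \<in> carrier E \<Longrightarrow> x \<oplus>\<^bsub>E\<^esub> (x \<oplus>\<^bsub>E\<^esub> y) = y"
  by (simp add: E.a_assoc[symmetric] E2)

lemma Mval: "f \<in> carrier M \<Longrightarrow> v \<in> S \<Longrightarrow> f v \<in> carrier E"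
  by (auto simp: free_module_def)

lemma Madd: "v \<in> S \<Longrightarrow> (f \<oplus>\<^bsub>M\<^esub> g) v = f v \<oplus>\<^bsub>E\<^esub> g v"
  by (auto simp: free_module_def E.func_space_def)

lemma Msm: "v \<in> S \<Longrightarrow> (c \<odot>\<^bsub>M\<^esub> g) v = c \<otimes>\<^bsub>E\<^esub> g v"
  by (auto simp: free_module_def E.func_space_def)

lemma Mz: "v \<in> S \<Longrightarrow> \<zero>\<^bsub>M\<^esub> v = \<zero>\<^bsub>E\<^esub>"
  by (auto simp: free_module_def E.func_space_def)

lemma Mfin: "f \<in> carrier M \<Longrightarrow> finite (supp f)"
  by (auto simp: free_module_def supp_def)

lemma Mext: "f \<in> carrier M \<Longrightarrow> g \<in> carrier M \<Longrightarrow> (\<And>v. v \<in> S \<Longrightarrow> f v = g v) \<Longrightarrow> f = g"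
  by (auto simp: free_module_def intro: PiE_ext)

lemma dM [simp]: "\<delta> v \<in> carrier M" by (rule free_gen_closed) (rule E.is_cring)

lemma tc: "f \<in> carrier M \<Longrightarrow> v \<in> S \<Longrightarrow> (f v \<otimes>\<^bsub>E\<^esub> f v) \<otimes>\<^bsub>E\<^esub> h (\<phi> v) \<in> carrier E"
  by (intro E.m_closed Mval hc f.form_closed)

lemma supp_S: "supp f \<subseteq> S" by (auto simp: supp_def)

lemma Qsum:
  assumes "f \<in> carrier M" "finite A" "supp f \<subseteq> A" "A \<subseteq> S"
  shows "Q f = (\<Oplus>\<^bsub>E\<^esub>v\<in>A. (f v \<otimes>\<^bsub>E\<^esub> f v) \<otimes>\<^bsub>E\<^esub> h (\<phi> v))"
  unfolding Q_def
proof (rule E.add.finprod_mono_neutral_cong_left)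
  show "finite A" "supp f \<subseteq> A" by fact+
  show "(f v \<otimes>\<^bsub>E\<^esub> f v) \<otimes>\<^bsub>E\<^esub> h (\<phi> v) = \<zero>\<^bsub>E\<^esub>" if "v \<in> A - supp f" for v
  proof -
    have "f v = \<zero>\<^bsub>E\<^esub>" "v \<in> S" using that assms(4) by (auto simp: supp_def)
    thus ?thesis using f.form_closed by simp
  qed
  show "(\<lambda>v. (f v \<otimes>\<^bsub>E\<^esub> f v) \<otimes>\<^bsub>E\<^esub> h (\<phi> v)) \<in> A \<rightarrow> carrier E"
    using tc[OF assms(1)] assms(4) by blast
qed simp

lemma Qc [simp]: "f \<in> carrier M \<Longrightarrow> Q f \<in> carrier E"
  unfolding Q_def using tc supp_S by (intro E.finsum_closed) blast

lemma Qadd: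
  assumes fg: "f \<in> carrier M" "g \<in> carrier M"
  shows "Q (f \<oplus>\<^bsub>M\<^esub> g) = Q f \<oplus>\<^bsub>E\<^esub> Q g"
proof -
  let ?A = "supp f \<union> supp g"
  have A: "finite ?A" "?A \<subseteq> S" using Mfin fg by (auto simp: supp_def)
  have s: "supp (f \<oplus>\<^bsub>M\<^esub> g) \<subseteq> ?A" by (auto simp: supp_def Madd)
  have sq: "(x \<oplus>\<^bsub>E\<^esub> y) \<otimes>\<^bsub>E\<^esub> (x \<oplus>\<^bsub>E\<^esub> y) = x \<otimes>\<^bsub>E\<^esub> x \<oplus>\<^bsub>E\<^esub> y \<otimes>\<^bsub>E\<^esub> y"
    if "x \<in> carrier E" "y \<in> carrier E" for x y
    using that by (simp add: E.l_distr E.r_distr E.m_comm[of y x] E.a_assoc E2')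
  have "Q (f \<oplus>\<^bsub>M\<^esub> g) = (\<Oplus>\<^bsub>E\<^esub>v\<in>?A. ((f \<oplus>\<^bsub>M\<^esub> g) v \<otimes>\<^bsub>E\<^esub> (f \<oplus>\<^bsub>M\<^esub> g) v) \<otimes>\<^bsub>E\<^esub> h (\<phi> v))"
    by (rule Qsum) (use fg A s in auto)
  also have "\<dots> = (\<Oplus>\<^bsub>E\<^esub>v\<in>?A. (f v \<otimes>\<^bsub>E\<^esub> f v) \<otimes>\<^bsub>E\<^esub> h (\<phi> v) \<oplus>\<^bsub>E\<^esub> (g v \<otimes>\<^bsub>E\<^esub> g v) \<otimes>\<^bsub>E\<^esub> h (\<phi> v))"
  proof (intro E.finsum_cong' Pi_I)
    fix v assume "v \<in> ?A"
    hence v: "v \<in> S" "f v \<in> carrier E" "g v \<in> carrier E" "h (\<phi> v) \<in> carrier E"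
      using A fg by (auto simp: Mval f.form_closed)
    show "((f \<oplus>\<^bsub>M\<^esub> g) v \<otimes>\<^bsub>E\<^esub> (f \<oplus>\<^bsub>M\<^esub> g) v) \<otimes>\<^bsub>E\<^esub> h (\<phi> v) =
      (f v \<otimes>\<^bsub>E\<^esub> f v) \<otimes>\<^bsub>E\<^esub> h (\<phi> v) \<oplus>\<^bsub>E\<^esub> (g v \<otimes>\<^bsub>E\<^esub> g v) \<otimes>\<^bsub>E\<^esub> h (\<phi> v)"
      unfolding Madd[OF v(1)] sq[OF v(2,3)] using v by (simp add: E.l_distr)
    show "(f v \<otimes>\<^bsub>E\<^esub> f v) \<otimes>\<^bsub>E\<^esub> h (\<phi> v) \<oplus>\<^bsub>E\<^esub> (g v \<otimes>\<^bsub>E\<^esub> g v) \<otimes>\<^bsub>E\<^esub> h (\<phi> v) \<in> carrier E"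
      using v by simp
  qed simp
  also have "\<dots> = (\<Oplus>\<^bsub>E\<^esub>v\<in>?A. (f v \<otimes>\<^bsub>E\<^esub> f v) \<otimes>\<^bsub>E\<^esub> h (\<phi> v)) \<oplus>\<^bsub>E\<^esub> (\<Oplus>\<^bsub>E\<^esub>v\<in>?A. (g v \<otimes>\<^bsub>E\<^esub> g v) \<otimes>\<^bsub>E\<^esub> h (\<phi> v))"
    using A tc[OF fg(1)] tc[OF fg(2)] by (intro E.finsum_addf) blast+
  also have "\<dots> = Q f \<oplus>\<^bsub>E\<^esub> Q g" using Qsum[of f ?A] Qsum[of g ?A] A fg by simp
  finally show ?thesis .
qed

lemma Qsm:
  assumes f: "f \<in> carrier M" "c \<in> carrier E"
  shows "Q (c \<odot>\<^bsub>M\<^esub> f) = (c \<otimes>\<^bsub>E\<^esub> c) \<otimes>\<^bsub>E\<^esub> Q f"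
proof -
  have A: "finite (supp f)" "supp f \<subseteq> S" using Mfin f by (auto simp: supp_def)
  have s: "supp (c \<odot>\<^bsub>M\<^esub> f) \<subseteq> supp f" using f by (auto simp: supp_def Msm)
  have "Q (c \<odot>\<^bsub>M\<^esub> f) = (\<Oplus>\<^bsub>E\<^esub>v\<in>supp f. ((c \<odot>\<^bsub>M\<^esub> f) v \<otimes>\<^bsub>E\<^esub> (c \<odot>\<^bsub>M\<^esub> f) v) \<otimes>\<^bsub>E\<^esub> h (\<phi> v))"
    by (rule Qsum) (use f A s in auto)
  also have "\<dots> = (\<Oplus>\<^bsub>E\<^esub>v\<in>supp f. (c \<otimes>\<^bsub>E\<^esub> c) \<otimes>\<^bsub>E\<^esub> ((f v \<otimes>\<^bsub>E\<^esub> f v) \<otimes>\<^bsub>E\<^esub> h (\<phi> v)))"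
  proof (intro E.finsum_cong' Pi_I)
    fix v assume "v \<in> supp f"
    hence v: "v \<in> S" "f v \<in> carrier E" "h (\<phi> v) \<in> carrier E"
      using A f by (auto simp: Mval f.form_closed)
    show "((c \<odot>\<^bsub>M\<^esub> f) v \<otimes>\<^bsub>E\<^esub> (c \<odot>\<^bsub>M\<^esub> f) v) \<otimes>\<^bsub>E\<^esub> h (\<phi> v) =
      (c \<otimes>\<^bsub>E\<^esub> c) \<otimes>\<^bsub>E\<^esub> ((f v \<otimes>\<^bsub>E\<^esub> f v) \<otimes>\<^bsub>E\<^esub> h (\<phi> v))"
      unfolding Msm[OF v(1)] using v f(2) by (simp add: E.m_ac)
    show "(c \<otimes>\<^bsub>E\<^esub> c) \<otimes>\<^bsub>E\<^esub> ((f v \<otimes>\<^bsub>E\<^esub> f v) \<otimes>\<^bsub>E\<^esub> h (\<phi> v)) \<in> carrier E"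
      using v f(2) by simp
  qed simp
  also have "\<dots> = (c \<otimes>\<^bsub>E\<^esub> c) \<otimes>\<^bsub>E\<^esub> (\<Oplus>\<^bsub>E\<^esub>v\<in>supp f. (f v \<otimes>\<^bsub>E\<^esub> f v) \<otimes>\<^bsub>E\<^esub> h (\<phi> v))"
    using A f tc[OF f(1)] by (intro E.finsum_rdistr[symmetric]) (auto simp del: E.m_closed)
  finally show ?thesis unfolding Q_def .
qed

lemma Qd: "v \<in> S \<Longrightarrow> Q (\<delta> v) = h (\<phi> v)"
proof -
  assume v: "v \<in> S"
  have d: "\<delta> v v = \<one>\<^bsub>E\<^esub>" using v by (simp add: free_gen_def)
  have "supp (\<delta> v) \<subseteq> {v}" by (auto simp: supp_def free_gen_def)
  hence "Q (\<delta> v) = (\<Oplus>\<^bsub>E\<^esub>w\<in>{v}. (\<delta> v w \<otimes>\<^bsub>E\<^esub> \<delta> v w) \<otimes>\<^bsub>E\<^esub> h (\<phi> w))"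
    using v by (intro Qsum) auto
  also have "\<dots> = (\<delta> v v \<otimes>\<^bsub>E\<^esub> \<delta> v v) \<otimes>\<^bsub>E\<^esub> h (\<phi> v)"
    using tc[OF dM[of v] v] by (simp del: E.m_closed)
  finally show ?thesis using v by (simp add: d f.form_closed)
qed

lemma Qminus:
  assumes "f \<in> carrier M" "g \<in> carrier M"
  shows "Q (f \<ominus>\<^bsub>M\<^esub> g) = Q f \<oplus>\<^bsub>E\<^esub> Q g"
proof -
  have "Q f = Q ((f \<ominus>\<^bsub>M\<^esub> g) \<oplus>\<^bsub>M\<^esub> g)" using assms by (simp add: a_minus_def M.M.a_assoc M.M.l_neg)
  hence "Q f = Q (f \<ominus>\<^bsub>M\<^esub> g) \<oplus>\<^bsub>E\<^esub> Q g" using assms by (simp add: Qadd)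
  thus ?thesis using assms by (simp add: E.a_assoc E2)
qed

definition "rels = {\<delta> (v \<oplus>\<^bsub>V\<^esub> w) \<ominus>\<^bsub>M\<^esub> (\<delta> v \<oplus>\<^bsub>M\<^esub> \<delta> w) | v w. v \<in> S \<and> w \<in> S} \<union>
         {\<delta> (c \<odot>\<^bsub>V\<^esub> v) \<ominus>\<^bsub>M\<^esub> h c \<odot>\<^bsub>M\<^esub> \<delta> v | c v. c \<in> carrier F \<and> v \<in> S}"

lemma T_eq: "T = LinearCombinations.module.span E M rels"
  by (simp add: tensor_relations_def rels_def Let_def)

lemma rels_sub: "rels \<subseteq> carrier M" by (auto simp: rels_def)

lemma T_sub: "LinearCombinations.submodule E T M"
  unfolding T_eq by (rule M.span_is_submodule[OF rels_sub])

lemma QT: "f \<in> T \<Longrightarrow> Q f = \<zero>\<^bsub>E\<^esub>"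
proof -
  assume f: "f \<in> T"
  let ?N = "{f \<in> carrier M. Q f = \<zero>\<^bsub>E\<^esub>}"
  have z: "Q \<zero>\<^bsub>M\<^esub> = \<zero>\<^bsub>E\<^esub>"
  proof -
    have "supp \<zero>\<^bsub>M\<^esub> = {}" by (auto simp: supp_def Mz)
    thus ?thesis by (simp add: Q_def)
  qed
  have "LinearCombinations.submodule E ?N M"
    by unfold_locales (auto simp: Qadd Qsm z)
  moreover have "rels \<subseteq> ?N"
    by (auto simp: rels_def Qminus Qadd Qsm Qd f.form_add f.form_smult hadd hmul f.form_closed E2)
  ultimately have "LinearCombinations.module.span E M rels \<subseteq> ?N"
    using M.span_is_subset by blast
  thus ?thesis using f T_eq by auto
qed

abbreviation cs where "cs x \<equiv> T +>\<^bsub>M\<^esub> x"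

sublocale A: abelian_subgroup T M by (rule quotient_abelian_subgroup[OF T_sub])
sublocale X: Module.module E X unfolding ext_space_def by (rule quotient_module_module[OF T_sub])

lemma cs_rep: "Y \<in> carrier X \<Longrightarrow> \<exists>x\<in>carrier M. Y = cs x"
  by (auto simp: ext_space_def quotient_module_def A_RCOSETS_def RCOSETS_def a_r_coset_def)
lemma cs_mem: "x \<in> carrier M \<Longrightarrow> cs x \<in> carrier X"
  by (auto simp: ext_space_def quotient_module_def A_RCOSETS_def RCOSETS_def a_r_coset_def)
lemma cs_add: "x \<in> carrier M \<Longrightarrow> y \<in> carrier M \<Longrightarrow> cs x \<oplus>\<^bsub>X\<^esub> cs y = cs (x \<oplus>\<^bsub>M\<^esub> y)"
  using A.a_rcos_sum by (simp add: ext_space_def quotient_module_def)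
lemma cs_smult: "x \<in> carrier M \<Longrightarrow> c \<in> carrier E \<Longrightarrow> c \<odot>\<^bsub>X\<^esub> cs x = cs (c \<odot>\<^bsub>M\<^esub> x)"
  unfolding ext_space_def by (rule quotient_smult[OF T_sub])

lemma cs_Q: "x \<in> carrier M \<Longrightarrow> y \<in> cs x \<Longrightarrow> Q y = Q x"
proof -
  assume x: "x \<in> carrier M" and "y \<in> cs x"
  then obtain n where n: "n \<in> T" "y = n \<oplus>\<^bsub>M\<^esub> x" by (auto simp: a_r_coset_def r_coset_def)
  thus ?thesis using x A.a_subset QT by (auto simp: Qadd)
qed

lemma cs_eq: "x \<in> carrier M \<Longrightarrow> y \<in> carrier M \<Longrightarrow> x \<ominus>\<^bsub>M\<^esub> y \<in> T \<Longrightarrow> cs x = cs y"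
proof -
  assume x: "x \<in> carrier M" "y \<in> carrier M" "x \<ominus>\<^bsub>M\<^esub> y \<in> T"
  have "x = (x \<ominus>\<^bsub>M\<^esub> y) \<oplus>\<^bsub>M\<^esub> y" using x by (simp add: a_minus_def M.M.a_assoc M.M.l_neg)
  hence "x \<in> cs y" using x by (auto simp: a_r_coset_def r_coset_def)
  thus ?thesis using x A.a_repr_independence'[of x y] by simp
qed

lemma rels_T: "rels \<subseteq> T" unfolding T_eq using M.in_own_span[OF rels_sub] .

lemma M_induct [consumes 1]:
  assumes "f \<in> carrier M"
    and add: "\<And>f g. f \<in> carrier M \<Longrightarrow> g \<in> carrier M \<Longrightarrow> P f \<Longrightarrow> P g \<Longrightarrow> P (f \<oplus>\<^bsub>M\<^esub> g)"
    and gen: "\<And>c v. c \<in> carrier E \<Longrightarrow> v \<in> S \<Longrightarrow> P (c \<odot>\<^bsub>M\<^esub> \<delta> v)"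
  shows "P f"
proof -
  have P0: "P \<zero>\<^bsub>M\<^esub>" using gen[of "\<zero>\<^bsub>E\<^esub>" "\<zero>\<^bsub>V\<^esub>"] by simp
  have "P f" if "finite A" "A \<subseteq> S" "supp f \<subseteq> A" "f \<in> carrier M" for A f
    using that
  proof (induction A arbitrary: f rule: finite_induct)
    case empty
    hence "f = \<zero>\<^bsub>M\<^esub>" by (intro Mext) (auto simp: supp_def Mz)
    thus ?case using P0 by simp
  next
    case (insert a A)
    define g where "g = f \<oplus>\<^bsub>M\<^esub> (\<ominus>\<^bsub>E\<^esub> f a) \<odot>\<^bsub>M\<^esub> \<delta> a"
    have fa: "f a \<in> carrier E" "a \<in> S" using insert by (auto simp: Mval)
    have g: "g \<in> carrier M" using insert fa by (simp add: g_def)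
    have "supp g \<subseteq> A"
    proof
      fix v assume v: "v \<in> supp g"
      hence vS: "v \<in> S" "g v \<noteq> \<zero>\<^bsub>E\<^esub>" by (auto simp: supp_def)
      have fv: "f v \<in> carrier E" using vS insert by (auto simp: Mval)
      have "g v = f v \<oplus>\<^bsub>E\<^esub> (\<ominus>\<^bsub>E\<^esub> f a) \<otimes>\<^bsub>E\<^esub> \<delta> a v" using vS by (simp add: g_def Madd Msm)
      hence "v \<noteq> a" "f v \<noteq> \<zero>\<^bsub>E\<^esub>" using vS fa fv by (auto simp: free_gen_def E.r_neg split: if_splits)
      thus "v \<in> A" using insert vS by (auto simp: supp_def)
    qed
    hence "P g" using insert g by auto
    hence "P (g \<oplus>\<^bsub>M\<^esub> f a \<odot>\<^bsub>M\<^esub> \<delta> a)" using g fa by (intro add gen) auto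
    moreover have "g \<oplus>\<^bsub>M\<^esub> f a \<odot>\<^bsub>M\<^esub> \<delta> a = f"
      using insert fa g by (simp add: g_def M.M.a_assoc M.smult_l_minus M.M.l_neg)
    ultimately show ?case by simp
  qed
  thus ?thesis using assms(1) Mfin[OF assms(1)] by (auto simp: supp_def)
qed

lemma vsX: "vectorspace E X" by (intro vectorspace.intro X.module_axioms E.field_axioms)

lemma csd_add:
  assumes "v \<in> S" "w \<in> S"
  shows "cs (\<delta> (v \<oplus>\<^bsub>V\<^esub> w)) = cs (\<delta> v) \<oplus>\<^bsub>X\<^esub> cs (\<delta> w)"
proof -
  have "\<delta> (v \<oplus>\<^bsub>V\<^esub> w) \<ominus>\<^bsub>M\<^esub> (\<delta> v \<oplus>\<^bsub>M\<^esub> \<delta> w) \<in> T" using assms by (intro subsetD[OF rels_T]) (auto simp: rels_def)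
  from cs_eq[OF _ _ this] show ?thesis by (simp add: cs_add)
qed

lemma csd_sm:
  assumes "v \<in> S" "c \<in> carrier F"
  shows "cs (\<delta> (c \<odot>\<^bsub>V\<^esub> v)) = h c \<odot>\<^bsub>X\<^esub> cs (\<delta> v)"
proof -
  have "\<delta> (c \<odot>\<^bsub>V\<^esub> v) \<ominus>\<^bsub>M\<^esub> h c \<odot>\<^bsub>M\<^esub> \<delta> v \<in> T" using assms by (intro subsetD[OF rels_T]) (auto simp: rels_def)
  from cs_eq[OF _ _ this] show ?thesis using assms by (simp add: cs_smult)
qed

lemma X_fin: "vectorspace.fin_dim E X"
proof -
  obtain B where B: "finite B" "B \<subseteq> S" "f.span B = S" using f.finite_dim unfolding f.fin_dim_def by auto
  let ?B = "(\<lambda>b. cs (\<delta> b)) ` B"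
  have Bs: "?B \<subseteq> carrier X" by (auto intro: cs_mem)
  let ?Y = "X.span ?B"
  have Y: "LinearCombinations.submodule E ?Y X" by (rule X.span_is_submodule[OF Bs])
  interpret Y: LinearCombinations.submodule E ?Y X by (rule Y)
  let ?L = "{v \<in> S. cs (\<delta> v) \<in> ?Y}"
  have z: "cs (\<delta> \<zero>\<^bsub>V\<^esub>) \<in> ?Y"
  proof -
    have "cs (\<delta> (\<zero>\<^bsub>F\<^esub> \<odot>\<^bsub>V\<^esub> \<zero>\<^bsub>V\<^esub>)) = \<zero>\<^bsub>E\<^esub> \<odot>\<^bsub>X\<^esub> cs (\<delta> \<zero>\<^bsub>V\<^esub>)"
      by (subst csd_sm) (simp_all add: hzero)
    also have "\<dots> = \<zero>\<^bsub>X\<^esub>" by (rule X.smult_l_null) (rule cs_mem[OF dM])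
    finally show ?thesis by simp
  qed
  have L': "LinearCombinations.submodule F ?L V"
  proof (intro LinearCombinations.submodule.intro)
    show "Module.module F V" by (rule f.module_axioms)
  qed (auto simp: csd_add csd_sm z intro: Y.m_closed Y.smult_closed)
  moreover have BL: "B \<subseteq> ?L"
  proof
    fix b assume b: "b \<in> B"
    have "cs (\<delta> b) \<in> ?Y" using X.in_own_span[OF Bs] b by blast
    thus "b \<in> ?L" using b B(2) by blast
  qed
  have "f.span B \<subseteq> ?L" using f.span_is_subset[OF BL L'] .
  hence L: "cs (\<delta> v) \<in> ?Y" if "v \<in> S" for v using that B(3) by blast
  have C: "cs f \<in> ?Y" if "f \<in> carrier M" for f using that
  proof (induction rule: M_induct)
    case (1 f g) thus ?case using Y.m_closed cs_add by metis
  next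
    case (2 c v) thus ?case using L[OF 2(2)] Y.smult_closed[OF 2(1)] cs_smult[OF dM 2(1)] by metis
  qed
  have "?Y = carrier X"
  proof
    show "?Y \<subseteq> carrier X" by (rule Y.subset)
    show "carrier X \<subseteq> ?Y"
    proof
      fix y assume "y \<in> carrier X"
      from cs_rep[OF this] show "y \<in> ?Y" using C by auto
    qed
  qed
  moreover have "finite ?B" using B(1) by simp
  ultimately show ?thesis unfolding vectorspace.fin_dim_def[OF vsX] using Bs by blast
qed

lemma pt: "pure_tensor E h F V e v = cs (e \<odot>\<^bsub>M\<^esub> \<delta> v)" by (simp add: pure_tensor_def)

theorem ext_form_ex1:
  "\<exists>!q. ts_form E X q \<and> q \<in> extensional (carrier X) \<and>
       (\<forall>e\<in>carrier E. \<forall>v\<in>S. q (pure_tensor E h F V e v) = (e \<otimes>\<^bsub>E\<^esub> e) \<otimes>\<^bsub>E\<^esub> h (\<phi> v))"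
proof (rule ex_ex1I)
  define q where "q = restrict (\<lambda>Y. Q (SOME y. y \<in> Y)) (carrier X)"
  have q: "q (cs x) = Q x" if "x \<in> carrier M" for x
  proof -
    have "(SOME y. y \<in> cs x) \<in> cs x" using someI[of "\<lambda>y. y \<in> cs x" x] A.a_rcos_self[OF that] by blast
    thus ?thesis using cs_Q[OF that] cs_mem[OF that] by (simp add: q_def)
  qed
  have "ts_form E X q"
  proof (intro ts_form.intro ts_form_axioms.intro vsX X_fin)
    show "\<one>\<^bsub>E\<^esub> \<oplus>\<^bsub>E\<^esub> \<one>\<^bsub>E\<^esub> = \<zero>\<^bsub>E\<^esub>" by (rule E2) simp
  qed (auto dest!: cs_rep simp: q cs_add cs_smult Qadd Qsm)
  moreover have "q \<in> extensional (carrier X)" by (simp add: q_def)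
  ultimately show "\<exists>q. ts_form E X q \<and> q \<in> extensional (carrier X) \<and>
       (\<forall>e\<in>carrier E. \<forall>v\<in>S. q (pure_tensor E h F V e v) = (e \<otimes>\<^bsub>E\<^esub> e) \<otimes>\<^bsub>E\<^esub> h (\<phi> v))"
    by (intro exI[of _ q]) (auto simp: pt q Qsm Qd)
next
  fix q q'
  assume q1: "ts_form E X q \<and> q \<in> extensional (carrier X) \<and>
       (\<forall>e\<in>carrier E. \<forall>v\<in>S. q (pure_tensor E h F V e v) = (e \<otimes>\<^bsub>E\<^esub> e) \<otimes>\<^bsub>E\<^esub> h (\<phi> v))"
  assume q2: "ts_form E X q' \<and> q' \<in> extensional (carrier X) \<and>
       (\<forall>e\<in>carrier E. \<forall>v\<in>S. q' (pure_tensor E h F V e v) = (e \<otimes>\<^bsub>E\<^esub> e) \<otimes>\<^bsub>E\<^esub> h (\<phi> v))"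
  have e: "q (cs f) = q' (cs f)" if "f \<in> carrier M" for f using that
  proof (induction rule: M_induct)
    case (1 f g)
    thus ?case
      using ts_form.form_add[OF conjunct1[OF q1] cs_mem cs_mem]
        ts_form.form_add[OF conjunct1[OF q2] cs_mem cs_mem]
      by (simp add: cs_add[symmetric])
  next
    case (2 c v)
    thus ?case using q1 q2 by (simp add: pt)
  qed
  show "q = q'"
  proof (rule extensionalityI[of _ "carrier X"])
    show "q Y = q' Y" if "Y \<in> carrier X" for Y using cs_rep[OF that] e by auto
  qed (use q1 q2 in auto)
qed

end

lemma ext_form:
  assumes "ts_form F V \<phi>" "field E" "h \<in> ring_hom F E"
  shows "ts_form E (ext_space E h F V) (ext_form E h F V \<phi>)"
    and "\<And>e v. \<lbrakk>e \<in> carrier E; v \<in> carrier V\<rbrakk> \<Longrightarrow>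
      ext_form E h F V \<phi> (pure_tensor E h F V e v) = (e \<otimes>\<^bsub>E\<^esub> e) \<otimes>\<^bsub>E\<^esub> h (\<phi> v)"
proof -
  interpret scalar_extension F V \<phi> E h
    using assms by (intro scalar_extension.intro scalar_extension_axioms.intro)
  note * = theI'[OF ext_form_ex1, folded ext_form_def]
  show "ts_form E (ext_space E h F V) (ext_form E h F V \<phi>)" using * by blast
  show "ext_form E h F V \<phi> (pure_tensor E h F V e v) = (e \<otimes>\<^bsub>E\<^esub> e) \<otimes>\<^bsub>E\<^esub> h (\<phi> v)"
    if "e \<in> carrier E" "v \<in> carrier V" for e v using * that by blast
qed

end

theory Submission
  imports Defs
begin

text \<open>
  A totally singular form \<open>\<phi>\<close> on \<open>V\<close> is additive and satisfies \<open>\<phi>(av) = a\<^sup>2\<phi>(v)\<close>, so its set of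
  values \<open>D = \<phi>(V)\<close> is a subspace of \<open>F\<close> over the field \<open>F\<^sup>2\<close> of squares.  The form is determined
  up to isometry by \<open>D\<close> and \<open>dim V\<close> (\<open>isometric_if_same_values\<close>), and its defect is
  \<open>dim V - dim D\<close>, where \<open>dim D\<close> is taken over \<open>F\<^sup>2\<close> (\<open>defect_eq\<close>).  Hence \<open>\<phi>\<close> and \<open>\<psi>\<close>, of the
  same dimension and with value spaces \<open>D\<close> and \<open>D'\<close>, are similar as soon as \<open>D' = cD\<close> for some
  \<open>c \<noteq> 0\<close>.

  Let \<open>E = F(\<surd>a)\<close>.  Then \<open>E\<^sup>2 = F\<^sup>2 + aF\<^sup>2\<close>, and the values of \<open>\<phi>\<^sub>E\<close> form the \<open>E\<^sup>2\<close>-span of \<open>D\<close>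
  (\<open>defect_ext_form\<close>).  If \<open>a\<close> is not a square, a basis of \<open>D\<close> becomes dependent over \<open>E\<^sup>2\<close> exactly
  if \<open>d = ad'\<close> for some nonzero \<open>d\<close>, \<open>d'\<close> in \<open>D\<close> (\<open>independent_adjoin_sqrt_iff\<close>).  So a weak Vishik
  equivalence yields two things: \<open>dim D = dim D'\<close>, from \<open>a = 0\<close>, and \<open>D\<close> and \<open>D'\<close> have the same
  nonsquare ratios \<open>d/d'\<close>.  In particular the norm fields agree, and the anisotropic part of \<open>\<psi>\<close>
  is minimal, too.

  What remains is a statement on two \<open>m\<close>-dimensional subspaces \<open>D\<close> and \<open>D'\<close> of \<open>F\<close> whose norm
  fields have degree \<open>2\<^sup>m\<^sup>-\<^sup>1\<close> (\<open>minimal_spaces_proportional\<close>).  As \<open>d/d' = dd'/d'\<^sup>2\<close>, equal ratios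
  mean equal sets of products, and after scaling, \<open>1\<close> belongs to both spaces.  Minimality of \<open>D\<close>
  says that a basis \<open>1, b\<^sub>1, \<dots>, b\<^sub>m\<^sub>-\<^sub>1\<close> of \<open>D\<close> is 2-independent.  Modulo \<open>F\<^sup>2\<close>, the product \<open>dd'\<close> is
  alternating, and 2-independence makes it an embedding of \<open>\<Lambda>\<^sup>2D\<close>.  Every element of \<open>D'\<close> is a
  product of two elements of \<open>D\<close>, so \<open>D'\<close> modulo \<open>F\<^sup>2\<close> is an \<open>(m-1)\<close>-dimensional space of
  decomposable bivectors.  Such a space is either \<open>g \<and> D\<close> for some \<open>g\<close>, whence \<open>D' = gD\<close>, or consists
  of all bivectors of a 3-dimensional space, and then \<open>D'\<close> contains independent elements \<open>1, x, y\<close>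
  together with \<open>xy\<close>, which contradicts the minimality of \<open>D'\<close>.  The proof below carries this out
  with elements of \<open>F\<close> and rests on two facts on a minimal \<open>D\<close> that contains \<open>1\<close>: for independent
  \<open>1, x, y\<close> in \<open>D\<close>, the product \<open>xy\<close> is not in \<open>D\<close> (\<open>product_not_in_minimal_space\<close>); for independent
  \<open>1, b, c, d\<close> in \<open>D\<close>, the product \<open>bcd\<close> is not a product of two elements of \<open>D\<close>
  (\<open>triple_product_not_product\<close>).
\<close>

section \<open>Fields of characteristic 2 over their squares\<close>

locale field_char_two = field +
  assumes one_plus_one: "\<one> \<oplus> \<one> = \<zero>"
begin

declare Span.simps [simp del]

abbreviation "sqs \<equiv> squares R"

lemma add_self [simp]: "x \<in> carrier R \<Longrightarrow> x \<oplus> x = \<zero>"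
  using char_two_neg[OF one_plus_one] .

lemma add_self_left [simp]: "\<lbrakk>x \<in> carrier R; y \<in> carrier R\<rbrakk> \<Longrightarrow> x \<oplus> (x \<oplus> y) = y"
  by (simp add: a_assoc[symmetric])

lemma minus_self [simp]: "x \<in> carrier R \<Longrightarrow> \<ominus> x = x"
  by (rule minus_equality) simp_all

lemma add_eq_zero_iff: "\<lbrakk>x \<in> carrier R; y \<in> carrier R\<rbrakk> \<Longrightarrow> x \<oplus> y = \<zero> \<longleftrightarrow> x = y"
  by (metis add_self add_self_left r_zero)

lemma square_add:
  "\<lbrakk>x \<in> carrier R; y \<in> carrier R\<rbrakk> \<Longrightarrow> (x \<oplus> y) \<otimes> (x \<oplus> y) = x \<otimes> x \<oplus> y \<otimes> y"
  by (simp add: l_distr r_distr m_comm[of y x] a_ac)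

lemma square_in: "x \<in> carrier R \<Longrightarrow> x \<otimes> x \<in> sqs"
  by (auto simp: squares_def)

lemma inv_nz: "\<lbrakk>x \<in> carrier R; x \<noteq> \<zero>\<rbrakk> \<Longrightarrow> inv x \<in> carrier R \<and> x \<otimes> inv x = \<one> \<and> inv x \<noteq> \<zero>"
  using field_Units by auto

lemma inv_cancel:
  "\<lbrakk>x \<in> carrier R; x \<noteq> \<zero>; y \<in> carrier R\<rbrakk> \<Longrightarrow> x \<otimes> (inv x \<otimes> y) = y"
  "\<lbrakk>x \<in> carrier R; x \<noteq> \<zero>; y \<in> carrier R\<rbrakk> \<Longrightarrow> inv x \<otimes> (x \<otimes> y) = y"
  using inv_nz[of x] by (simp_all add: m_assoc[symmetric] m_comm)

lemma squares_subfield: "subfield sqs R"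
proof (rule subfieldI')
  show "subring sqs R"
  proof (rule subringI)
    show "sqs \<subseteq> carrier R" by (auto simp: squares_def)
    show "\<one> \<in> sqs" using square_in[of \<one>] by simp
    show "\<ominus> x \<in> sqs" if "x \<in> sqs" for x using that by (auto simp: squares_def)
    show "x \<otimes> y \<in> sqs" if "x \<in> sqs" "y \<in> sqs" for x y
    proof -
      obtain s t where "x = s \<otimes> s" "y = t \<otimes> t" "s \<in> carrier R" "t \<in> carrier R"
        using \<open>x \<in> sqs\<close> \<open>y \<in> sqs\<close> by (auto simp: squares_def)
      thus ?thesis using square_in[of "s \<otimes> t"] by (simp add: m_ac)
    qed
    show "x \<oplus> y \<in> sqs" if "x \<in> sqs" "y \<in> sqs" for x y
    proof -
      obtain s t where "x = s \<otimes> s" "y = t \<otimes> t" "s \<in> carrier R" "t \<in> carrier R"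
        using \<open>x \<in> sqs\<close> \<open>y \<in> sqs\<close> by (auto simp: squares_def)
      thus ?thesis using square_in[of "s \<oplus> t"] by (simp add: square_add)
    qed
  qed
  show "inv x \<in> sqs" if x: "x \<in> sqs - {\<zero>}" for x
  proof -
    obtain s where s: "x = s \<otimes> s" "s \<in> carrier R" using x by (auto simp: squares_def)
    hence "s \<noteq> \<zero>" using x by auto
    note i = inv_nz[OF s(2) this]
    have "inv x = inv s \<otimes> inv s"
      using s i by (intro comm_inv_char) (simp_all add: m_ac inv_cancel)
    thus ?thesis using square_in i by simp
  qed
qed

lemma sqs_carrier: "a \<in> sqs \<Longrightarrow> a \<in> carrier R" by (auto simp: squares_def)

lemma inv_square_mult:
  assumes "x \<in> carrier R" "x \<noteq> \<zero>"
  shows "inv x = (inv x \<otimes> inv x) \<otimes> x" "inv x \<otimes> inv x \<in> sqs"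
  using inv_nz[OF assms] assms square_in by (auto simp: m_assoc m_comm[of "inv x" x])

text \<open>Over the squares, inverses come for free: \<open>1/x = x/x\<^sup>2\<close>.\<close>

lemma subring_over_squares_subfield:
  assumes "subring A R" "sqs \<subseteq> A"
  shows "subfield A R"
proof (rule subfieldI'[OF assms(1)])
  fix x assume x: "x \<in> A - {\<zero>}"
  hence xc: "x \<in> carrier R" using subringE(1)[OF assms(1)] by blast
  show "inv x \<in> A"
    using inv_square_mult[of x] xc x assms(2) subringE(6)[OF assms(1), of "inv x \<otimes> inv x" x] by auto
qed

subsection \<open>Spans\<close>

text \<open>A \<^const>\<open>subalgebra\<close> is closed under addition and under multiplication by scalars only, so it
  is a linear subspace.\<close>

abbreviation "space D \<equiv> subalgebra sqs D R"

lemma space_carrier: "space D \<Longrightarrow> x \<in> D \<Longrightarrow> x \<in> carrier R"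
  using subalgebra_in_carrier by blast

lemma space_add: "\<lbrakk>space D; x \<in> D; y \<in> D\<rbrakk> \<Longrightarrow> x \<oplus> y \<in> D"
  using subgroup.m_closed[OF subalgebra.axioms(1)] by fastforce

lemma space_zero: "space D \<Longrightarrow> \<zero> \<in> D"
  using subgroup.one_closed[OF subalgebra.axioms(1)] by fastforce

lemma space_smult: "\<lbrakk>space D; a \<in> sqs; x \<in> D\<rbrakk> \<Longrightarrow> a \<otimes> x \<in> D"
  using subalgebra.smult_closed by fast

lemma space_square: "\<lbrakk>space D; \<one> \<in> D; a \<in> sqs\<rbrakk> \<Longrightarrow> a \<in> D"
  using space_smult[of D a \<one>] sqs_carrier by simp

lemma dimension_space: "dimension n sqs D \<Longrightarrow> space D"
  using finite_dimension_imp_subalgebra[OF squares_subfield] finite_dimensionI by blast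

lemma Span_space: "set us \<subseteq> carrier R \<Longrightarrow> space (Span sqs us)"
  using Span_is_subalgebra[OF squares_subfield] .

lemma Span_Nil: "Span K [] = {\<zero>}" by (simp add: Span.simps)

lemma Span_Cons: "Span K (u # us) = line_extension K u (Span K us)" by (simp add: Span.simps)

lemma in_Span_Cons: "x \<in> Span K (u # us) \<longleftrightarrow> (\<exists>a\<in>K. \<exists>y\<in>Span K us. x = a \<otimes> u \<oplus> y)"
  by (simp add: Span_Cons line_extension_mem_iff)

lemma independent_Cons:
  "independent K (u # us) \<longleftrightarrow> u \<in> carrier R \<and> u \<notin> Span K us \<and> independent K us"
  using independent_backwards li_Cons by metis

lemma Span_one: "Span sqs [\<one>] = sqs"
proof -
  have "a = a \<otimes> \<one> \<oplus> \<zero>" if "a \<in> sqs" for a using sqs_carrier[OF that] by simp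
  thus ?thesis unfolding in_Span_Cons set_eq_iff Span_Nil by (auto simp: sqs_carrier)
qed

lemma dimension_eq_if_subset:
  assumes "dimension n sqs D" "dimension n sqs D'" "D \<subseteq> D'"
  shows "D = D'"
proof -
  obtain us where us: "independent sqs us" "length us = n" "Span sqs us = D"
    using exists_base[OF squares_subfield assms(1)] by blast
  have "set us \<subseteq> D"
    using Span_base_incl[OF squares_subfield independent_in_carrier[OF us(1)]] us(3) by simp
  thus ?thesis
    using independent_length_eq_dimension[OF squares_subfield assms(2) us(1)] us assms(3) by auto
qed

lemma independent_outside:
  assumes "dimension n sqs D" "independent sqs us" "set us \<subseteq> D" "length us < n"
  obtains x where "x \<in> D" "independent sqs (x # us)"
proof -
  have "Span sqs us \<subseteq> D"
    using subalgebra_Span_incl[OF squares_subfield dimension_space[OF assms(1)] assms(3)] .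
  moreover have "Span sqs us \<noteq> D"
    using independent_length_eq_dimension[OF squares_subfield assms(1-3)] assms(4) by auto
  ultimately obtain x where "x \<in> D" "x \<notin> Span sqs us" by blast
  thus thesis using that assms(2) space_carrier[OF dimension_space[OF assms(1)]]
    by (auto simp: independent_Cons)
qed

text \<open>The rank of a list, which is what the defect sees, decides its independence.\<close>

lemma Span_dimension:
  assumes K: "subfield K R" and "set us \<subseteq> carrier R"
  shows "\<exists>r\<le>length us. dimension r K (Span K us) \<and> (r = length us \<longleftrightarrow> independent K us)"
  using assms(2)
proof (induction us)
  case Nil thus ?case by (simp add: Span_Nil)
next
  case (Cons u us)
  then obtain r where r: "r \<le> length us" "dimension r K (Span K us)" "r = length us \<longleftrightarrow> independent K us"
    by auto
  show ?case
  proof (cases "u \<in> Span K us")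
    case True
    have "set (u # us) \<subseteq> Span K us"
      using True Span_base_incl[OF K, of us] Cons.prems by auto
    hence "Span K (u # us) = Span K us"
      using mono_Span_subset[OF K, of "u # us" us] mono_Span[OF K, of us u] Cons.prems by auto
    thus ?thesis using r True by (intro exI[of _ r]) (auto simp: independent_Cons)
  next
    case False
    hence "dimension (Suc r) K (Span K (u # us))"
      unfolding Span_Cons using r Cons.prems by (intro Suc_dim) auto
    thus ?thesis using r False Cons.prems by (intro exI[of _ "Suc r"]) (auto simp: independent_Cons)
  qed
qed

lemma dimension_mono:
  assumes "dimension n sqs D" "dimension m sqs D'" "D \<subseteq> D'"
  shows "n \<le> m"
proof -
  obtain us where us: "independent sqs us" "length us = n" "Span sqs us = D"
    using exists_base[OF squares_subfield assms(1)] by blast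
  have "set us \<subseteq> D"
    using Span_base_incl[OF squares_subfield independent_in_carrier[OF us(1)]] us(3) by simp
  thus ?thesis
    using independent_length_le_dimension[OF squares_subfield assms(2) us(1)] us assms(3) by auto
qed

subsection \<open>Scaling\<close>

lemma dimension_scale:
  assumes "dimension n sqs D" "c \<in> carrier R" "c \<noteq> \<zero>"
  shows "dimension n sqs ((\<otimes>) c ` D)"
  using assms(1)
proof (induction n sqs D rule: dimension.induct)
  case zero_dim
  show ?case using assms by simp
next
  case (Suc_dim v E n)
  have E: "E \<subseteq> carrier R" using space_carrier[OF dimension_space[OF Suc_dim(3)]] by blast
  have "c \<otimes> v \<notin> (\<otimes>) c ` E"
    using E Suc_dim(1,2) m_lcancel[OF assms(3,2) Suc_dim(1)] by blast
  moreover have "line_extension sqs (c \<otimes> v) ((\<otimes>) c ` E) = (\<otimes>) c ` line_extension sqs v E"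
  proof -
    have eq: "a \<otimes> (c \<otimes> v) \<oplus> c \<otimes> e = c \<otimes> (a \<otimes> v \<oplus> e)" if "a \<in> sqs" "e \<in> E" for a e
    proof -
      have "a \<in> carrier R" "e \<in> carrier R" using that E sqs_carrier by auto
      thus ?thesis using Suc_dim(1) assms(2) by (simp add: r_distr m_lcomm)
    qed
    show ?thesis
    proof (intro equalityI subsetI)
      fix x assume "x \<in> line_extension sqs (c \<otimes> v) ((\<otimes>) c ` E)"
      then obtain a e where "a \<in> sqs" "e \<in> E" "x = a \<otimes> (c \<otimes> v) \<oplus> c \<otimes> e"
        unfolding line_extension_mem_iff by blast
      thus "x \<in> (\<otimes>) c ` line_extension sqs v E"
        unfolding image_iff by (intro bexI[of _ "a \<otimes> v \<oplus> e"]) (use eq in \<open>auto simp: line_extension_mem_iff\<close>)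
    next
      fix x assume "x \<in> (\<otimes>) c ` line_extension sqs v E"
      then obtain a e where "a \<in> sqs" "e \<in> E" "x = c \<otimes> (a \<otimes> v \<oplus> e)"
        by (auto simp: line_extension_mem_iff)
      thus "x \<in> line_extension sqs (c \<otimes> v) ((\<otimes>) c ` E)"
        unfolding line_extension_mem_iff
        by (intro bexI[of _ a] bexI[of _ "c \<otimes> e"]) (auto simp: eq)
    qed
  qed
  ultimately show ?case
    using dimension.Suc_dim[OF _ _ Suc_dim(4), of "c \<otimes> v"] Suc_dim(1) assms by auto
qed

lemma scale_scale:
  assumes "D \<subseteq> carrier R" "c \<in> carrier R" "d \<in> carrier R"
  shows "(\<otimes>) c ` (\<otimes>) d ` D = (\<otimes>) (c \<otimes> d) ` D"
  unfolding image_image using assms by (intro image_cong) (auto simp: m_assoc)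

lemma scale_one: "D \<subseteq> carrier R \<Longrightarrow> (\<otimes>) \<one> ` D = D"
  using image_cong[of D D "(\<otimes>) \<one>" "\<lambda>x. x"] l_one by (simp add: subset_iff)

text \<open>\<open>1 = g (g / g\<^sup>2)\<close>, where \<open>1 / g\<^sup>2\<close> is a square.\<close>

lemma one_in_scale:
  assumes "space D" "g \<in> D" "g \<noteq> \<zero>"
  shows "\<one> \<in> (\<otimes>) g ` D"
proof -
  have g: "g \<in> carrier R" using assms space_carrier by blast
  have "inv g \<in> D" using inv_square_mult[OF g assms(3)] space_smult[OF assms(1) _ assms(2)] by metis
  thus ?thesis using inv_nz[OF g assms(3)] by (intro image_eqI[of _ _ "inv g"]) auto
qed

section \<open>Adjoining square roots\<close>

fun subproducts :: "'a list \<Rightarrow> 'a list" where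
  "subproducts [] = [\<one>]"
| "subproducts (h # hs) = map ((\<otimes>) h) (subproducts hs) @ subproducts hs"

text \<open>The ring generated over \<open>F\<^sup>2\<close> by \<open>hs\<close>: as \<open>h\<^sup>2 \<in> F\<^sup>2\<close> for every \<open>h\<close>, the products of sublists of
  \<open>hs\<close> span it.  It is a field of degree at most \<open>2\<close> to the power \<open>length hs\<close>.\<close>

definition root_field :: "'a list \<Rightarrow> 'a set" where
  "root_field hs = Span sqs (subproducts hs)"

lemma subproducts_carrier: "set hs \<subseteq> carrier R \<Longrightarrow> set (subproducts hs) \<subseteq> carrier R"
  by (induction hs) auto

lemma length_subproducts: "length (subproducts hs) = 2 ^ length hs"
  by (induction hs) auto

lemma Span_map_mult:
  assumes "set us \<subseteq> carrier R" "h \<in> carrier R"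
  shows "Span sqs (map ((\<otimes>) h) us) = (\<otimes>) h ` Span sqs us"
  using assms(1)
proof (induction us)
  case Nil thus ?case using assms by (simp add: Span_Nil)
next
  case (Cons u us)
  have eq: "a \<otimes> (h \<otimes> u) \<oplus> h \<otimes> e = h \<otimes> (a \<otimes> u \<oplus> e)" if "a \<in> sqs" "e \<in> Span sqs us" for a e
  proof -
    have "a \<in> carrier R" "e \<in> carrier R"
      using that Cons.prems Span_subgroup_props(1)[OF squares_subfield] sqs_carrier by auto
    thus ?thesis using Cons.prems assms by (simp add: r_distr m_lcomm)
  qed
  show ?case
  proof (intro equalityI subsetI)
    fix x assume "x \<in> Span sqs (map ((\<otimes>) h) (u # us))"
    then obtain a e where "a \<in> sqs" "e \<in> Span sqs us" "x = a \<otimes> (h \<otimes> u) \<oplus> h \<otimes> e"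
      using Cons by (auto simp: in_Span_Cons)
    thus "x \<in> (\<otimes>) h ` Span sqs (u # us)"
      unfolding image_iff by (intro bexI[of _ "a \<otimes> u \<oplus> e"]) (use eq in \<open>auto simp: in_Span_Cons\<close>)
  next
    fix x assume "x \<in> (\<otimes>) h ` Span sqs (u # us)"
    then obtain a e where ae: "a \<in> sqs" "e \<in> Span sqs us" "x = h \<otimes> (a \<otimes> u \<oplus> e)"
      by (auto simp: in_Span_Cons)
    hence "x = a \<otimes> (h \<otimes> u) \<oplus> h \<otimes> e" using eq by simp
    moreover have "h \<otimes> e \<in> Span sqs (map ((\<otimes>) h) us)" using Cons ae by auto
    ultimately show "x \<in> Span sqs (map ((\<otimes>) h) (u # us))"
      using ae(1) by (auto simp: in_Span_Cons)
  qed
qed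

lemma root_field_Nil: "root_field [] = sqs"
  by (simp add: root_field_def Span_one)

lemma root_field_Cons:
  assumes "set (h # hs) \<subseteq> carrier R"
  shows "root_field (h # hs) = {h \<otimes> p \<oplus> q | p q. p \<in> root_field hs \<and> q \<in> root_field hs}"
proof -
  have c: "set (subproducts hs) \<subseteq> carrier R" "h \<in> carrier R" using assms subproducts_carrier by auto
  hence "set (map ((\<otimes>) h) (subproducts hs)) \<subseteq> carrier R" by auto
  from Span_append_eq_set_add[OF squares_subfield this c(1)] show ?thesis
    using Span_map_mult[OF c] by (fastforce simp: root_field_def set_add_def')
qed

lemma root_field_dimension:
  assumes "set hs \<subseteq> carrier R"
  shows "\<exists>r\<le>2 ^ length hs. dimension r sqs (root_field hs)"
  using Span_dimension[OF squares_subfield subproducts_carrier[OF assms]]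
  unfolding root_field_def length_subproducts by blast

lemma root_field_space: "set hs \<subseteq> carrier R \<Longrightarrow> space (root_field hs)"
  unfolding root_field_def using Span_space subproducts_carrier by blast

lemma root_field_mono:
  assumes "set (h # hs) \<subseteq> carrier R"
  shows "root_field hs \<subseteq> root_field (h # hs)"
proof
  fix q assume q: "q \<in> root_field hs"
  have s: "space (root_field hs)" using root_field_space assms by simp
  have "q = h \<otimes> \<zero> \<oplus> q" using assms space_carrier[OF s q] by simp
  thus "q \<in> root_field (h # hs)" unfolding root_field_Cons[OF assms] using q space_zero[OF s] by blast
qed

lemma one_in_root_field: "set hs \<subseteq> carrier R \<Longrightarrow> \<one> \<in> root_field hs"
proof (induction hs)
  case Nil
  show ?case using subringE(3)[OF subfieldE(1)[OF squares_subfield]] by (simp add: root_field_Nil)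
next
  case (Cons h hs) thus ?case using root_field_mono[of h hs] by auto
qed

lemma root_field_subfield:
  assumes "set hs \<subseteq> carrier R"
  shows "subfield (root_field hs) R"
proof (rule subring_over_squares_subfield)
  note s = root_field_space[OF assms]
  show "sqs \<subseteq> root_field hs" using space_square[OF s one_in_root_field[OF assms]] by blast
  have "x \<otimes> y \<in> root_field hs" if "x \<in> root_field hs" "y \<in> root_field hs" for x y
    using assms that
  proof (induction hs arbitrary: x y)
    case Nil thus ?case using subringE(6)[OF subfieldE(1)[OF squares_subfield]] by (simp add: root_field_Nil)
  next
    case (Cons h hs)
    note s = root_field_space[of hs]
    obtain p q p' q' where e: "x = h \<otimes> p \<oplus> q" "y = h \<otimes> p' \<oplus> q'"
      and m: "p \<in> root_field hs" "q \<in> root_field hs" "p' \<in> root_field hs" "q' \<in> root_field hs"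
      using Cons.prems root_field_Cons[of h hs] by auto
    have c: "h \<in> carrier R" "p \<in> carrier R" "q \<in> carrier R" "p' \<in> carrier R" "q' \<in> carrier R"
      using m Cons.prems space_carrier[OF s] by auto
    have "x \<otimes> y = h \<otimes> (p \<otimes> q' \<oplus> q \<otimes> p') \<oplus> ((h \<otimes> h) \<otimes> (p \<otimes> p') \<oplus> q \<otimes> q')"
      unfolding e using c by algebra
    moreover have "p \<otimes> q' \<oplus> q \<otimes> p' \<in> root_field hs"
      using Cons m by (intro space_add[OF s]) auto
    moreover have "(h \<otimes> h) \<otimes> (p \<otimes> p') \<oplus> q \<otimes> q' \<in> root_field hs"
      using Cons m square_in[OF c(1)] by (intro space_add[OF s] space_smult[OF s, of "h \<otimes> h"]) auto
    ultimately show ?case using root_field_Cons[of h hs] Cons.prems by blast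
  qed
  thus "subring (root_field hs) R"
    using space_carrier[OF s] one_in_root_field[OF assms] space_add[OF s]
    by (intro subringI) auto
qed

lemma root_field_ops:
  assumes "set hs \<subseteq> carrier R" "x \<in> root_field hs" "y \<in> root_field hs"
  shows "x \<oplus> y \<in> root_field hs" "x \<otimes> y \<in> root_field hs" "x \<in> carrier R"
    "y \<noteq> \<zero> \<Longrightarrow> inv y \<in> root_field hs"
  using subringE(6,7)[OF subfieldE(1)[OF root_field_subfield[OF assms(1)]]] assms
    space_carrier[OF root_field_space] subfield_m_inv(1)[OF root_field_subfield[OF assms(1)], of y] by auto

lemma generators_in_root_field:
  assumes "set hs \<subseteq> carrier R"
  shows "set hs \<subseteq> root_field hs"
  using assms
proof (induction hs)
  case (Cons h hs)
  have "h = h \<otimes> \<one> \<oplus> \<zero>" using Cons by simp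
  moreover have "\<one> \<in> root_field hs" "\<zero> \<in> root_field hs"
    using one_in_root_field space_zero[OF root_field_space] Cons by auto
  ultimately have "h \<in> root_field (h # hs)" using root_field_Cons[of h hs] Cons.prems by blast
  thus ?case using Cons root_field_mono[of h hs] by auto
qed simp

section \<open>Subspaces of minimal norm degree\<close>

text \<open>The norm field of any form whose set of values is \<open>D\<close>.\<close>

definition ratio_field :: "'a set \<Rightarrow> 'a set" where
  "ratio_field D = generate_field R (sqs \<union> {a \<otimes> inv b | a b. a \<in> D - {\<zero>} \<and> b \<in> D - {\<zero>}})"

text \<open>The value space of a minimal form of dimension \<open>m\<close>.\<close>

definition minimal_space :: "nat \<Rightarrow> 'a set \<Rightarrow> bool" where
  "minimal_space m D \<longleftrightarrow> dimension m sqs D \<and> 1 \<le> m \<and> (dim over sqs) (ratio_field D) = 2 ^ (m - 1)"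

lemma ratio_field_carrier:
  assumes "D \<subseteq> carrier R"
  shows "sqs \<union> {a \<otimes> inv b | a b. a \<in> D - {\<zero>} \<and> b \<in> D - {\<zero>}} \<subseteq> carrier R"
  using assms inv_nz sqs_carrier by blast

lemma minimal_space_scale:
  assumes "minimal_space m D" "c \<in> carrier R" "c \<noteq> \<zero>"
  shows "minimal_space m ((\<otimes>) c ` D)"
proof -
  have D: "D \<subseteq> carrier R"
    using assms(1) space_carrier[OF dimension_space] unfolding minimal_space_def by blast
  have eq: "(c \<otimes> a) \<otimes> inv (c \<otimes> b) = a \<otimes> inv b" if "a \<in> carrier R" "b \<in> carrier R" "b \<noteq> \<zero>" for a b
  proof -
    have "inv (c \<otimes> b) = inv c \<otimes> inv b"
      using that assms(2,3) inv_nz[of c] inv_nz[of b]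
      by (intro comm_inv_char) (simp_all add: m_ac inv_cancel)
    thus ?thesis using that assms(2,3) inv_nz[of c] inv_nz[of b] by (simp add: m_ac inv_cancel)
  qed
  have "{a \<otimes> inv b | a b. a \<in> (\<otimes>) c ` D - {\<zero>} \<and> b \<in> (\<otimes>) c ` D - {\<zero>}} =
      {a \<otimes> inv b | a b. a \<in> D - {\<zero>} \<and> b \<in> D - {\<zero>}}" (is "?A = ?B")
  proof (intro equalityI subsetI)
    fix x assume "x \<in> ?A"
    then obtain a b where ab: "a \<in> D" "b \<in> D" "c \<otimes> a \<noteq> \<zero>" "c \<otimes> b \<noteq> \<zero>" "x = (c \<otimes> a) \<otimes> inv (c \<otimes> b)"
      by blast
    hence "a \<noteq> \<zero>" "b \<noteq> \<zero>" using assms(2) by auto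
    thus "x \<in> ?B" using ab eq[of a b] D by blast
  next
    fix x assume "x \<in> ?B"
    then obtain a b where ab: "a \<in> D" "b \<in> D" "a \<noteq> \<zero>" "b \<noteq> \<zero>" "x = a \<otimes> inv b" by blast
    hence "c \<otimes> a \<noteq> \<zero>" "c \<otimes> b \<noteq> \<zero>" using assms(2,3) D integral[of c a] integral[of c b] by auto
    moreover have "x = (c \<otimes> a) \<otimes> inv (c \<otimes> b)"
      unfolding ab(5) by (rule eq[symmetric]) (use ab D in auto)
    ultimately show "x \<in> ?A" using ab by blast
  qed
  thus ?thesis using assms dimension_scale unfolding minimal_space_def ratio_field_def by auto
qed

text \<open>Minimality as 2-independence: if \<open>b\<close> were in \<open>F\<^sup>2(hs)\<close>, this field would contain \<open>D\<close> and with it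
  the norm field, but its degree is at most \<open>2\<close> to the power \<open>m - 2\<close>.\<close>

lemma minimal_space_not_in_root_field:
  assumes "minimal_space m D" "set (b # hs) \<subseteq> carrier R" "D \<subseteq> Span sqs (\<one> # b # hs)"
    and m: "m = length hs + 2"
  shows "b \<notin> root_field hs"
proof
  assume b: "b \<in> root_field hs"
  let ?A = "root_field hs"
  have hs: "set hs \<subseteq> carrier R" using assms(2) by simp
  note A = root_field_subfield[OF hs]
  have "Span sqs (\<one> # b # hs) \<subseteq> ?A"
    using subalgebra_Span_incl[OF squares_subfield root_field_space[OF hs]] b
      one_in_root_field[OF hs] generators_in_root_field[OF hs] by simp
  hence DA: "D \<subseteq> ?A" using assms(3) by blast
  have D: "D \<subseteq> carrier R"
    using assms(1) space_carrier[OF dimension_space] unfolding minimal_space_def by blast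
  have "ratio_field D \<subseteq> ?A"
    unfolding ratio_field_def
  proof (rule generate_field_min_subfield1[OF ratio_field_carrier[OF D] A])
    have "a \<otimes> inv b \<in> ?A" if "a \<in> D" "b \<in> D" "b \<noteq> \<zero>" for a b
      using root_field_ops(2)[OF hs, of a "inv b"] root_field_ops(4)[OF hs, of a b] that DA by blast
    thus "sqs \<union> {a \<otimes> inv b |a b. a \<in> D - {\<zero>} \<and> b \<in> D - {\<zero>}} \<subseteq> ?A"
      using space_square[OF root_field_space[OF hs] one_in_root_field[OF hs]] by blast
  qed
  moreover obtain r where r: "r \<le> 2 ^ length hs" "dimension r sqs ?A"
    using root_field_dimension[OF hs] by blast
  moreover have sp: "space (ratio_field D)"
  proof -
    have sub: "subfield (ratio_field D) R"
      unfolding ratio_field_def by (rule generate_field_is_subfield[OF ratio_field_carrier[OF D]])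
    have sq: "sqs \<subseteq> ratio_field D" unfolding ratio_field_def by (auto intro: generate_field.incl)
    show ?thesis
      using subringE(6)[OF subfieldE(1)[OF sub]] sq subring.axioms(1)[OF subfieldE(1)[OF sub]]
      by (intro subalgebra.intro subalgebra_axioms.intro) auto
  qed
  ultimately have "finite_dimension sqs (ratio_field D)"
    using subalbegra_incl_imp_finite_dimension[OF squares_subfield finite_dimensionI[OF r(2)] sp] by blast
  from finite_dimensionE[OF squares_subfield this]
  have "dimension (2 ^ (m - 1)) sqs (ratio_field D)" using assms(1) by (simp add: minimal_space_def)
  from dimension_mono[OF this r(2) \<open>ratio_field D \<subseteq> ?A\<close>] have "2 * 2 ^ length hs \<le> r" using m by simp
  moreover have "(0 :: nat) < 2 ^ length hs" by simp
  ultimately show False using r(1) by linarith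
qed


lemma Span_ConsE:
  assumes "x \<in> Span K (u # us)"
  obtains a y where "a \<in> K" "y \<in> Span K us" "x = a \<otimes> u \<oplus> y"
  using assms by (auto simp: in_Span_Cons)

text \<open>Complete \<open>1, x, y\<close> to a basis of \<open>D\<close> by a list \<open>Vs\<close>.  If \<open>xy\<close> were in \<open>D\<close>, it would be
  \<open>\<beta>x + \<gamma>y + \<alpha> + \<kappa>\<close> with \<open>\<alpha>, \<beta>, \<gamma> \<in> F\<^sup>2\<close> and \<open>\<kappa>\<close> in the span of \<open>Vs\<close>, and solving for \<open>x\<close> would place
  \<open>x\<close> in \<open>F\<^sup>2(y, Vs)\<close>.\<close>

lemma product_not_in_minimal_space:
  assumes D: "minimal_space m D" "\<one> \<in> D" and xy: "x \<in> D" "y \<in> D" "independent sqs [x, y, \<one>]"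
  shows "x \<otimes> y \<notin> D"
proof
  assume p: "x \<otimes> y \<in> D"
  have d: "dimension m sqs D" using D by (simp add: minimal_space_def)
  obtain Vs where Vs: "length (Vs @ [x, y, \<one>]) = m" "independent sqs (Vs @ [x, y, \<one>])"
      "Span sqs (Vs @ [x, y, \<one>]) = D"
    using complete_base[OF squares_subfield d xy(3)] xy D(2) by auto
  have c: "set Vs \<subseteq> carrier R" "x \<in> carrier R" "y \<in> carrier R"
    using independent_in_carrier[OF Vs(2)] by auto
  let ?L = "root_field (y # Vs)"
  have hs: "set (y # Vs) \<subseteq> carrier R" using c by simp
  have S: "Span sqs (\<one> # x # y # Vs) = D" "Span sqs (x # y # \<one> # Vs) = D"
    unfolding Vs(3)[symmetric] using c by (auto intro!: Span_same_set[OF squares_subfield])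
  have nx: "x \<notin> ?L"
    using minimal_space_not_in_root_field[OF D(1), of x "y # Vs"] c S(1) Vs(1) by simp
  obtain \<beta> \<gamma> \<alpha> \<kappa> where k: "\<beta> \<in> sqs" "\<gamma> \<in> sqs" "\<alpha> \<in> sqs" "\<kappa> \<in> Span sqs Vs"
    "x \<otimes> y = \<beta> \<otimes> x \<oplus> (\<gamma> \<otimes> y \<oplus> (\<alpha> \<otimes> \<one> \<oplus> \<kappa>))"
    using p unfolding S(2)[symmetric] by (elim Span_ConsE) blast
  note sL = root_field_space[OF hs] and oL = one_in_root_field[OF hs]
  have L: "y \<in> ?L" "\<kappa> \<in> ?L" "\<alpha> \<in> ?L" "\<beta> \<in> ?L" "\<gamma> \<otimes> y \<in> ?L"
    using generators_in_root_field[OF hs] k space_square[OF sL oL] space_smult[OF sL]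
      subalgebra_Span_incl[OF squares_subfield sL, of Vs] by auto
  have kc: "\<beta> \<in> carrier R" "\<gamma> \<in> carrier R" "\<alpha> \<in> carrier R" "\<kappa> \<in> carrier R"
    using k sqs_carrier space_carrier[OF sL L(2)] by auto
  let ?t = "\<gamma> \<otimes> y \<oplus> (\<alpha> \<oplus> \<kappa>)" and ?u = "y \<oplus> \<beta>"
  have t: "?t \<in> ?L" "?u \<in> ?L" using L by (auto intro!: space_add[OF sL])
  have "y \<notin> sqs" using xy(3) unfolding independent_Cons Span_one by blast
  hence u0: "?u \<noteq> \<zero>" using k(1) add_eq_zero_iff[of y \<beta>] c kc by auto
  have "x \<otimes> ?u = ?t"
  proof -
    have "x \<otimes> ?u = x \<otimes> y \<oplus> \<beta> \<otimes> x" using c kc by algebra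
    thus ?thesis unfolding k(5) using c kc by (simp add: a_ac)
  qed
  hence "x = ?t \<otimes> inv ?u" using u0 c kc inv_nz[of ?u] by (metis a_closed m_assoc r_one)
  thus False using nx root_field_ops(2)[OF hs t(1) root_field_ops(4)[OF hs t(2) t(2) u0]] by simp
qed

text \<open>Complete \<open>1, b, c, d\<close> to a basis of \<open>D\<close> and let \<open>L\<close> be the field generated by the basis elements
  other than \<open>b\<close>, so that \<open>b \<notin> L\<close>.  With \<open>e = \<beta>b + e'\<close> and \<open>f = \<beta>'b + f'\<close>, the equation \<open>bcd = ef\<close>
  is linear in \<open>b\<close> over \<open>L\<close>, since \<open>b\<^sup>2 \<in> F\<^sup>2\<close>.  Comparing the coefficients of \<open>b\<close> gives
  \<open>cd = \<beta>f' + \<beta>'e'\<close>, which lies in \<open>D\<close>, against the previous lemma.\<close>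

lemma triple_product_not_product:
  assumes D: "minimal_space m D" "\<one> \<in> D"
    and bcd: "b \<in> D" "c \<in> D" "d \<in> D" "independent sqs [b, c, d, \<one>]" and ef: "e \<in> D" "f \<in> D"
  shows "b \<otimes> (c \<otimes> d) \<noteq> e \<otimes> f"
proof
  assume eq: "b \<otimes> (c \<otimes> d) = e \<otimes> f"
  have dm: "dimension m sqs D" using D by (simp add: minimal_space_def)
  obtain Vs where Vs: "length (Vs @ [b, c, d, \<one>]) = m" "independent sqs (Vs @ [b, c, d, \<one>])"
      "Span sqs (Vs @ [b, c, d, \<one>]) = D"
    using complete_base[OF squares_subfield dm bcd(4)] bcd D(2) by auto
  have cr: "set Vs \<subseteq> carrier R" "b \<in> carrier R" "c \<in> carrier R" "d \<in> carrier R"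
    using independent_in_carrier[OF Vs(2)] by auto
  let ?L = "root_field (c # d # Vs)" and ?H = "Span sqs (c # d # \<one> # Vs)"
  have hs: "set (c # d # Vs) \<subseteq> carrier R" using cr by simp
  have S: "Span sqs (\<one> # b # c # d # Vs) = D" "Span sqs (b # c # d # \<one> # Vs) = D"
    unfolding Vs(3)[symmetric] using cr by (auto intro!: Span_same_set[OF squares_subfield])
  have nb: "b \<notin> ?L"
    using minimal_space_not_in_root_field[OF D(1), of b "c # d # Vs"] cr S(1) Vs(1) by simp
  note sL = root_field_space[OF hs]
  have sH: "space ?H" using cr by (intro Span_space) auto
  have HL: "?H \<subseteq> ?L"
    using subalgebra_Span_incl[OF squares_subfield sL, of "c # d # \<one> # Vs"]
      generators_in_root_field[OF hs] one_in_root_field[OF hs] by auto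
  have HD: "?H \<subseteq> D" unfolding S(2)[symmetric] using cr by (intro mono_Span[OF squares_subfield]) auto
  obtain \<beta> e' where e: "\<beta> \<in> sqs" "e' \<in> ?H" "e = \<beta> \<otimes> b \<oplus> e'"
    using ef(1) unfolding S(2)[symmetric] in_Span_Cons[of _ sqs b] by blast
  obtain \<beta>' f' where f: "\<beta>' \<in> sqs" "f' \<in> ?H" "f = \<beta>' \<otimes> b \<oplus> f'"
    using ef(2) unfolding S(2)[symmetric] in_Span_Cons[of _ sqs b] by blast
  have kc: "\<beta> \<in> carrier R" "\<beta>' \<in> carrier R" "e' \<in> carrier R" "f' \<in> carrier R"
    using e f sqs_carrier space_carrier[OF sH] by auto
  let ?g = "\<beta> \<otimes> f' \<oplus> \<beta>' \<otimes> e'"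
  have g: "?g \<in> ?H" using e f by (intro space_add[OF sH] space_smult[OF sH])
  let ?w = "c \<otimes> d \<oplus> ?g" and ?r = "(\<beta> \<otimes> \<beta>') \<otimes> (b \<otimes> b) \<oplus> e' \<otimes> f'"
  have bw: "b \<otimes> ?w = ?r"
  proof -
    have "e \<otimes> f = ?r \<oplus> b \<otimes> ?g" unfolding e f using cr kc by algebra
    hence "b \<otimes> ?w = (?r \<oplus> b \<otimes> ?g) \<oplus> b \<otimes> ?g" unfolding eq[symmetric] using cr kc by (simp add: r_distr)
    also have "\<dots> = ?r" by (subst a_assoc) (use cr kc in simp_all)
    finally show ?thesis .
  qed
  have sq: "sqs \<subseteq> ?L" using space_square[OF sL one_in_root_field[OF hs]] by blast
  have r: "?r \<in> ?L"
    using e f HL sq square_in[OF cr(2)]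
    by (intro root_field_ops(1)[OF hs] root_field_ops(2)[OF hs, of "\<beta> \<otimes> \<beta>'"]
        root_field_ops(2)[OF hs, of e'] root_field_ops(2)[OF hs, of \<beta>]) auto
  have w: "?w \<in> ?L"
    using generators_in_root_field[OF hs]
    by (intro root_field_ops(1)[OF hs _ subsetD[OF HL g]] root_field_ops(2)[OF hs, of c]) auto
  have "?w = \<zero>"
  proof (rule ccontr)
    assume w0: "?w \<noteq> \<zero>"
    have "b = ?r \<otimes> inv ?w"
      unfolding bw[symmetric] using w0 cr kc inv_nz[of ?w] by (simp add: m_assoc)
    thus False using nb root_field_ops(2)[OF hs r root_field_ops(4)[OF hs w w w0]] by simp
  qed
  hence "c \<otimes> d = ?g" using add_eq_zero_iff[of "c \<otimes> d" ?g] cr kc by simp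
  hence "c \<otimes> d \<in> D" using g HD by auto
  moreover have "independent sqs [c, d, \<one>]" using bcd(4) independent_backwards(2) by blast
  ultimately show False using product_not_in_minimal_space[OF D bcd(2,3)] by blast
qed

text \<open>If \<open>a = \<beta>b + \<gamma>\<close> with \<open>\<beta>, \<gamma> \<in> F\<^sup>2\<close>, then \<open>ab = \<beta>b\<^sup>2 + \<gamma>b\<close> is in \<open>D\<close>.\<close>

lemma independent_if_product_outside:
  assumes D: "space D" "\<one> \<in> D" and ab: "a \<in> D" "b \<in> D" "a \<otimes> b \<notin> D"
  shows "independent sqs [a, b, \<one>]"
proof -
  have c: "a \<in> carrier R" "b \<in> carrier R" using ab space_carrier[OF D(1)] by auto
  have "b \<notin> sqs" using ab space_smult[OF D(1), of b a] m_comm c by auto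
  moreover have "a \<notin> Span sqs [b, \<one>]"
  proof
    assume "a \<in> Span sqs [b, \<one>]"
    then obtain \<beta> \<gamma> where a: "\<beta> \<in> sqs" "\<gamma> \<in> sqs" "a = \<beta> \<otimes> b \<oplus> \<gamma>"
      unfolding in_Span_Cons[of _ _ b] Span_one by blast
    hence "a \<otimes> b = (\<beta> \<otimes> (b \<otimes> b)) \<oplus> \<gamma> \<otimes> b" using c sqs_carrier by (simp add: l_distr m_assoc)
    moreover have "\<beta> \<otimes> (b \<otimes> b) \<in> D"
      using space_smult[OF D(1) a(1) space_square[OF D]] square_in c by blast
    moreover have "\<gamma> \<otimes> b \<in> D" using space_smult[OF D(1) a(2) ab(2)] .
    ultimately show False using ab(3) space_add[OF D(1)] by auto
  qed
  moreover have "\<one> \<notin> Span sqs []" by (simp add: Span_Nil)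
  ultimately show ?thesis unfolding independent_Cons Span_one using c by auto
qed

lemma in_Span_with_oneE:
  assumes "x \<in> Span sqs [a, b, \<one>]" "a \<in> carrier R" "b \<in> carrier R"
  obtains \<alpha> \<beta> \<gamma> where "\<alpha> \<in> sqs" "\<beta> \<in> sqs" "\<gamma> \<in> sqs" "x = \<alpha> \<otimes> a \<oplus> \<beta> \<otimes> b \<oplus> \<gamma>"
proof -
  obtain \<alpha> \<beta> \<gamma> where k: "\<alpha> \<in> sqs" "\<beta> \<in> sqs" "\<gamma> \<in> sqs" "x = \<alpha> \<otimes> a \<oplus> (\<beta> \<otimes> b \<oplus> \<gamma>)"
    using assms(1) by (elim Span_ConsE[of _ _ a] Span_ConsE[of _ _ b]) (simp add: Span_one)
  thus thesis using that[of \<alpha> \<beta> \<gamma>] assms(2,3) sqs_carrier by (simp add: a_assoc)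
qed

text \<open>Let \<open>z = ab\<close> be an element of \<open>D'\<close> outside \<open>D\<close>.  The products \<open>xz = xab\<close> and \<open>yz = yab\<close> are
  products of two elements of \<open>D\<close>, so \<open>x\<close> and \<open>y\<close> are combinations of \<open>a, b, 1\<close>.  Multiplying the
  two combinations expresses \<open>xy\<close> by \<open>ab = z\<close>, \<open>x\<close>, \<open>y\<close> and squares, all in \<open>D'\<close>, whereas \<open>xy\<close>
  cannot be in the minimal space \<open>D'\<close>.\<close>

lemma minimal_space_subset:
  assumes D: "minimal_space m D" "\<one> \<in> D" and D': "minimal_space m D'" "\<one> \<in> D'"
    and P: "\<And>s t. \<lbrakk>s \<in> D'; t \<in> D'\<rbrakk> \<Longrightarrow> \<exists>a\<in>D. \<exists>b\<in>D. s \<otimes> t = a \<otimes> b"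
    and xy: "x \<in> D" "x \<in> D'" "y \<in> D" "y \<in> D'" "independent sqs [x, y, \<one>]"
  shows "D' \<subseteq> D"
proof
  fix z assume z: "z \<in> D'"
  have s: "space D" "space D'" using D D' dimension_space by (auto simp: minimal_space_def)
  have zc: "z \<in> carrier R" using z space_carrier[OF s(2)] by blast
  obtain a b where ab: "a \<in> D" "b \<in> D" "z = a \<otimes> b" using P[OF z D'(2)] zc by auto
  have c: "a \<in> carrier R" "b \<in> carrier R" "x \<in> carrier R" "y \<in> carrier R"
    using ab xy space_carrier[OF s(1)] by auto
  show "z \<in> D"
  proof (rule ccontr)
    assume nz: "z \<notin> D"
    hence i: "independent sqs [a, b, \<one>]" using independent_if_product_outside[OF s(1) D(2) ab(1,2)] ab(3) by simp
    have S: "t \<in> Span sqs [a, b, \<one>]" if t: "t \<in> D" "t \<in> D'" for t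
    proof (rule ccontr)
      assume "t \<notin> Span sqs [a, b, \<one>]"
      hence "independent sqs [t, a, b, \<one>]"
        using i space_carrier[OF s(1) t(1)] independent_Cons[of sqs t "[a, b, \<one>]"] by simp
      moreover obtain e f where "e \<in> D" "f \<in> D" "t \<otimes> z = e \<otimes> f" using P[OF t(2) z] by blast
      ultimately show False using triple_product_not_product[OF D t(1) ab(1,2)] ab(3) by metis
    qed
    obtain \<alpha> \<beta> \<gamma> where k: "\<alpha> \<in> sqs" "\<beta> \<in> sqs" "\<gamma> \<in> sqs" "x = \<alpha> \<otimes> a \<oplus> \<beta> \<otimes> b \<oplus> \<gamma>"
      using in_Span_with_oneE[OF S[OF xy(1,2)] c(1,2)] .
    obtain \<alpha>' \<beta>' \<gamma>' where k': "\<alpha>' \<in> sqs" "\<beta>' \<in> sqs" "\<gamma>' \<in> sqs" "y = \<alpha>' \<otimes> a \<oplus> \<beta>' \<otimes> b \<oplus> \<gamma>'"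
      using in_Span_with_oneE[OF S[OF xy(3,4)] c(1,2)] .
    have kc: "\<alpha> \<in> carrier R" "\<beta> \<in> carrier R" "\<gamma> \<in> carrier R" "\<alpha>' \<in> carrier R" "\<beta>' \<in> carrier R" "\<gamma>' \<in> carrier R"
      using k k' sqs_carrier by auto
    have kk: "r \<otimes> t \<in> sqs" if "r \<in> sqs" "t \<in> sqs" for r t
      using subringE(6)[OF subfieldE(1)[OF squares_subfield]] that .
    have ka: "r \<oplus> t \<in> sqs" if "r \<in> sqs" "t \<in> sqs" for r t
      using subringE(7)[OF subfieldE(1)[OF squares_subfield]] that .
    let ?m = "\<alpha> \<otimes> \<beta>' \<oplus> \<alpha>' \<otimes> \<beta>"
    let ?u = "\<alpha> \<otimes> a \<oplus> \<beta> \<otimes> b" and ?v = "\<alpha>' \<otimes> a \<oplus> \<beta>' \<otimes> b"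
    have u: "?u = x \<oplus> \<gamma>" and v: "?v = y \<oplus> \<gamma>'"
      unfolding k(4) k'(4) using c kc by (simp_all add: a_assoc)
    have xyc: "x \<otimes> y = ?u \<otimes> ?v \<oplus> (\<gamma>' \<otimes> x \<oplus> (\<gamma> \<otimes> y \<oplus> \<gamma> \<otimes> \<gamma>'))"
      unfolding u v using c(3,4) kc by (simp add: l_distr r_distr m_ac a_ac)
    have uv: "?u \<otimes> ?v = (\<alpha> \<otimes> \<alpha>') \<otimes> (a \<otimes> a) \<oplus> ((\<beta> \<otimes> \<beta>') \<otimes> (b \<otimes> b) \<oplus> ?m \<otimes> z)"
      unfolding ab(3) using c kc by (simp add: l_distr r_distr m_ac a_ac)
    have qD: "t \<in> D'" if "t \<in> sqs" for t using space_square[OF s(2) D'(2) that] .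
    have "(\<alpha> \<otimes> \<alpha>') \<otimes> (a \<otimes> a) \<in> D'" "(\<beta> \<otimes> \<beta>') \<otimes> (b \<otimes> b) \<in> D'" "\<gamma> \<otimes> \<gamma>' \<in> D'"
      by (rule qD[OF kk[OF kk[OF k(1) k'(1)] square_in[OF c(1)]]],
          rule qD[OF kk[OF kk[OF k(2) k'(2)] square_in[OF c(2)]]], rule qD[OF kk[OF k(3) k'(3)]])
    moreover have "?m \<in> sqs" using k k' by (intro ka kk)
    hence "?m \<otimes> z \<in> D'" using space_smult[OF s(2) _ z] by blast
    moreover have "\<gamma>' \<otimes> x \<in> D'" "\<gamma> \<otimes> y \<in> D'"
      using space_smult[OF s(2)] k(3) k'(3) xy(2,4) by blast+
    ultimately have "x \<otimes> y \<in> D'" unfolding xyc uv by (simp add: space_add[OF s(2)])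
    thus False using product_not_in_minimal_space[OF D' xy(2,4,5)] by blast
  qed
qed


text \<open>\<open>ab = (ga) (g b/g\<^sup>2)\<close>, so scaling a space does not change the set of products.\<close>

lemma products_scale:
  assumes D: "space D" and g: "g \<in> carrier R" "g \<noteq> \<zero>" and t: "\<exists>a\<in>D. \<exists>b\<in>D. t = a \<otimes> b"
  shows "\<exists>a\<in>(\<otimes>) g ` D. \<exists>b\<in>(\<otimes>) g ` D. t = a \<otimes> b"
proof -
  obtain a b where ab: "a \<in> D" "b \<in> D" "t = a \<otimes> b" using t by blast
  have c: "a \<in> carrier R" "b \<in> carrier R" using ab space_carrier[OF D] by auto
  note i = inv_nz[OF g]
  have "(inv g \<otimes> inv g) \<otimes> b \<in> D"
    using space_smult[OF D square_in ab(2)] i by simp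
  moreover have "t = (g \<otimes> a) \<otimes> (g \<otimes> ((inv g \<otimes> inv g) \<otimes> b))"
  proof -
    have "g \<otimes> ((inv g \<otimes> inv g) \<otimes> b) = inv g \<otimes> b" using i c g by (simp add: m_assoc inv_cancel)
    hence "(g \<otimes> a) \<otimes> (g \<otimes> ((inv g \<otimes> inv g) \<otimes> b)) = a \<otimes> (g \<otimes> (inv g \<otimes> b))"
      using i c g by (simp only:) (simp add: m_ac)
    thus ?thesis using i c g ab(3) by (simp add: inv_cancel)
  qed
  ultimately show ?thesis using ab(1) by blast
qed

text \<open>By the previous lemmas it suffices to find a scaling of \<open>D\<close> that contains three independent
  elements \<open>1, x, y\<close> of \<open>D'\<close>, or a basis of \<open>D'\<close> if \<open>m \<le> 2\<close>.  Each element of \<open>D'\<close> is a product of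
  elements of \<open>D\<close>; writing \<open>y = ce\<close>, the space \<open>E = cD\<close> contains \<open>1\<close> and \<open>y\<close>.  If \<open>x = ab\<close> is not in
  \<open>E\<close>, then \<open>yab\<close> being a product in \<open>E\<close> forces \<open>y = \<alpha>a + \<beta>b + \<gamma>\<close>, and \<open>g = \<alpha>a + \<beta>b\<close> is the common
  factor modulo squares: both \<open>x\<close> and \<open>y = g + \<gamma>\<close> are in \<open>gE\<close>, because
  \<open>gb = \<alpha>x + \<beta>b\<^sup>2\<close> and \<open>ga = \<beta>x + \<alpha>a\<^sup>2\<close>.\<close>

lemma eq_scale_if_one_in:
  assumes D: "minimal_space m D" and D': "minimal_space m D'" "\<one> \<in> D'"
    and P: "\<And>s t. \<lbrakk>s \<in> D'; t \<in> D'\<rbrakk> \<Longrightarrow> \<exists>a\<in>D. \<exists>b\<in>D. s \<otimes> t = a \<otimes> b"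
  shows "\<exists>g\<in>carrier R - {\<zero>}. D' = (\<otimes>) g ` D"
proof -
  have d: "dimension m sqs D" "dimension m sqs D'" "1 \<le> m" using D D' by (auto simp: minimal_space_def)
  note s = dimension_space[OF d(1)] dimension_space[OF d(2)]
  have one: "independent sqs [\<one>]" by (auto simp: independent_Cons Span_Nil)
  have same: "?thesis" if g: "g \<in> carrier R" "g \<noteq> \<zero>" and us: "independent sqs us" "length us = m"
      "set us \<subseteq> D'" "set us \<subseteq> (\<otimes>) g ` D" for g us
  proof -
    have "Span sqs us = D'"
      using independent_length_eq_dimension[OF squares_subfield d(2) us(1,3)] us(2) by simp
    moreover have "Span sqs us = (\<otimes>) g ` D"
      using independent_length_eq_dimension[OF squares_subfield dimension_scale[OF d(1) g] us(1,4)] us(2) by simp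
    ultimately show ?thesis using g by blast
  qed
  have finish: "D' = (\<otimes>) g ` E"
    if E: "minimal_space m E" "\<And>s t. \<lbrakk>s \<in> D'; t \<in> D'\<rbrakk> \<Longrightarrow> \<exists>a\<in>E. \<exists>b\<in>E. s \<otimes> t = a \<otimes> b"
      and g: "g \<in> carrier R" "g \<noteq> \<zero>"
      and xy: "x \<in> D'" "y \<in> D'" "independent sqs [x, y, \<one>]"
        "x \<in> (\<otimes>) g ` E" "y \<in> (\<otimes>) g ` E" "\<one> \<in> (\<otimes>) g ` E" for E g x y
  proof -
    have sE: "space E" using E(1) dimension_space unfolding minimal_space_def by blast
    note m = minimal_space_scale[OF E(1) g]
    have "D' \<subseteq> (\<otimes>) g ` E"
      using minimal_space_subset[OF m xy(6) D' products_scale[OF sE g E(2)] xy(4,1,5,2,3)] .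
    thus ?thesis using dimension_eq_if_subset[OF d(2)] m unfolding minimal_space_def by blast
  qed
  consider "m = 1" | "m = 2" | "3 \<le> m" using d(3) by linarith
  thus ?thesis
  proof cases
    case 1
    obtain a where a: "a \<in> D" "independent sqs [a]"
      using independent_outside[OF d(1), of "[]"] 1 by auto
    hence a': "a \<noteq> \<zero>" "a \<in> carrier R" by (auto simp: independent_Cons Span_Nil)
    show ?thesis using same[OF a'(2,1) one] 1 D'(2) one_in_scale[OF s(1) a(1) a'(1)] by simp
  next
    case 2
    obtain x where x: "x \<in> D'" "independent sqs [x, \<one>]"
      using independent_outside[OF d(2) one] 2 D'(2) by auto
    hence x': "x \<noteq> \<zero>" "x \<in> carrier R"
      using space_zero[OF Span_space, of "[\<one>]"] by (auto simp: independent_Cons)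
    obtain a b where ab: "a \<in> D" "b \<in> D" "x = a \<otimes> b" using P[OF x(1) D'(2)] x' by auto
    have c: "a \<in> carrier R" "b \<in> carrier R" using ab space_carrier[OF s(1)] by auto
    hence a0: "a \<noteq> \<zero>" using ab x' by auto
    show ?thesis using same[OF c(1) a0 x(2)] 2 D'(2) one_in_scale[OF s(1) ab(1) a0] ab x(1) by auto
  next
    case 3
    obtain y where y: "y \<in> D'" "independent sqs [y, \<one>]"
      using independent_outside[OF d(2) one] 3 D'(2) by auto
    obtain x where x: "x \<in> D'" "independent sqs [x, y, \<one>]"
      using independent_outside[OF d(2) y(2)] 3 D'(2) y(1) by auto
    have xyc: "x \<in> carrier R" "y \<in> carrier R" using x y space_carrier[OF s(2)] by auto
    have ys: "y \<notin> sqs" using y(2) Span_one unfolding independent_Cons by simp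
    have y0: "y \<noteq> \<zero>" using ys square_in[of \<zero>] by auto
    obtain c e where ce: "c \<in> D" "e \<in> D" "y = c \<otimes> e" using P[OF y(1) D'(2)] xyc by auto
    have cec: "c \<in> carrier R" "e \<in> carrier R" using ce space_carrier[OF s(1)] by auto
    have c0: "c \<noteq> \<zero>" using ce y0 cec by auto
    define E where "E = (\<otimes>) c ` D"
    have mE: "minimal_space m E" unfolding E_def by (rule minimal_space_scale[OF D cec(1) c0])
    have sE: "space E" using mE dimension_space unfolding minimal_space_def by blast
    have PE: "\<exists>a\<in>E. \<exists>b\<in>E. s \<otimes> t = a \<otimes> b" if "s \<in> D'" "t \<in> D'" for s t
      unfolding E_def by (rule products_scale[OF s(1) cec(1) c0 P[OF that]])
    have oE: "\<one> \<in> E" unfolding E_def by (rule one_in_scale[OF s(1) ce(1) c0])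
    have yE: "y \<in> E" unfolding E_def using ce by blast
    obtain a b where ab: "a \<in> E" "b \<in> E" "x = a \<otimes> b" using PE[OF x(1) D'(2)] xyc by auto
    have abc: "a \<in> carrier R" "b \<in> carrier R" using ab space_carrier[OF sE] by auto
    show ?thesis
    proof (cases "x \<in> E")
      case True
      have E1: "(\<otimes>) \<one> ` E = E" using scale_one[of E] space_carrier[OF sE] by blast
      have "D' = (\<otimes>) \<one> ` E"
        by (rule finish[OF mE PE _ _ x(1) y(1) x(2)]) (use True yE oE E1 in simp_all)
      hence "D' = E" using E1 by simp
      thus ?thesis unfolding E_def using cec c0 by blast
    next
      case False
      hence i: "independent sqs [a, b, \<one>]"
        using independent_if_product_outside[OF sE oE ab(1,2)] ab(3) by simp
      have "y \<in> Span sqs [a, b, \<one>]"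
      proof (rule ccontr)
        assume "y \<notin> Span sqs [a, b, \<one>]"
        hence "independent sqs [y, a, b, \<one>]"
          using i xyc independent_Cons[of sqs y "[a, b, \<one>]"] by simp
        moreover obtain p q where "p \<in> E" "q \<in> E" "y \<otimes> x = p \<otimes> q" using PE[OF y(1) x(1)] by blast
        ultimately show False using triple_product_not_product[OF mE oE yE ab(1,2)] ab(3) by metis
      qed
      then obtain \<alpha> \<beta> \<gamma> where k: "\<alpha> \<in> sqs" "\<beta> \<in> sqs" "\<gamma> \<in> sqs" "y = \<alpha> \<otimes> a \<oplus> \<beta> \<otimes> b \<oplus> \<gamma>"
        using in_Span_with_oneE abc by metis
      have kc: "\<alpha> \<in> carrier R" "\<beta> \<in> carrier R" "\<gamma> \<in> carrier R" using k sqs_carrier by auto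
      define g where "g = \<alpha> \<otimes> a \<oplus> \<beta> \<otimes> b"
      have gE: "g \<in> E" unfolding g_def using k ab by (intro space_add[OF sE] space_smult[OF sE])
      have gc: "g \<in> carrier R" using gE space_carrier[OF sE] by blast
      have g0: "g \<noteq> \<zero>" using ys k kc unfolding g_def[symmetric] by auto
      have sg: "space ((\<otimes>) g ` E)"
        using dimension_scale[OF _ gc g0] mE dimension_space unfolding minimal_space_def by blast
      have og: "\<one> \<in> (\<otimes>) g ` E" by (rule one_in_scale[OF sE gE g0])
      have qg: "t \<in> (\<otimes>) g ` E" if "t \<in> sqs" for t using space_square[OF sg og that] .
      have "g \<in> (\<otimes>) g ` E" using oE gc by (intro image_eqI[of _ _ \<one>]) auto
      hence yg: "y \<in> (\<otimes>) g ` E" using space_add[OF sg _ qg[OF k(3)]] unfolding k(4) g_def[symmetric] by blast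
      have main: "x \<in> (\<otimes>) g ` E"
        if h: "\<mu> \<in> sqs" "\<nu> \<in> sqs" "\<mu> \<noteq> \<zero>" "u \<in> E" "g \<otimes> u = \<mu> \<otimes> x \<oplus> \<nu> \<otimes> (u \<otimes> u)" for \<mu> \<nu> u
      proof -
        have hc: "\<mu> \<in> carrier R" "\<nu> \<in> carrier R" "u \<in> carrier R" using h sqs_carrier space_carrier[OF sE] by auto
        have "\<mu> \<otimes> x = g \<otimes> u \<oplus> \<nu> \<otimes> (u \<otimes> u)"
          unfolding h(5) using hc xyc by (simp add: a_assoc)
        moreover have "g \<otimes> u \<oplus> \<nu> \<otimes> (u \<otimes> u) \<in> (\<otimes>) g ` E"
          by (rule space_add[OF sg imageI[OF h(4)] space_smult[OF sg h(2) qg[OF square_in[OF hc(3)]]]])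
        ultimately have "\<mu> \<otimes> x \<in> (\<otimes>) g ` E" by simp
        moreover have "inv \<mu> \<in> sqs" using subfield_m_inv(1)[OF squares_subfield] h(1,3) by auto
        ultimately have "inv \<mu> \<otimes> (\<mu> \<otimes> x) \<in> (\<otimes>) g ` E" using space_smult[OF sg] by blast
        thus ?thesis using inv_cancel(2)[OF hc(1) h(3) xyc(1)] by simp
      qed
      have xg: "x \<in> (\<otimes>) g ` E"
      proof (cases "\<alpha> = \<zero>")
        case False
        have "g \<otimes> b = \<alpha> \<otimes> x \<oplus> \<beta> \<otimes> (b \<otimes> b)" unfolding g_def ab(3) using kc abc by algebra
        thus ?thesis using main[OF k(1,2) False ab(2)] by blast
      next
        case True
        have "\<beta> \<noteq> \<zero>" using g0 True abc kc unfolding g_def by auto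
        moreover have "g \<otimes> a = \<beta> \<otimes> x \<oplus> \<alpha> \<otimes> (a \<otimes> a)" unfolding g_def ab(3) using kc abc by algebra
        ultimately show ?thesis using main[OF k(2,1) _ ab(1)] by blast
      qed
      have "D' = (\<otimes>) g ` E" by (rule finish[OF mE PE gc g0 x(1) y(1) x(2) xg yg og])
      also have "\<dots> = (\<otimes>) (g \<otimes> c) ` D"
        unfolding E_def using scale_scale[OF _ gc cec(1)] space_carrier[OF s(1)] by blast
      finally show ?thesis using gc g0 cec c0 integral[of g c] by blast
    qed
  qed
qed

theorem minimal_spaces_proportional:
  assumes D: "minimal_space m D" and D': "minimal_space m D'"
    and P: "\<And>s t. \<lbrakk>s \<in> D'; t \<in> D'\<rbrakk> \<Longrightarrow> \<exists>a\<in>D. \<exists>b\<in>D. s \<otimes> t = a \<otimes> b"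
  shows "\<exists>g\<in>carrier R - {\<zero>}. D' = (\<otimes>) g ` D"
proof -
  have d: "dimension m sqs D" "dimension m sqs D'" "1 \<le> m" using D D' by (auto simp: minimal_space_def)
  note s = dimension_space[OF d(1)] dimension_space[OF d(2)]
  obtain c where "c \<in> D'" "independent sqs [c]"
    using independent_outside[OF d(2), of "[]"] d(3) by auto
  hence c: "c \<in> D'" "c \<noteq> \<zero>" "c \<in> carrier R" by (auto simp: independent_Cons Span_Nil)
  have "\<exists>g\<in>carrier R - {\<zero>}. (\<otimes>) c ` D' = (\<otimes>) g ` D"
  proof (rule eq_scale_if_one_in[OF D minimal_space_scale[OF D' c(3,2)] one_in_scale[OF s(2) c(1,2)]])
    fix x y assume "x \<in> (\<otimes>) c ` D'" "y \<in> (\<otimes>) c ` D'"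
    then obtain x' y' where xy: "x' \<in> D'" "y' \<in> D'" "x = c \<otimes> x'" "y = c \<otimes> y'" by blast
    obtain a b where ab: "a \<in> D" "b \<in> D" "x' \<otimes> y' = a \<otimes> b" using P[OF xy(1,2)] by blast
    have cr: "x' \<in> carrier R" "y' \<in> carrier R" "a \<in> carrier R" "b \<in> carrier R"
      using xy ab space_carrier[OF s(1)] space_carrier[OF s(2)] by auto
    have "x \<otimes> y = (c \<otimes> c) \<otimes> (x' \<otimes> y')" unfolding xy using c cr by (simp add: m_ac)
    also have "\<dots> = ((c \<otimes> c) \<otimes> a) \<otimes> b" unfolding ab(3) using c cr by (simp add: m_assoc)
    finally show "\<exists>a\<in>D. \<exists>b\<in>D. x \<otimes> y = a \<otimes> b"
      using space_smult[OF s(1) square_in[OF c(3)] ab(1)] ab(2) by blast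
  qed
  then obtain g where g: "g \<in> carrier R" "g \<noteq> \<zero>" "(\<otimes>) c ` D' = (\<otimes>) g ` D" by blast
  note i = inv_nz[OF c(3,2)]
  have "D' = (\<otimes>) (inv c \<otimes> c) ` D'" using scale_one[of D'] i c space_carrier[OF s(2)] by (auto simp: m_comm)
  also have "\<dots> = (\<otimes>) (inv c) ` (\<otimes>) c ` D'"
    using scale_scale[of D' "inv c" c] i c space_carrier[OF s(2)] by auto
  also have "\<dots> = (\<otimes>) (inv c \<otimes> g) ` D"
    unfolding g(3) using scale_scale[of D "inv c" g] i g space_carrier[OF s(1)] by auto
  finally show ?thesis using i g integral[of "inv c" g] by blast
qed

end

section \<open>Coordinates in a vector space\<close>

text \<open>Bases and coefficients are lists, as in \<open>combine\<close>, so that the values of a form on a basis form a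
  list over which the coefficients can be combined even if values repeat.\<close>

fun lcomb :: "('k, 'v, 'n) module_scheme \<Rightarrow> 'k list \<Rightarrow> 'v list \<Rightarrow> 'v" where
  "lcomb V (x # xs) (v # vs) = (x \<odot>\<^bsub>V\<^esub> v) \<oplus>\<^bsub>V\<^esub> lcomb V xs vs"
| "lcomb V xs vs = \<zero>\<^bsub>V\<^esub>"

definition coefs :: "('k, 'm) ring_scheme \<Rightarrow> nat \<Rightarrow> 'k list set" where
  "coefs K n = {xs. set xs \<subseteq> carrier K \<and> length xs = n}"

definition list_basis :: "('k, 'm) ring_scheme \<Rightarrow> ('k, 'v, 'n) module_scheme \<Rightarrow> 'v list \<Rightarrow> bool" where
  "list_basis K V vs \<longleftrightarrow> set vs \<subseteq> carrier V \<and>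
     (\<forall>v\<in>carrier V. \<exists>xs\<in>coefs K (length vs). v = lcomb V xs vs) \<and>
     (\<forall>xs\<in>coefs K (length vs). lcomb V xs vs = \<zero>\<^bsub>V\<^esub> \<longrightarrow> xs = replicate (length vs) \<zero>\<^bsub>K\<^esub>)"

lemma coefs_Suc: "xs \<in> coefs K (Suc n) \<longleftrightarrow> (\<exists>y ys. xs = y # ys \<and> y \<in> carrier K \<and> ys \<in> coefs K n)"
  by (cases xs) (auto simp: coefs_def)

lemma coefs_zero: "xs \<in> coefs K 0 \<longleftrightarrow> xs = []"
  by (auto simp: coefs_def)

lemma list_basis_carrier: "list_basis K V vs \<Longrightarrow> set vs \<subseteq> carrier V"
  by (simp add: list_basis_def)

lemma list_basis_spans:
  assumes "list_basis K V vs" "v \<in> carrier V"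
  obtains xs where "xs \<in> coefs K (length vs)" "v = lcomb V xs vs"
  using assms by (auto simp: list_basis_def)

lemma list_basis_independent:
  "\<lbrakk>list_basis K V vs; xs \<in> coefs K (length vs); lcomb V xs vs = \<zero>\<^bsub>V\<^esub>\<rbrakk> \<Longrightarrow> xs = replicate (length vs) \<zero>\<^bsub>K\<^esub>"
  by (simp add: list_basis_def)

lemma coefs_add:
  assumes "ring K" "xs \<in> coefs K n" "ys \<in> coefs K n"
  shows "map2 (\<oplus>\<^bsub>K\<^esub>) xs ys \<in> coefs K n"
proof -
  interpret ring K by fact
  show ?thesis using assms(2,3)
    by (induction n arbitrary: xs ys) (auto simp: coefs_Suc coefs_zero)
qed

abbreviation unit_coefs :: "('k, 'm) ring_scheme \<Rightarrow> nat \<Rightarrow> nat \<Rightarrow> 'k list" where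
  "unit_coefs K n i \<equiv> (replicate n \<zero>\<^bsub>K\<^esub>)[i := \<one>\<^bsub>K\<^esub>]"

lemma unit_coefs_closed: "ring K \<Longrightarrow> unit_coefs K n i \<in> coefs K n"
  using set_update_subset_insert[of "replicate n \<zero>\<^bsub>K\<^esub>" i "\<one>\<^bsub>K\<^esub>"]
    ring.ring_simprules(2,6)[of K]
  by (auto simp: coefs_def set_replicate_conv_if split: if_splits)

definition coordinates :: "('k, 'm) ring_scheme \<Rightarrow> ('k, 'v, 'n) module_scheme \<Rightarrow> 'v list \<Rightarrow> 'v \<Rightarrow> 'k list" where
  "coordinates K V vs v = (SOME xs. xs \<in> coefs K (length vs) \<and> lcomb V xs vs = v)"

lemma coordinates:
  assumes "list_basis K V vs" "v \<in> carrier V"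
  shows "coordinates K V vs v \<in> coefs K (length vs)" "lcomb V (coordinates K V vs v) vs = v"
proof -
  have "\<exists>xs. xs \<in> coefs K (length vs) \<and> lcomb V xs vs = v" using list_basis_spans[OF assms] by metis
  from someI_ex[OF this, folded coordinates_def]
  show "coordinates K V vs v \<in> coefs K (length vs)" "lcomb V (coordinates K V vs v) vs = v" by blast+
qed

context vectorspace
begin

lemma lcomb_closed: "\<lbrakk>set xs \<subseteq> carrier K; set bs \<subseteq> carrier V\<rbrakk> \<Longrightarrow> lcomb V xs bs \<in> carrier V"
  by (induction xs bs rule: list_induct2') auto

lemma lcomb_add:
  assumes "xs \<in> coefs K (length bs)" "ys \<in> coefs K (length bs)" "set bs \<subseteq> carrier V"
  shows "lcomb V (map2 (\<oplus>\<^bsub>K\<^esub>) xs ys) bs = lcomb V xs bs \<oplus>\<^bsub>V\<^esub> lcomb V ys bs"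
  using assms
proof (induction bs arbitrary: xs ys)
  case (Cons v bs)
  then obtain x xs' y ys' where e: "xs = x # xs'" "ys = y # ys'" "x \<in> carrier K" "y \<in> carrier K"
    "xs' \<in> coefs K (length bs)" "ys' \<in> coefs K (length bs)" by (auto simp: coefs_Suc)
  hence "lcomb V xs' bs \<in> carrier V" "lcomb V ys' bs \<in> carrier V"
    using Cons.prems(3) by (auto intro!: lcomb_closed simp: coefs_def)
  thus ?case using Cons.IH[OF e(5,6)] Cons.prems(3) e(3,4)
    unfolding e(1,2) by (simp add: smult_l_distr M.a_ac)
qed (simp add: coefs_zero)

lemma lcomb_smult:
  assumes "c \<in> carrier K" "set xs \<subseteq> carrier K" "set bs \<subseteq> carrier V"
  shows "lcomb V (map ((\<otimes>\<^bsub>K\<^esub>) c) xs) bs = c \<odot>\<^bsub>V\<^esub> lcomb V xs bs"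
  using assms
  by (induction xs bs rule: list_induct2') (auto simp: smult_r_distr smult_assoc1 lcomb_closed)

lemma lcomb_append:
  assumes "length xs = length bs" "set xs \<subseteq> carrier K" "set ys \<subseteq> carrier K"
    "set bs \<subseteq> carrier V" "set ws \<subseteq> carrier V"
  shows "lcomb V (xs @ ys) (bs @ ws) = lcomb V xs bs \<oplus>\<^bsub>V\<^esub> lcomb V ys ws"
  using assms by (induction xs bs rule: list_induct2) (auto simp: M.a_assoc lcomb_closed)

lemma lcomb_replicate_zero:
  "set bs \<subseteq> carrier V \<Longrightarrow> lcomb V (replicate (length bs) \<zero>\<^bsub>K\<^esub>) bs = \<zero>\<^bsub>V\<^esub>"
  by (induction bs) auto

lemma lcomb_unit_coefs:
  "\<lbrakk>i < length bs; set bs \<subseteq> carrier V\<rbrakk> \<Longrightarrow> lcomb V (unit_coefs K (length bs) i) bs = bs ! i"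
proof (induction bs arbitrary: i)
  case (Cons v bs)
  show ?case
  proof (cases i)
    case 0 thus ?thesis using Cons.prems lcomb_replicate_zero[of bs] by simp
  next
    case (Suc j)
    moreover have "bs ! j \<in> carrier V" using Cons.prems Suc by auto
    ultimately show ?thesis using Cons.IH[of j] Cons.prems by simp
  qed
qed simp

lemma lcomb_eq_lincomb:
  assumes "distinct bs" "set bs \<subseteq> carrier V" "a \<in> set bs \<rightarrow> carrier K"
  shows "lcomb V (map a bs) bs = lincomb a (set bs)"
  using assms
proof (induction bs)
  case (Cons v bs)
  have "lincomb a (set bs \<union> {v}) = (a v \<odot>\<^bsub>V\<^esub> v) \<oplus>\<^bsub>V\<^esub> lincomb a (set bs)"
    using Cons.prems by (intro lincomb_insert) auto
  thus ?case using Cons by simp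
qed simp

lemma list_basis_unique:
  assumes b: "list_basis K V bs" and xs: "xs \<in> coefs K (length bs)" and ys: "ys \<in> coefs K (length bs)"
    and eq: "lcomb V xs bs = lcomb V ys bs"
  shows "xs = ys"
proof -
  let ?n = "map ((\<otimes>\<^bsub>K\<^esub>) (\<ominus>\<^bsub>K\<^esub> \<one>\<^bsub>K\<^esub>)) ys"
  note c = list_basis_carrier[OF b]
  have n: "?n \<in> coefs K (length bs)" using ys by (auto simp: coefs_def)
  have yc: "lcomb V ys bs \<in> carrier V" using ys c by (auto intro!: lcomb_closed simp: coefs_def)
  have "lcomb V (map2 (\<oplus>\<^bsub>K\<^esub>) xs ?n) bs = \<zero>\<^bsub>V\<^esub>"
    using lcomb_add[OF xs n c] lcomb_smult[of "\<ominus>\<^bsub>K\<^esub> \<one>\<^bsub>K\<^esub>" ys bs] ys c eq yc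
    by (simp add: coefs_def smult_l_minus M.r_neg)
  moreover have "map2 (\<oplus>\<^bsub>K\<^esub>) xs ?n \<in> coefs K (length bs)"
    by (rule coefs_add[OF is_ring xs n])
  ultimately have z: "map2 (\<oplus>\<^bsub>K\<^esub>) xs ?n = replicate (length bs) \<zero>\<^bsub>K\<^esub>"
    using list_basis_independent[OF b] by blast
  show ?thesis
  proof (rule nth_equalityI)
    show "length xs = length ys" using xs ys by (simp add: coefs_def)
    fix i assume i: "i < length xs"
    hence iy: "xs ! i \<in> carrier K" "ys ! i \<in> carrier K" using xs ys by (auto simp: coefs_def subset_iff)
    have "(map2 (\<oplus>\<^bsub>K\<^esub>) xs ?n) ! i = \<zero>\<^bsub>K\<^esub>" unfolding z using i xs by (simp add: coefs_def)
    hence "xs ! i \<oplus>\<^bsub>K\<^esub> \<ominus>\<^bsub>K\<^esub> (ys ! i) = \<zero>\<^bsub>K\<^esub>"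
      using i xs ys iy by (simp add: coefs_def l_minus)
    thus "xs ! i = ys ! i" using iy R.r_right_minus_eq[of "xs ! i" "ys ! i"] by (simp add: a_minus_def)
  qed
qed

lemma coordinates_eqI:
  assumes "list_basis K V bs" "xs \<in> coefs K (length bs)" "lcomb V xs bs = v"
  shows "coordinates K V bs v = xs"
proof -
  have v: "v \<in> carrier V"
    using lcomb_closed[of xs bs] assms list_basis_carrier by (auto simp: coefs_def)
  show ?thesis
    by (rule list_basis_unique[OF assms(1) coordinates(1)[OF assms(1) v] assms(2)])
      (simp only: coordinates(2)[OF assms(1) v] assms(3))
qed

lemma coordinates_add:
  assumes b: "list_basis K V bs" and vw: "v \<in> carrier V" "w \<in> carrier V"
  shows "coordinates K V bs (v \<oplus>\<^bsub>V\<^esub> w) = map2 (\<oplus>\<^bsub>K\<^esub>) (coordinates K V bs v) (coordinates K V bs w)"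
proof (rule coordinates_eqI[OF b])
  note c = coordinates[OF b vw(1)] and d = coordinates[OF b vw(2)]
  show "map2 (\<oplus>\<^bsub>K\<^esub>) (coordinates K V bs v) (coordinates K V bs w) \<in> coefs K (length bs)"
    by (rule coefs_add[OF is_ring c(1) d(1)])
  show "lcomb V (map2 (\<oplus>\<^bsub>K\<^esub>) (coordinates K V bs v) (coordinates K V bs w)) bs = v \<oplus>\<^bsub>V\<^esub> w"
    using lcomb_add[OF c(1) d(1) list_basis_carrier[OF b]] unfolding c(2) d(2) .
qed

lemma coordinates_smult:
  assumes b: "list_basis K V bs" and av: "a \<in> carrier K" "v \<in> carrier V"
  shows "coordinates K V bs (a \<odot>\<^bsub>V\<^esub> v) = map ((\<otimes>\<^bsub>K\<^esub>) a) (coordinates K V bs v)"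
proof (rule coordinates_eqI[OF b])
  note c = coordinates[OF b av(2)]
  show "map ((\<otimes>\<^bsub>K\<^esub>) a) (coordinates K V bs v) \<in> coefs K (length bs)"
    using c(1) av(1) by (auto simp: coefs_def)
  show "lcomb V (map ((\<otimes>\<^bsub>K\<^esub>) a) (coordinates K V bs v)) bs = a \<odot>\<^bsub>V\<^esub> v"
    using lcomb_smult[of a "coordinates K V bs v" bs] c(1) av list_basis_carrier[OF b]
    unfolding c(2) by (simp add: coefs_def)
qed

lemma list_basis_exists:
  assumes "fin_dim"
  obtains bs where "list_basis K V bs"
proof -
  obtain B where B: "finite B" "basis B" using finite_basis_exists[OF assms] by blast
  then obtain bs where bs: "set bs = B" "distinct bs" using finite_distinct_list by blast
  have Bc: "set bs \<subseteq> carrier V" "lin_indpt (set bs)" "span (set bs) = carrier V"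
    using B bs by (auto simp: basis_def)
  have "\<exists>xs\<in>coefs K (length bs). v = lcomb V xs bs" if v: "v \<in> carrier V" for v
  proof -
    obtain a where a: "a \<in> set bs \<rightarrow> carrier K" "lincomb a (set bs) = v"
      using finite_in_span[OF _ Bc(1), of v] v Bc(3) by auto
    show ?thesis
      using a lcomb_eq_lincomb[OF bs(2) Bc(1) a(1)]
      by (intro bexI[of _ "map a bs"]) (auto simp: coefs_def)
  qed
  moreover have "xs = replicate (length bs) \<zero>\<^bsub>K\<^esub>"
    if xs: "xs \<in> coefs K (length bs)" "lcomb V xs bs = \<zero>\<^bsub>V\<^esub>" for xs
  proof -
    define a where "a = (\<lambda>v. the (map_of (zip bs xs) v))"
    have l: "length xs = length bs" using xs by (simp add: coefs_def)
    have m: "map a bs = xs"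
      using l bs(2) by (intro nth_equalityI) (auto simp: a_def map_of_zip_nth)
    have ac: "a \<in> set bs \<rightarrow> carrier K" using m xs(1) by (auto simp: coefs_def)
    have "lincomb a (set bs) = \<zero>\<^bsub>V\<^esub>" using lcomb_eq_lincomb[OF bs(2) Bc(1) ac] m xs(2) by simp
    hence "a \<in> set bs \<rightarrow> {\<zero>\<^bsub>K\<^esub>}" using not_lindepD[OF Bc(2) _ _ ac] by auto
    hence "map a bs = replicate (length bs) \<zero>\<^bsub>K\<^esub>" by (intro nth_equalityI) auto
    thus ?thesis using m by simp
  qed
  ultimately show thesis using that Bc(1) unfolding list_basis_def by blast
qed

lemma list_basis_dim:
  assumes b: "list_basis K V bs"
  shows "fin_dim" "dim = length bs"
proof -
  note c = list_basis_carrier[OF b]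
  have "i = j" if ij: "i < length bs" "j < length bs" "bs ! i = bs ! j" for i j
  proof -
    have "unit_coefs K (length bs) i = unit_coefs K (length bs) j"
    proof (rule list_basis_unique[OF b])
      show "lcomb V (unit_coefs K (length bs) i) bs = lcomb V (unit_coefs K (length bs) j) bs"
        unfolding lcomb_unit_coefs[OF ij(1) c] lcomb_unit_coefs[OF ij(2) c] by (rule ij(3))
    qed (rule unit_coefs_closed[OF is_ring])+
    hence "unit_coefs K (length bs) i ! i = unit_coefs K (length bs) j ! i" by simp
    thus ?thesis using ij by (cases "i = j") auto
  qed
  hence dist: "distinct bs" by (auto simp: distinct_conv_nth)
  have "span (set bs) = carrier V"
  proof (intro equalityI subsetI)
    show "v \<in> carrier V" if "v \<in> span (set bs)" for v using that span_closed[OF c] by blast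
  next
    fix v assume "v \<in> carrier V"
    then obtain xs where "xs \<in> coefs K (length bs)" "v = lcomb V xs bs" using list_basis_spans[OF b] by blast
    moreover have "lcomb V xs ws \<in> span (set bs)" if "set ws \<subseteq> set bs" "set xs \<subseteq> carrier K" for xs ws
    proof -
      interpret S: LinearCombinations.submodule K "span (set bs)" V by (rule span_is_submodule[OF c])
      show ?thesis using that in_own_span[OF c] by (induction xs ws rule: list_induct2') auto
    qed
    ultimately show "v \<in> span (set bs)" by (auto simp: coefs_def)
  qed
  moreover have "lin_indpt (set bs)"
  proof (rule finite_lin_indpt2[OF _ c])
    fix a assume a: "a \<in> set bs \<rightarrow> carrier K" "lincomb a (set bs) = \<zero>\<^bsub>V\<^esub>"
    have "lcomb V (map a bs) bs = \<zero>\<^bsub>V\<^esub>" using lcomb_eq_lincomb[OF dist c a(1)] a(2) by simp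
    hence r: "map a bs = replicate (length bs) \<zero>\<^bsub>K\<^esub>"
      using a(1) by (intro list_basis_independent[OF b]) (auto simp: coefs_def)
    have "set (map a bs) \<subseteq> {\<zero>\<^bsub>K\<^esub>}" unfolding r by (simp add: set_replicate_conv_if)
    thus "\<forall>v\<in>set bs. a v = \<zero>\<^bsub>K\<^esub>" by auto
  qed simp
  ultimately have B: "basis (set bs)" using c by (simp add: basis_def)
  show "fin_dim" unfolding fin_dim_def using B c by (intro exI[of _ "set bs"]) (auto simp: basis_def)
  show "dim = length bs" using dim_basis[OF _ B] distinct_card[OF dist] by simp
qed

end

lemma basis_exchange_map:
  assumes V: "vectorspace K V" "list_basis K V vs" and W: "vectorspace K W" "list_basis K W ws"
    and l: "length vs = length ws"
  obtains f where "linear_map K V W f" "bij_betw f (carrier V) (carrier W)"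
    "\<And>xs. xs \<in> coefs K (length vs) \<Longrightarrow> f (lcomb V xs vs) = lcomb W xs ws"
proof -
  interpret V: vectorspace K V by fact
  interpret W: vectorspace K W by fact
  note vc = list_basis_carrier[OF V(2)] and wc = list_basis_carrier[OF W(2)]
  let ?c = "coordinates K V vs"
  note crd = coordinates[OF V(2)]
  define f where "f v = lcomb W (?c v) ws" for v
  have f: "f (lcomb V xs vs) = lcomb W xs ws" if "xs \<in> coefs K (length vs)" for xs
    using V.coordinates_eqI[OF V(2) that refl] by (simp add: f_def)
  have fc: "f v \<in> carrier W" if "v \<in> carrier V" for v
    unfolding f_def using crd[OF that] wc by (intro W.lcomb_closed) (auto simp: coefs_def)
  have lin: "linear_map K V W f"
  proof (intro linear_map.intro mod_hom.intro mod_hom_axioms.intro V W V.module_axioms W.module_axioms)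
    have "f (v \<oplus>\<^bsub>V\<^esub> w) = f v \<oplus>\<^bsub>W\<^esub> f w" if vw: "v \<in> carrier V" "w \<in> carrier V" for v w
      unfolding f_def V.coordinates_add[OF V(2) vw]
      using W.lcomb_add[of "?c v" ws "?c w"] crd(1)[OF vw(1)] crd(1)[OF vw(2)] l wc by simp
    moreover have "f (a \<odot>\<^bsub>V\<^esub> v) = a \<odot>\<^bsub>W\<^esub> f v" if av: "a \<in> carrier K" "v \<in> carrier V" for a v
      unfolding f_def V.coordinates_smult[OF V(2) av]
      using W.lcomb_smult[of a "?c v" ws] crd(1)[OF av(2)] av(1) wc by (simp add: coefs_def)
    ultimately show "f \<in> LinearCombinations.module_hom K V W"
      using fc by (auto simp: LinearCombinations.module_hom_def)
  qed
  have "bij_betw f (carrier V) (carrier W)"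
  proof (rule bij_betw_imageI)
    show "inj_on f (carrier V)"
    proof (rule inj_onI)
      fix v w assume vw: "v \<in> carrier V" "w \<in> carrier V" "f v = f w"
      have "?c v = ?c w"
        by (rule W.list_basis_unique[OF W(2)]) (use crd(1)[OF vw(1)] crd(1)[OF vw(2)] vw(3) l in \<open>simp_all add: f_def\<close>)
      thus "v = w" using crd(2)[OF vw(1)] crd(2)[OF vw(2)] by metis
    qed
    show "f ` carrier V = carrier W"
    proof (intro equalityI subsetI)
      show "w \<in> carrier W" if "w \<in> f ` carrier V" for w using that fc by auto
      fix w assume "w \<in> carrier W"
      then obtain xs where xs: "xs \<in> coefs K (length ws)" "w = lcomb W xs ws"
        using list_basis_spans[OF W(2)] by blast
      moreover have "lcomb V xs vs \<in> carrier V" using xs vc by (intro V.lcomb_closed) (auto simp: coefs_def)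
      ultimately show "w \<in> f ` carrier V" using f[of xs] l by (intro image_eqI[of _ _ "lcomb V xs vs"]) auto
    qed
  qed
  thus thesis using that lin f by blast
qed

lemma direct_sum_list_basis:
  assumes U: "vectorspace K U" "list_basis K U us" and W: "vectorspace K W" "list_basis K W ws"
  defines "bs \<equiv> map (\<lambda>u. (u, \<zero>\<^bsub>W\<^esub>)) us @ map (\<lambda>w. (\<zero>\<^bsub>U\<^esub>, w)) ws"
  shows "list_basis K (direct_sum U W) bs"
    and "\<lbrakk>xs \<in> coefs K (length us); ys \<in> coefs K (length ws)\<rbrakk> \<Longrightarrow>
      lcomb (direct_sum U W) (xs @ ys) bs = (lcomb U xs us, lcomb W ys ws)"
proof -
  interpret U: vectorspace K U by fact
  interpret W: vectorspace K W by fact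
  interpret D: vectorspace K "direct_sum U W" by (rule direct_sum_is_vs[OF U(1) W(1)])
  note uc = list_basis_carrier[OF U(2)] and wc = list_basis_carrier[OF W(2)]
  have 1: "lcomb (direct_sum U W) xs (map (\<lambda>u. (u, \<zero>\<^bsub>W\<^esub>)) us') = (lcomb U xs us', \<zero>\<^bsub>W\<^esub>)"
    if "set xs \<subseteq> carrier K" "set us' \<subseteq> carrier U" for xs us'
    using that by (induction xs us' rule: list_induct2') (auto simp: direct_sum_def)
  have 2: "lcomb (direct_sum U W) xs (map (\<lambda>w. (\<zero>\<^bsub>U\<^esub>, w)) ws') = (\<zero>\<^bsub>U\<^esub>, lcomb W xs ws')"
    if "set xs \<subseteq> carrier K" "set ws' \<subseteq> carrier W" for xs ws'
    using that by (induction xs ws' rule: list_induct2') (auto simp: direct_sum_def)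
  have bc: "set (map (\<lambda>u. (u, \<zero>\<^bsub>W\<^esub>)) us) \<subseteq> carrier (direct_sum U W)"
    "set (map (\<lambda>w. (\<zero>\<^bsub>U\<^esub>, w)) ws) \<subseteq> carrier (direct_sum U W)"
    using uc wc by (auto simp: direct_sum_def)
  show L: "lcomb (direct_sum U W) (xs @ ys) bs = (lcomb U xs us, lcomb W ys ws)"
    if xy: "xs \<in> coefs K (length us)" "ys \<in> coefs K (length ws)" for xs ys
  proof -
    have "lcomb U xs us \<in> carrier U" "lcomb W ys ws \<in> carrier W"
      using xy uc wc U.lcomb_closed W.lcomb_closed by (auto simp: coefs_def)
    thus ?thesis
      unfolding bs_def using D.lcomb_append[OF _ _ _ bc, of xs ys] 1[OF _ uc, of xs] 2[OF _ wc, of ys] xy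
      by (simp add: coefs_def direct_sum_def)
  qed
  show "list_basis K (direct_sum U W) bs"
    unfolding list_basis_def
  proof (intro conjI ballI impI)
    show "set bs \<subseteq> carrier (direct_sum U W)" using bc by (simp add: bs_def)
    fix v assume "v \<in> carrier (direct_sum U W)"
    then obtain u w where v: "v = (u, w)" "u \<in> carrier U" "w \<in> carrier W" by (auto simp: direct_sum_def)
    obtain xs where xs: "xs \<in> coefs K (length us)" "u = lcomb U xs us" using list_basis_spans[OF U(2) v(2)] .
    obtain ys where ys: "ys \<in> coefs K (length ws)" "w = lcomb W ys ws" using list_basis_spans[OF W(2) v(3)] .
    show "\<exists>zs\<in>coefs K (length bs). v = lcomb (direct_sum U W) zs bs"
      using L[OF xs(1) ys(1)] xs ys v by (intro bexI[of _ "xs @ ys"]) (auto simp: coefs_def bs_def)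
  next
    fix zs assume zs: "zs \<in> coefs K (length bs)" "lcomb (direct_sum U W) zs bs = \<zero>\<^bsub>direct_sum U W\<^esub>"
    let ?x = "take (length us) zs" and ?y = "drop (length us) zs"
    have xy: "?x \<in> coefs K (length us)" "?y \<in> coefs K (length ws)"
      using zs(1) set_take_subset[of "length us" zs] set_drop_subset[of "length us" zs]
      by (auto simp: coefs_def bs_def)
    have "(lcomb U ?x us, lcomb W ?y ws) = (\<zero>\<^bsub>U\<^esub>, \<zero>\<^bsub>W\<^esub>)"
      using L[OF xy] zs(2) by (simp add: direct_sum_def)
    hence "?x = replicate (length us) \<zero>\<^bsub>K\<^esub>" "?y = replicate (length ws) \<zero>\<^bsub>K\<^esub>"
      using list_basis_independent[OF U(2) xy(1)] list_basis_independent[OF W(2) xy(2)] by auto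
    hence "?x @ ?y = replicate (length bs) \<zero>\<^bsub>K\<^esub>" by (simp add: bs_def replicate_add)
    thus "zs = replicate (length bs) \<zero>\<^bsub>K\<^esub>" by simp
  qed
qed

section \<open>Values and isometry\<close>

lemma (in ring) independent_iff_combine:
  assumes "subfield K R" "set us \<subseteq> carrier R"
  shows "independent K us \<longleftrightarrow>
    (\<forall>ks. set ks \<subseteq> K \<longrightarrow> length ks = length us \<longrightarrow> combine ks us = \<zero> \<longrightarrow> ks = replicate (length us) \<zero>)"
proof
  assume i: "independent K us"
  show "\<forall>ks. set ks \<subseteq> K \<longrightarrow> length ks = length us \<longrightarrow> combine ks us = \<zero> \<longrightarrow> ks = replicate (length us) \<zero>"
  proof (intro allI impI)
    fix ks assume ks: "set ks \<subseteq> K" "length ks = length us" "combine ks us = \<zero>"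
    have "set ks \<subseteq> {\<zero>}" using independent_imp_trivial_combine[OF assms(1) i ks(1,3)] ks(2) by simp
    thus "ks = replicate (length us) \<zero>" using ks(2) by (metis replicate_eqI subset_singletonD singletonD subsetD)
  qed
next
  assume *: "\<forall>ks. set ks \<subseteq> K \<longrightarrow> length ks = length us \<longrightarrow> combine ks us = \<zero> \<longrightarrow> ks = replicate (length us) \<zero>"
  show "independent K us"
  proof (rule ccontr)
    assume d: "\<not> independent K us"
    obtain ks where ks: "length ks = length us" "combine ks us = \<zero>" "set ks \<subseteq> K" "set ks \<noteq> {\<zero>}"
      using dependent_imp_non_trivial_combine[OF assms d] .
    have "us \<noteq> []" using d by auto
    thus False using ks * by (metis length_greater_0_conv less_numeral_extra(3) set_replicate)
  qed
qed

lemma lcomb_update_carrier: "lcomb (V\<lparr>carrier := C\<rparr>) xs vs = lcomb V xs vs"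
  by (induction xs vs rule: list_induct2') auto

lemma isometric_if_list_bases:
  assumes V: "vectorspace K V" "list_basis K V vs" and W: "vectorspace K W" "list_basis K W ws"
    and l: "length vs = length ws"
    and eq: "\<And>xs. xs \<in> coefs K (length vs) \<Longrightarrow> \<phi> (lcomb V xs vs) = \<psi> (lcomb W xs ws)"
  shows "isometric K V \<phi> W \<psi>"
proof -
  obtain f where f: "linear_map K V W f" "bij_betw f (carrier V) (carrier W)"
    "\<And>xs. xs \<in> coefs K (length vs) \<Longrightarrow> f (lcomb V xs vs) = lcomb W xs ws"
    by (rule basis_exchange_map[OF V W l], rule that)
  have "\<phi> v = \<psi> (f v)" if v: "v \<in> carrier V" for v
  proof -
    obtain xs where "xs \<in> coefs K (length vs)" "v = lcomb V xs vs" using list_basis_spans[OF V(2) v] .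
    thus ?thesis using eq f(3) by simp
  qed
  thus ?thesis using f(1,2) unfolding isometric_def by blast
qed

context field
begin

lemma func_space_list_basis: "\<exists>es. list_basis R (func_space {..<n}) es \<and> length es = n"
proof -
  let ?P = "func_space {..<n}"
  interpret P: Module.module R ?P by (rule func_space_is_module)
  define e where "e j = (\<lambda>i\<in>{..<n}. if i = j then \<one> else \<zero>)" for j :: nat
  have ec: "e j \<in> carrier ?P" for j by (auto simp: e_def func_space_def)
  have ev: "lcomb ?P xs (map e [m..<m + length xs]) i = (if m \<le> i \<and> i < m + length xs then xs ! (i - m) else \<zero>)"
    if "i < n" "set xs \<subseteq> carrier R" for xs m i
    using that(2)
  proof (induction xs arbitrary: m)
    case Nil thus ?case using that(1) by (auto simp: func_space_def)
  next
    case (Cons x xs)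
    have u: "[m..<m + length (x # xs)] = m # [Suc m..<Suc m + length xs]"
      by (simp add: upt_conv_Cons del: upt_Suc)
    have "lcomb ?P (x # xs) (map e [m..<m + length (x # xs)]) i =
        x \<otimes> e m i \<oplus> lcomb ?P xs (map e [Suc m..<Suc m + length xs]) i"
      unfolding u using that(1) by (simp add: func_space_def del: upt_Suc)
    also have "\<dots> = x \<otimes> e m i \<oplus> (if Suc m \<le> i \<and> i < Suc m + length xs then xs ! (i - Suc m) else \<zero>)"
      using Cons.IH[of "Suc m"] Cons.prems by (simp del: upt_Suc)
    also have "\<dots> = (if m \<le> i \<and> i < m + length (x # xs) then (x # xs) ! (i - m) else \<zero>)"
    proof (cases "i = m")
      case True thus ?thesis using Cons.prems that(1) by (simp add: e_def)
    next
      case False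
      hence "e m i = \<zero>" using that(1) by (simp add: e_def)
      moreover have "xs ! (i - Suc m) \<in> carrier R" if "Suc m \<le> i" "i < Suc m + length xs"
        using Cons.prems that by (auto intro!: subsetD[OF _ nth_mem])
      moreover have "(x # xs) ! (i - m) = xs ! (i - Suc m)" if "Suc m \<le> i"
        using that by (metis Suc_diff_Suc Suc_le_lessD nth_Cons_Suc)
      ultimately show ?thesis using Cons.prems False by auto
    qed
    finally show ?case .
  qed
  have lc: "lcomb ?P xs vs \<in> carrier ?P" if "set xs \<subseteq> carrier R" "set vs \<subseteq> carrier ?P" for xs vs
    using that by (induction xs vs rule: list_induct2') auto
  let ?es = "map e [0..<n]"
  have es: "set ?es \<subseteq> carrier ?P" using ec by auto
  have "list_basis R ?P ?es"
    unfolding list_basis_def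
  proof (intro conjI ballI impI es)
    fix w assume w: "w \<in> carrier ?P"
    hence wc: "w \<in> {..<n} \<rightarrow>\<^sub>E carrier R" by (simp add: func_space_def)
    let ?x = "map w [0..<n]"
    have "w i \<in> carrier R" if "i < n" for i using PiE_mem[OF wc, of i] that by simp
    hence x: "?x \<in> coefs R (length ?es)" unfolding coefs_def by auto
    have "lcomb ?P ?x ?es \<in> {..<n} \<rightarrow>\<^sub>E carrier R"
      using lc[OF _ es] x by (simp add: func_space_def coefs_def)
    hence "w = lcomb ?P ?x ?es"
      using wc ev[of _ ?x 0] x by (intro PiE_ext[of w "{..<n}" "\<lambda>_. carrier R"]) (auto simp: coefs_def)
    thus "\<exists>xs\<in>coefs R (length ?es). w = lcomb ?P xs ?es" using x by blast
  next
    fix xs assume xs: "xs \<in> coefs R (length ?es)" "lcomb ?P xs ?es = \<zero>\<^bsub>?P\<^esub>"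
    hence l: "length xs = n" "set xs \<subseteq> carrier R" by (auto simp: coefs_def)
    show "xs = replicate (length ?es) \<zero>"
    proof (rule nth_equalityI)
      fix i assume i: "i < length xs"
      hence "xs ! i = lcomb ?P xs ?es i" using ev[of i xs 0] l by simp
      also have "\<dots> = \<zero>" using xs(2) i l by (simp add: func_space_def)
      finally show "xs ! i = replicate (length ?es) \<zero> ! i" using i l by simp
    qed (simp add: l)
  qed
  thus ?thesis by (intro exI[of _ ?es]) simp
qed

lemma diag_form_zero:
  assumes "w \<in> carrier (func_space {..<k})"
  shows "diag_form R k (\<lambda>_. \<zero>) w = \<zero>"
proof -
  have "(\<Oplus>i\<in>{..<k}. \<zero> \<otimes> (w i \<otimes> w i)) = (\<Oplus>i\<in>{..<k}. \<zero>)"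
    using assms by (intro finsum_cong') (auto simp: func_space_def PiE_def Pi_def)
  thus ?thesis by (simp add: diag_form_def)
qed

end

context ts_form
begin

sublocale C: field_char_two K
  by (intro field_char_two.intro field_char_two_axioms.intro char_two) unfold_locales

lemma form_zero: "\<phi> \<zero>\<^bsub>V\<^esub> = \<zero>"
  using form_smult[of \<zero> "\<zero>\<^bsub>V\<^esub>"] form_closed[of "\<zero>\<^bsub>V\<^esub>"] by simp

lemma map_form_carrier: "set bs \<subseteq> carrier V \<Longrightarrow> set (map \<phi> bs) \<subseteq> carrier K"
  using form_closed by auto

lemma form_lcomb:
  assumes "set xs \<subseteq> carrier K" "set bs \<subseteq> carrier V"
  shows "\<phi> (lcomb V xs bs) = combine (map (\<lambda>x. x \<otimes> x) xs) (map \<phi> bs)"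
  using assms
  by (induction xs bs rule: list_induct2') (auto simp: form_zero form_add form_smult lcomb_closed)

lemma squares_list:
  assumes "set ks \<subseteq> squares K"
  obtains xs where "xs \<in> coefs K (length ks)" "ks = map (\<lambda>x. x \<otimes> x) xs"
proof -
  have "\<exists>xs. xs \<in> coefs K (length ks) \<and> ks = map (\<lambda>x. x \<otimes> x) xs"
    using assms
  proof (induction ks)
    case (Cons k ks)
    then obtain x xs where "x \<in> carrier K" "k = x \<otimes> x" "xs \<in> coefs K (length ks)" "ks = map (\<lambda>x. x \<otimes> x) xs"
      by (auto simp: squares_def)
    thus ?case by (intro exI[of _ "x # xs"]) (auto simp: coefs_def)
  qed (simp add: coefs_def)
  thus thesis using that by blast
qed

lemma map_squares_eq_zero:
  assumes "set xs \<subseteq> carrier K" "map (\<lambda>x. x \<otimes> x) xs = replicate n \<zero>"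
  shows "xs = replicate n \<zero>"
  using assms
proof (induction n arbitrary: xs)
  case (Suc n)
  then obtain x ys where "xs = x # ys" "x \<otimes> x = \<zero>" "map (\<lambda>x. x \<otimes> x) ys = replicate n \<zero>"
    by (auto simp: Cons_eq_map_conv map_eq_Cons_conv)
  thus ?case using Suc integral[of x x] by auto
qed simp

text \<open>\<open>\<phi>\<close> maps \<open>\<Sum> x\<^sub>i v\<^sub>i\<close> to \<open>\<Sum> x\<^sub>i\<^sup>2 \<phi>(v\<^sub>i)\<close>.\<close>

lemma values_eq_Span:
  assumes b: "list_basis K V bs"
  shows "\<phi> ` carrier V = Span (squares K) (map \<phi> bs)"
proof (intro equalityI subsetI)
  note c = list_basis_carrier[OF b]
  note iff = Span_mem_iff_length_version[OF C.squares_subfield map_form_carrier[OF c]]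
  fix d assume "d \<in> \<phi> ` carrier V"
  then obtain v where v: "v \<in> carrier V" "d = \<phi> v" by blast
  then obtain xs where xs: "xs \<in> coefs K (length bs)" "v = lcomb V xs bs" using list_basis_spans[OF b] by blast
  show "d \<in> Span (squares K) (map \<phi> bs)"
    unfolding iff using xs v form_lcomb[of xs bs] c C.square_in
    by (intro exI[of _ "map (\<lambda>x. x \<otimes> x) xs"]) (auto simp: coefs_def)
next
  note c = list_basis_carrier[OF b]
  note iff = Span_mem_iff_length_version[OF C.squares_subfield map_form_carrier[OF c]]
  fix d assume "d \<in> Span (squares K) (map \<phi> bs)"
  then obtain ks where ks: "set ks \<subseteq> squares K" "length ks = length bs" "d = combine ks (map \<phi> bs)"
    unfolding iff by auto
  obtain xs where xs: "xs \<in> coefs K (length ks)" "ks = map (\<lambda>x. x \<otimes> x) xs" using squares_list[OF ks(1)] .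
  hence "d = \<phi> (lcomb V xs bs)" using form_lcomb[of xs bs] c ks by (simp add: coefs_def)
  thus "d \<in> \<phi> ` carrier V" using lcomb_closed[of xs bs] xs c by (auto simp: coefs_def)
qed

lemma anisotropic_values_independent:
  assumes b: "list_basis K V bs" and an: "anisotropic K V \<phi>"
  shows "independent (squares K) (map \<phi> bs)"
proof -
  note c = list_basis_carrier[OF b]
  show ?thesis
    unfolding independent_iff_combine[OF C.squares_subfield map_form_carrier[OF c]]
  proof (intro allI impI)
    fix ks assume ks: "set ks \<subseteq> squares K" "length ks = length (map \<phi> bs)" "combine ks (map \<phi> bs) = \<zero>"
    obtain xs where xs: "xs \<in> coefs K (length ks)" "ks = map (\<lambda>x. x \<otimes> x) xs" using squares_list[OF ks(1)] .
    have "\<phi> (lcomb V xs bs) = \<zero>" using form_lcomb[of xs bs] c ks xs by (simp add: coefs_def)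
    moreover have "lcomb V xs bs \<in> carrier V" using lcomb_closed[of xs bs] xs c by (auto simp: coefs_def)
    ultimately have "lcomb V xs bs = \<zero>\<^bsub>V\<^esub>" using an by (auto simp: isotropic_def)
    hence "xs = replicate (length bs) \<zero>" using list_basis_independent[OF b] xs(1) ks(2) by simp
    thus "ks = replicate (length (map \<phi> bs)) \<zero>" unfolding xs(2) by simp
  qed
qed

lemma form_lcomb_eq_zero:
  assumes "set xs \<subseteq> carrier K" "set bs \<subseteq> carrier V" "\<forall>v\<in>set bs. \<phi> v = \<zero>"
  shows "\<phi> (lcomb V xs bs) = \<zero>"
  using assms
  by (induction xs bs rule: list_induct2') (auto simp: form_zero form_add form_smult lcomb_closed)

lemma coefs_zero_if_values_independent:
  assumes i: "independent (squares K) (map \<phi> us)" and us: "set us \<subseteq> carrier V"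
    and xs: "xs \<in> coefs K (length us)" "\<phi> (lcomb V xs us) = \<zero>"
  shows "xs = replicate (length us) \<zero>"
proof -
  have "combine (map (\<lambda>x. x \<otimes> x) xs) (map \<phi> us) = \<zero>"
    using form_lcomb[of xs us] xs us by (simp add: coefs_def)
  moreover have "set (map (\<lambda>x. x \<otimes> x) xs) \<subseteq> squares K" "length (map (\<lambda>x. x \<otimes> x) xs) = length (map \<phi> us)"
    using xs C.square_in by (auto simp: coefs_def)
  ultimately have "map (\<lambda>x. x \<otimes> x) xs = replicate (length (map \<phi> us)) \<zero>"
    using independent_iff_combine[OF C.squares_subfield map_form_carrier[OF us]] i by blast
  hence "map (\<lambda>x. x \<otimes> x) xs = replicate (length us) \<zero>" by simp
  thus ?thesis using map_squares_eq_zero xs(1) by (auto simp: coefs_def)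
qed

lemma kernel_list_basis:
  obtains ks where "list_basis K (V\<lparr>carrier := {v \<in> carrier V. \<phi> v = \<zero>}\<rparr>) ks"
proof -
  let ?N = "{v \<in> carrier V. \<phi> v = \<zero>}"
  have sm: "LinearCombinations.submodule K ?N V"
    by (intro LinearCombinations.submodule.intro module_axioms) (auto simp: form_zero form_add form_smult)
  hence sub: "VectorSpace.subspace K ?N V"
    unfolding VectorSpace.subspace_def using vectorspace_axioms by simp
  interpret L: vectorspace K "V\<lparr>carrier := ?N\<rparr>" by (rule subspace_is_vs[OF sub])
  have "\<exists>A. finite A \<and> maximal A (\<lambda>S. S \<subseteq> ?N \<and> lin_indpt S)"
  proof (rule maximal_exists)
    show "finite A \<and> card A \<le> dim" if "A \<subseteq> ?N \<and> lin_indpt A" for A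
      using li_le_dim[OF finite_dim, of A] that by auto
    show "{} \<subseteq> ?N \<and> lin_indpt {}" by (auto simp: lin_dep_def)
  qed
  then obtain A where A: "finite A" "maximal A (\<lambda>S. S \<subseteq> ?N \<and> lin_indpt S)" by blast
  have "(\<lambda>S. S \<subseteq> ?N \<and> lin_indpt S) = (\<lambda>S. S \<subseteq> carrier (V\<lparr>carrier := ?N\<rparr>) \<and> L.lin_indpt S)"
  proof (rule ext)
    fix S
    show "(S \<subseteq> ?N \<and> lin_indpt S) = (S \<subseteq> carrier (V\<lparr>carrier := ?N\<rparr>) \<and> L.lin_indpt S)"
    proof (cases "S \<subseteq> ?N")
      case True
      show ?thesis unfolding span_li_not_depend(2)[OF True sm] by simp
    qed simp
  qed
  hence "maximal A (\<lambda>S. S \<subseteq> carrier (V\<lparr>carrier := ?N\<rparr>) \<and> L.lin_indpt S)" using A(2) by simp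
  moreover from this have "A \<subseteq> carrier (V\<lparr>carrier := ?N\<rparr>)" by (simp add: maximal_def)
  ultimately have "L.fin_dim" using L.max_li_is_gen A(1) unfolding L.fin_dim_def by blast
  thus thesis using L.list_basis_exists that by blast
qed

text \<open>\<open>us\<close> consists of preimages of the basis \<open>ds\<close> of the value space, and \<open>ks\<close> is a basis of the
  subspace on which \<open>\<phi>\<close> vanishes.\<close>

lemma adapted_list_basis:
  assumes ds: "independent (squares K) ds" "Span (squares K) ds = \<phi> ` carrier V"
  obtains us ks where "list_basis K V (us @ ks)" "map \<phi> us = ds" "map \<phi> ks = replicate (length ks) \<zero>"
proof -
  have dc: "set ds \<subseteq> carrier K" using independent_in_carrier[OF ds(1)] .
  have "set ds \<subseteq> \<phi> ` carrier V" using Span_base_incl[OF C.squares_subfield dc] ds(2) by simp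
  hence "\<exists>us. set us \<subseteq> carrier V \<and> map \<phi> us = ds"
  proof (induction ds)
    case (Cons d ds)
    then obtain us u where "set us \<subseteq> carrier V" "map \<phi> us = ds" "u \<in> carrier V" "\<phi> u = d" by auto
    thus ?case by (intro exI[of _ "u # us"]) simp
  qed simp
  then obtain us where us: "set us \<subseteq> carrier V" "map \<phi> us = ds" by blast
  let ?N = "{v \<in> carrier V. \<phi> v = \<zero>}"
  obtain ks where ks: "list_basis K (V\<lparr>carrier := ?N\<rparr>) ks" using kernel_list_basis .
  have kc: "set ks \<subseteq> ?N" using list_basis_carrier[OF ks] by simp
  hence kV: "set ks \<subseteq> carrier V" by blast
  have k0: "map \<phi> ks = replicate (length ks) \<zero>" using kc by (intro nth_equalityI) (auto simp: subset_iff)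
  note ind = coefs_zero_if_values_independent[OF ds(1)[folded us(2)] us(1)]
  have "list_basis K V (us @ ks)"
    unfolding list_basis_def
  proof (intro conjI ballI impI)
    show "set (us @ ks) \<subseteq> carrier V" using us kc by auto
    fix v assume v: "v \<in> carrier V"
    hence "\<phi> v \<in> Span (squares K) ds" using ds(2) by blast
    then obtain qs where qs: "set qs \<subseteq> squares K" "length qs = length ds" "\<phi> v = combine qs ds"
      unfolding Span_mem_iff_length_version[OF C.squares_subfield dc] by auto
    obtain xs where xs: "xs \<in> coefs K (length qs)" "qs = map (\<lambda>x. x \<otimes> x) xs" using squares_list[OF qs(1)] .
    let ?u = "lcomb V xs us"
    have u: "?u \<in> carrier V" using xs us lcomb_closed[of xs us] by (auto simp: coefs_def)
    have pu: "\<phi> ?u = \<phi> v" using form_lcomb[of xs us] xs us qs by (simp add: coefs_def)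
    have "\<phi> (\<ominus>\<^bsub>V\<^esub> ?u) = \<phi> ?u"
      using form_add[of ?u "\<ominus>\<^bsub>V\<^esub> ?u"] u form_closed form_zero
        C.add_eq_zero_iff[of "\<phi> ?u" "\<phi> (\<ominus>\<^bsub>V\<^esub> ?u)"] by (simp add: M.r_neg)
    hence "v \<ominus>\<^bsub>V\<^esub> ?u \<in> ?N" using u v pu form_closed[OF v] by (simp add: a_minus_def form_add)
    then obtain ys where ys: "ys \<in> coefs K (length ks)" "v \<ominus>\<^bsub>V\<^esub> ?u = lcomb V ys ks"
      using list_basis_spans[OF ks, of "v \<ominus>\<^bsub>V\<^esub> ?u"] by (auto simp: lcomb_update_carrier)
    have "v = ?u \<oplus>\<^bsub>V\<^esub> (v \<ominus>\<^bsub>V\<^esub> ?u)" using u v by (simp add: a_minus_def M.a_lcomm[of ?u] M.r_neg)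
    also have "\<dots> = lcomb V (xs @ ys) (us @ ks)"
      unfolding ys(2) using lcomb_append[of xs us ys ks] xs ys us kV qs(2) by (auto simp: coefs_def)
    finally show "\<exists>zs\<in>coefs K (length (us @ ks)). v = lcomb V zs (us @ ks)"
      using xs ys us qs(2) by (intro bexI[of _ "xs @ ys"]) (auto simp: coefs_def)
  next
    fix zs assume zs: "zs \<in> coefs K (length (us @ ks))" "lcomb V zs (us @ ks) = \<zero>\<^bsub>V\<^esub>"
    let ?x = "take (length us) zs" and ?y = "drop (length us) zs"
    have xy: "?x \<in> coefs K (length us)" "?y \<in> coefs K (length ks)"
      using zs(1) set_take_subset[of "length us" zs] set_drop_subset[of "length us" zs]
      by (auto simp: coefs_def)
    have c: "lcomb V ?x us \<in> carrier V" "lcomb V ?y ks \<in> carrier V"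
      using xy us kV by (auto simp: coefs_def intro!: lcomb_closed)
    have "lcomb V (?x @ ?y) (us @ ks) = lcomb V ?x us \<oplus>\<^bsub>V\<^esub> lcomb V ?y ks"
      using xy us kV by (intro lcomb_append) (auto simp: coefs_def)
    hence s: "lcomb V ?x us \<oplus>\<^bsub>V\<^esub> lcomb V ?y ks = \<zero>\<^bsub>V\<^esub>" using zs(2) by simp
    have "\<phi> (lcomb V ?y ks) = \<zero>" using form_lcomb_eq_zero[of ?y ks] xy(2) kc by (auto simp: coefs_def)
    hence "\<phi> (lcomb V ?x us) = \<zero>"
      using form_add[OF c] form_zero form_closed[OF c(1)] unfolding s by simp
    hence x0: "?x = replicate (length us) \<zero>" using ind xy(1) by blast
    hence "lcomb V ?y ks = \<zero>\<^bsub>V\<^esub>" using s c lcomb_replicate_zero[OF us(1)] by simp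
    hence "?y = replicate (length ks) \<zero>"
      using list_basis_independent[OF ks, of ?y] xy(2) by (simp add: lcomb_update_carrier)
    hence "?x @ ?y = replicate (length (us @ ks)) \<zero>" using x0 by (simp add: replicate_add)
    thus "zs = replicate (length (us @ ks)) \<zero>" by simp
  qed
  thus thesis using that us(2) k0 by blast
qed

end

section \<open>The defect\<close>

text \<open>The summand \<open>k \<times> \<langle>0\<rangle>\<close> contributes nothing to the values, and an anisotropic form maps a basis to
  independent values.  So \<open>k\<close> is the same in all decompositions.\<close>

lemma an_decomposition_dims:
  assumes \<phi>: "ts_form K V \<phi>" and d: "an_decomposition K V \<phi> U \<sigma> k"
  shows "vectorspace.dim K V = vectorspace.dim K U + k" "\<sigma> ` carrier U = \<phi> ` carrier V"
    "ring.dimension K (vectorspace.dim K U) (squares K) (\<phi> ` carrier V)"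
proof -
  interpret f: ts_form K V \<phi> by fact
  let ?P = "f.func_space {..<k}"
  let ?S = "direct_sum U ?P" and ?s = "orth_sum K \<sigma> (diag_form K k (\<lambda>_. \<zero>\<^bsub>K\<^esub>))"
  interpret u: ts_form K U \<sigma> using d by (simp add: an_decomposition_def)
  have P: "vectorspace K ?P" by (rule f.func_space_is_vs)
  obtain us where us: "list_basis K U us" using u.list_basis_exists[OF u.finite_dim] .
  obtain es where es: "list_basis K ?P es" "length es = k" using f.func_space_list_basis by blast
  obtain T where T: "linear_map K V ?S T" "bij_betw T (carrier V) (carrier ?S)"
    "\<forall>v\<in>carrier V. \<phi> v = ?s (T v)"
    using d by (auto simp: an_decomposition_def isometric_def)
  interpret S: vectorspace K ?S by (rule direct_sum_is_vs[OF u.vectorspace_axioms P])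
  interpret T: linear_map K V ?S T by fact
  have "vectorspace.dim K ?S = length us + k"
    using S.list_basis_dim(2)[OF direct_sum_list_basis(1)[OF u.vectorspace_axioms us P es(1)]] es(2) by simp
  moreover have "f.dim = vectorspace.dim K ?S"
    using T.dim_eq[OF f.finite_dim] T(2) by (simp add: bij_betw_def)
  ultimately show "f.dim = u.dim + k" using u.list_basis_dim(2)[OF us] by simp
  have s: "?s (x, w) = \<sigma> x" if "x \<in> carrier U" "w \<in> carrier ?P" for x w
    using f.diag_form_zero[OF that(2)] u.form_closed[OF that(1)] by (simp add: orth_sum_def)
  have "\<phi> ` carrier V = ?s ` T ` carrier V" using T(3) by (force simp: image_image)
  also have "\<dots> = ?s ` (carrier U \<times> carrier ?P)" using T(2) by (simp add: bij_betw_def direct_sum_def)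
  also have "\<dots> = \<sigma> ` carrier U"
  proof -
    have "\<zero>\<^bsub>?P\<^esub> \<in> carrier ?P" by (auto simp: f.func_space_def)
    thus ?thesis using s by force
  qed
  finally show eq: "\<sigma> ` carrier U = \<phi> ` carrier V" by simp
  have "anisotropic K U \<sigma>" using d by (simp add: an_decomposition_def)
  from f.dimension_independent[OF u.anisotropic_values_independent[OF us this]]
  show "f.dimension u.dim (squares K) (\<phi> ` carrier V)"
    using u.values_eq_Span[OF us] u.list_basis_dim(2)[OF us] eq by simp
qed

context ts_form
begin

text \<open>The anisotropic part is the restriction of \<open>\<phi>\<close> to the span of preimages of a basis of the value
  space.\<close>

lemma an_decomposition_exists:
  assumes r: "dimension r (squares K) (\<phi> ` carrier V)"
  shows "\<exists>(U :: ('k, 'v) module) \<sigma> k. an_decomposition K V \<phi> U \<sigma> k"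
proof -
  obtain ds where ds: "independent (squares K) ds" "Span (squares K) ds = \<phi> ` carrier V"
    using exists_base[OF C.squares_subfield r] by blast
  obtain us ks where b: "list_basis K V (us @ ks)" "map \<phi> us = ds" "map \<phi> ks = replicate (length ks) \<zero>"
    using adapted_list_basis[OF ds] .
  have c: "set us \<subseteq> carrier V" "set ks \<subseteq> carrier V" using list_basis_carrier[OF b(1)] by auto
  let ?C = "{lcomb V xs us | xs. xs \<in> coefs K (length us)}"
  define U :: "('k, 'v) module" where
    "U = \<lparr>carrier = ?C, mult = mult V, one = one V, zero = zero V, add = add V, smult = smult V\<rparr>"
  have lc: "lcomb U xs vs = lcomb V xs vs" for xs vs
    by (induction xs vs rule: list_induct2') (auto simp: U_def)
  have CVI: "lcomb V xs us \<in> carrier V" if "xs \<in> coefs K (length us)" for xs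
    using that c lcomb_closed by (auto simp: coefs_def)
  hence CV: "?C \<subseteq> carrier V" by blast
  have usC: "set us \<subseteq> ?C"
  proof
    fix u assume "u \<in> set us"
    then obtain i where "i < length us" "u = us ! i" by (auto simp: in_set_conv_nth)
    thus "u \<in> ?C"
      using lcomb_unit_coefs[OF _ c(1), of i] unit_coefs_closed[OF is_ring]
      by (intro CollectI exI[of _ "unit_coefs K (length us) i"]) simp
  qed
  have add: "v \<oplus>\<^bsub>V\<^esub> w \<in> ?C" if vw: "v \<in> ?C" "w \<in> ?C" for v w
  proof -
    obtain xs ys where "xs \<in> coefs K (length us)" "ys \<in> coefs K (length us)" "v = lcomb V xs us" "w = lcomb V ys us"
      using vw by blast
    thus ?thesis using lcomb_add[of xs us ys] c(1) coefs_add[OF is_ring, of xs "length us" ys]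
      by (intro CollectI exI[of _ "map2 (\<oplus>) xs ys"]) simp
  qed
  have smul: "a \<odot>\<^bsub>V\<^esub> v \<in> ?C" if av: "a \<in> carrier K" "v \<in> ?C" for a v
  proof -
    obtain xs where xs: "xs \<in> coefs K (length us)" "v = lcomb V xs us" using av by blast
    hence "map ((\<otimes>) a) xs \<in> coefs K (length us)" using av by (auto simp: coefs_def)
    moreover have "a \<odot>\<^bsub>V\<^esub> v = lcomb V (map ((\<otimes>) a) xs) us"
      using lcomb_smult[of a xs us] xs av c(1) by (simp add: coefs_def)
    ultimately show ?thesis by blast
  qed
  have z: "\<zero>\<^bsub>V\<^esub> \<in> ?C"
    using lcomb_replicate_zero[OF c(1)] 
    by (intro CollectI exI[of _ "replicate (length us) \<zero>"]) (auto simp: coefs_def set_replicate_conv_if)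
  have neg: "\<exists>w\<in>?C. v \<oplus>\<^bsub>V\<^esub> w = \<zero>\<^bsub>V\<^esub>" if v: "v \<in> ?C" for v
  proof -
    have "v \<in> carrier V" using v CV by blast
    hence "v \<oplus>\<^bsub>V\<^esub> v = \<zero>\<^bsub>V\<^esub>" using smult_l_distr[of \<one> \<one> v] by simp
    thus ?thesis using v by blast
  qed
  have Uv: "vectorspace K U"
  proof (rule vs_criteria)
    show "field K" by (rule field_axioms)
    show "\<zero>\<^bsub>U\<^esub> \<in> carrier U" using z by (simp add: U_def)
    show "\<forall>v w. v \<in> carrier U \<and> w \<in> carrier U \<longrightarrow> v \<oplus>\<^bsub>U\<^esub> w \<in> carrier U" using add by (simp add: U_def)
    show "\<forall>v\<in>carrier U. \<exists>w\<in>carrier U. v \<oplus>\<^bsub>U\<^esub> w = \<zero>\<^bsub>U\<^esub>" using neg by (simp add: U_def)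
    show "\<forall>c v. c \<in> carrier K \<and> v \<in> carrier U \<longrightarrow> c \<odot>\<^bsub>U\<^esub> v \<in> carrier U" using smul by (simp add: U_def)
  qed (auto simp: U_def CVI M.a_ac smult_assoc1 smult_l_distr smult_r_distr)
  interpret U: vectorspace K U by (rule Uv)
  have lu: "xs @ replicate (length ks) \<zero> \<in> coefs K (length (us @ ks))"
    "lcomb V (xs @ replicate (length ks) \<zero>) (us @ ks) = lcomb V xs us" if xs: "xs \<in> coefs K (length us)" for xs
  proof -
    have "set (replicate (length ks) \<zero>) \<subseteq> carrier K" by (auto simp: set_replicate_conv_if)
    thus "xs @ replicate (length ks) \<zero> \<in> coefs K (length (us @ ks))"
      "lcomb V (xs @ replicate (length ks) \<zero>) (us @ ks) = lcomb V xs us"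
      using xs c lcomb_append[of xs us "replicate (length ks) \<zero>" ks] lcomb_replicate_zero[OF c(2)]
        lcomb_closed[of xs us] by (auto simp: coefs_def)
  qed
  have ub: "list_basis K U us"
    unfolding list_basis_def
  proof (intro conjI ballI impI)
    show "set us \<subseteq> carrier U" using usC by (simp add: U_def)
    show "\<exists>xs\<in>coefs K (length us). v = lcomb U xs us" if "v \<in> carrier U" for v
      using that by (auto simp: lc) (auto simp: U_def)
    fix xs assume xs: "xs \<in> coefs K (length us)" "lcomb U xs us = \<zero>\<^bsub>U\<^esub>"
    hence "lcomb V (xs @ replicate (length ks) \<zero>) (us @ ks) = \<zero>\<^bsub>V\<^esub>"
      using lu(2)[OF xs(1)] lc[of xs us] by (simp add: U_def)
    from list_basis_independent[OF b(1) lu(1)[OF xs(1)] this]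
    have "xs @ replicate (length ks) \<zero> = replicate (length us) \<zero> @ replicate (length ks) \<zero>"
      by (simp add: replicate_add)
    thus "xs = replicate (length us) \<zero>" using xs(1) by (simp add: coefs_def)
  qed
  have Uform: "ts_form K U \<phi>"
  proof (intro ts_form.intro ts_form_axioms.intro Uv char_two)
    show "U.fin_dim" by (rule U.list_basis_dim(1)[OF ub])
  qed (auto simp: U_def CVI form_closed form_smult form_add)
  have an: "anisotropic K U \<phi>"
    unfolding isotropic_def
  proof
    assume "\<exists>v\<in>carrier U - {\<zero>\<^bsub>U\<^esub>}. \<phi> v = \<zero>"
    then obtain v where v: "v \<in> carrier U" "v \<noteq> \<zero>\<^bsub>U\<^esub>" "\<phi> v = \<zero>" by blast
    obtain xs where xs: "xs \<in> coefs K (length us)" "v = lcomb V xs us" using v(1) by (auto simp: U_def)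
    hence "xs = replicate (length us) \<zero>"
      using coefs_zero_if_values_independent[OF ds(1)[folded b(2)] c(1)] v(3) by blast
    hence "v = \<zero>\<^bsub>V\<^esub>" using xs(2) lcomb_replicate_zero[OF c(1)] by simp
    thus False using v(2) by (simp add: U_def)
  qed
  let ?P = "func_space {..<length ks}"
  obtain es where es: "list_basis K ?P es" "length es = length ks" using func_space_list_basis by blast
  have P: "vectorspace K ?P" by (rule func_space_is_vs)
  interpret P: vectorspace K ?P by (rule P)
  note D = direct_sum_list_basis[OF Uv ub P es(1)]
  have "isometric K V \<phi> (direct_sum U ?P) (orth_sum K \<phi> (diag_form K (length ks) (\<lambda>_. \<zero>)))"
  proof (rule isometric_if_list_bases[OF vectorspace_axioms b(1) direct_sum_is_vs[OF Uv P] D(1)])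
    show "length (us @ ks) = length (map (\<lambda>u. (u, \<zero>\<^bsub>?P\<^esub>)) us @ map (Pair \<zero>\<^bsub>U\<^esub>) es)" using es by simp
    fix zs assume zs: "zs \<in> coefs K (length (us @ ks))"
    let ?x = "take (length us) zs" and ?y = "drop (length us) zs"
    have xy: "?x \<in> coefs K (length us)" "?y \<in> coefs K (length es)"
      using zs set_take_subset[of "length us" zs] set_drop_subset[of "length us" zs] es(2)
      by (auto simp: coefs_def)
    have xc: "lcomb V ?x us \<in> carrier V" "lcomb V ?y ks \<in> carrier V" "lcomb ?P ?y es \<in> carrier ?P"
      using xy c P.lcomb_closed list_basis_carrier[OF es(1)] by (auto simp: coefs_def intro!: lcomb_closed)
    have "\<forall>w\<in>set ks. \<phi> w = \<zero>" using b(3) by (metis in_set_replicate image_eqI list.set_map)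
    hence y0: "\<phi> (lcomb V ?y ks) = \<zero>" using form_lcomb_eq_zero[of ?y ks] xy(2) c(2) es(2) by (simp add: coefs_def)
    have "lcomb V (?x @ ?y) (us @ ks) = lcomb V ?x us \<oplus>\<^bsub>V\<^esub> lcomb V ?y ks"
      using xy c by (intro lcomb_append) (auto simp: coefs_def)
    hence 1: "\<phi> (lcomb V zs (us @ ks)) = \<phi> (lcomb V ?x us)"
      using form_add[OF xc(1,2)] y0 form_closed[OF xc(1)] by simp
    have 2: "lcomb (direct_sum U ?P) zs (map (\<lambda>u. (u, \<zero>\<^bsub>?P\<^esub>)) us @ map (Pair \<zero>\<^bsub>U\<^esub>) es) =
        (lcomb U ?x us, lcomb ?P ?y es)" using D(2)[OF xy] by simp
    show "\<phi> (lcomb V zs (us @ ks)) = orth_sum K \<phi> (diag_form K (length ks) (\<lambda>_. \<zero>))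
        (lcomb (direct_sum U ?P) zs (map (\<lambda>u. (u, \<zero>\<^bsub>?P\<^esub>)) us @ map (Pair \<zero>\<^bsub>U\<^esub>) es))"
      unfolding 1 2 orth_sum_def using diag_form_zero[OF xc(3)] form_closed[OF xc(1)] lc by simp
  qed
  thus ?thesis using Uform an unfolding an_decomposition_def by blast
qed

theorem defect_eq:
  assumes r: "dimension r (squares K) (\<phi> ` carrier V)"
  shows "defect K V \<phi> = dim - r" "r \<le> dim"
proof -
  have u: "dim = r + k" if "an_decomposition K V \<phi> U \<sigma> k" for U :: "('k, 'v) module" and \<sigma> k
    using an_decomposition_dims(1,3)[OF ts_form_axioms that] dimension_is_inj[OF C.squares_subfield r] by simp
  obtain U :: "('k, 'v) module" and \<sigma> k where k: "an_decomposition K V \<phi> U \<sigma> k"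
    using an_decomposition_exists[OF r] by blast
  show "r \<le> dim" using u[OF k] by simp
  show "defect K V \<phi> = dim - r"
    unfolding defect_def
  proof (rule the_equality)
    show "\<exists>(U :: ('k, 'v) module) \<sigma>. an_decomposition K V \<phi> U \<sigma> (dim - r)" using k u[OF k] by auto
  qed (use u in fastforce)
qed

end

text \<open>Bases of \<open>V\<close> and \<open>W\<close> adapted to the same basis of the value space have the same lists of values.\<close>

theorem isometric_if_same_values:
  assumes \<phi>: "ts_form K V \<phi>" and \<psi>: "ts_form K W \<psi>"
    and dims: "vectorspace.dim K V = vectorspace.dim K W"
    and vals: "\<phi> ` carrier V = \<psi> ` carrier W"
  shows "isometric K V \<phi> W \<psi>"
proof -
  interpret f: ts_form K V \<phi> by fact
  interpret g: ts_form K W \<psi> by fact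
  obtain bs where bs: "list_basis K V bs" using f.list_basis_exists[OF f.finite_dim] .
  obtain ds where ds: "f.independent (squares K) ds" "f.Span (squares K) ds = \<phi> ` carrier V"
    using f.filter_base[OF f.C.squares_subfield f.map_form_carrier[OF list_basis_carrier[OF bs]]]
      f.values_eq_Span[OF bs] by metis
  obtain us ks where b: "list_basis K V (us @ ks)" "map \<phi> us = ds" "map \<phi> ks = replicate (length ks) \<zero>\<^bsub>K\<^esub>"
    using f.adapted_list_basis[OF ds] .
  obtain us' ks' where b': "list_basis K W (us' @ ks')" "map \<psi> us' = ds" "map \<psi> ks' = replicate (length ks') \<zero>\<^bsub>K\<^esub>"
    using g.adapted_list_basis[of ds] ds vals by metis
  have "length us = length us'" using b(2) b'(2) by (metis length_map)
  moreover have "length (us @ ks) = length (us' @ ks')"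
    using f.list_basis_dim(2)[OF b(1)] g.list_basis_dim(2)[OF b'(1)] dims by simp
  ultimately have eq: "map \<phi> (us @ ks) = map \<psi> (us' @ ks')" "length (us @ ks) = length (us' @ ks')"
    using b b' by auto
  show ?thesis
  proof (rule isometric_if_list_bases[OF f.vectorspace_axioms b(1) g.vectorspace_axioms b'(1) eq(2)])
    fix xs assume "xs \<in> coefs K (length (us @ ks))"
    hence "set xs \<subseteq> carrier K" by (simp add: coefs_def)
    thus "\<phi> (lcomb V xs (us @ ks)) = \<psi> (lcomb W xs (us' @ ks'))"
      using f.form_lcomb[OF _ list_basis_carrier[OF b(1)]] g.form_lcomb[OF _ list_basis_carrier[OF b'(1)]] eq(1)
      by metis
  qed
qed

section \<open>Extension of scalars\<close>

lemma (in ring) combine_unit_coefs: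
  assumes "set xs \<subseteq> carrier R" "i < length xs"
  shows "combine xs (unit_coefs R (length xs) i) = xs ! i"
  using assms
proof (induction xs arbitrary: i)
  case (Cons x xs)
  have z: "combine xs (replicate (length xs) \<zero>) = \<zero>"
    using Cons.prems(1) by (induction xs) auto
  show ?case
  proof (cases i)
    case 0 thus ?thesis using Cons.prems z by simp
  next
    case (Suc j)
    moreover have "xs ! j \<in> carrier R" using Cons.prems Suc by auto
    ultimately show ?thesis using Cons.IH[of j] Cons.prems by simp
  qed
qed simp

text \<open>\<open>\<chi>(\<Sum> x\<^sub>i b\<^sub>i) = \<Sum> c\<^sub>i x\<^sub>i\<^sup>2\<close>.  For a unit vector \<open>cs\<close> this is the square of a coordinate.\<close>

lemma (in ts_form) form_with_values:
  assumes b: "list_basis K V bs" and cs: "cs \<in> coefs K (length bs)"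
  obtains \<chi> where "ts_form K V \<chi>" "map \<chi> bs = cs"
proof -
  let ?c = "coordinates K V bs"
  note crd = coordinates[OF b]
  note bc = list_basis_carrier[OF b]
  define \<chi> where "\<chi> v = combine (map (\<lambda>x. x \<otimes> x) (?c v)) cs" for v
  have add: "combine (map (\<lambda>x. x \<otimes> x) (map2 (\<oplus>) xs ys)) zs =
      combine (map (\<lambda>x. x \<otimes> x) xs) zs \<oplus> combine (map (\<lambda>x. x \<otimes> x) ys) zs"
    if "xs \<in> coefs K n" "ys \<in> coefs K n" "zs \<in> coefs K n" for xs ys zs n
    using that
  proof (induction n arbitrary: xs ys zs)
    case (Suc n)
    then obtain x xs' y ys' z zs' where e: "xs = x # xs'" "ys = y # ys'" "zs = z # zs'"
      "x \<in> carrier K" "y \<in> carrier K" "z \<in> carrier K"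
      "xs' \<in> coefs K n" "ys' \<in> coefs K n" "zs' \<in> coefs K n" by (auto simp: coefs_Suc)
    have "combine (map (\<lambda>x. x \<otimes> x) xs') zs' \<in> carrier K" "combine (map (\<lambda>x. x \<otimes> x) ys') zs' \<in> carrier K"
      using e by (intro combine_in_carrier; auto simp: coefs_def)+
    moreover have "((x \<oplus> y) \<otimes> (x \<oplus> y)) \<otimes> z = (x \<otimes> x) \<otimes> z \<oplus> (y \<otimes> y) \<otimes> z"
      using e(4-6) C.square_add[of x y] l_distr[of "x \<otimes> x" "y \<otimes> y" z] by simp
    ultimately show ?case using Suc.IH[OF e(7-9)] e(4-6) unfolding e(1-3) by (simp add: R.a_ac)
  qed (simp add: coefs_zero)
  have smult: "combine (map (\<lambda>x. x \<otimes> x) (map ((\<otimes>) a) xs)) zs = (a \<otimes> a) \<otimes> combine (map (\<lambda>x. x \<otimes> x) xs) zs"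
    if "a \<in> carrier K" "set xs \<subseteq> carrier K" "set zs \<subseteq> carrier K" for a xs zs
  proof -
    have eq: "map (\<lambda>x. x \<otimes> x) (map ((\<otimes>) a) xs) = map ((\<otimes>) (a \<otimes> a)) (map (\<lambda>x. x \<otimes> x) xs)"
      using that by (auto simp: m_ac)
    have "set (map (\<lambda>x. x \<otimes> x) xs) \<subseteq> carrier K" using that by auto
    from combine_r_distr[OF this that(3), of "a \<otimes> a"] show ?thesis
      unfolding eq using that(1) by (simp del: map_map)
  qed
  have "ts_form K V \<chi>"
  proof (intro ts_form.intro ts_form_axioms.intro vectorspace_axioms char_two finite_dim)
    show "\<chi> v \<in> carrier K" if "v \<in> carrier V" for v
      unfolding \<chi>_def using crd[OF that] cs by (intro combine_in_carrier) (auto simp: coefs_def)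
  next
    fix a v assume av: "a \<in> carrier K" "v \<in> carrier V"
    show "\<chi> (a \<odot>\<^bsub>V\<^esub> v) = (a \<otimes> a) \<otimes> \<chi> v"
      unfolding \<chi>_def coordinates_smult[OF b av]
      using smult[of a "?c v" cs] crd(1)[OF av(2)] av cs by (simp add: coefs_def)
  next
    fix v w assume vw: "v \<in> carrier V" "w \<in> carrier V"
    show "\<chi> (v \<oplus>\<^bsub>V\<^esub> w) = \<chi> v \<oplus> \<chi> w"
      unfolding \<chi>_def coordinates_add[OF b vw] using add[OF crd(1)[OF vw(1)] crd(1)[OF vw(2)] cs] by simp
  qed
  moreover have "map \<chi> bs = cs"
  proof (rule nth_equalityI)
    show "length (map \<chi> bs) = length cs" using cs by (simp add: coefs_def)
    fix i assume "i < length (map \<chi> bs)"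
    hence i: "i < length bs" by simp
    have csl: "set cs \<subseteq> carrier K" "length cs = length bs" using cs by (auto simp: coefs_def)
    let ?e = "unit_coefs K (length bs) i"
    have ec: "?e \<in> coefs K (length bs)" by (rule unit_coefs_closed[OF is_ring])
    have "?c (bs ! i) = ?e" by (rule coordinates_eqI[OF b ec lcomb_unit_coefs[OF i bc]])
    moreover have "map (\<lambda>x. x \<otimes> x) ?e = ?e" by (simp add: map_update)
    moreover have "combine ?e cs = combine cs ?e"
    proof -
      have "combine xs ys = combine ys xs" if "set xs \<subseteq> carrier K" "set ys \<subseteq> carrier K" for xs ys
        using that by (induction xs ys rule: list_induct2') (auto simp: m_comm)
      thus ?thesis using ec csl by (auto simp: coefs_def)
    qed
    ultimately have "\<chi> (bs ! i) = combine cs ?e" by (simp add: \<chi>_def)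
    also have "\<dots> = cs ! i" using combine_unit_coefs[of cs i] csl i by simp
    finally show "map \<chi> bs ! i = cs ! i" using i by simp
  qed
  ultimately show thesis using that by blast
qed

context scalar_extension
begin

text \<open>This is \<open>1 \<otimes> v\<close>.\<close>

definition "tensor v = cs (\<delta> v)"

lemma tensor_closed: "tensor v \<in> carrier X"
  unfolding tensor_def by (rule cs_mem) simp

lemma tensor_eq_pure: "tensor v = pure_tensor E h F V \<one>\<^bsub>E\<^esub> v"
  by (simp add: tensor_def pt)

lemma ext_form_tensor:
  assumes "ts_form F V \<chi>" "v \<in> S"
  shows "ext_form E h F V \<chi> (tensor v) = h (\<chi> v)"
  using ext_form(2)[OF assms(1) E.field_axioms h E.one_closed assms(2)]
    ts_form.form_closed[OF assms] by (simp add: tensor_eq_pure)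

lemma tensor_lcomb:
  assumes "set xs \<subseteq> carrier F" "set bs \<subseteq> S"
  shows "tensor (lcomb V xs bs) = lcomb X (map h xs) (map tensor bs)"
proof -
  have t0: "tensor \<zero>\<^bsub>V\<^esub> = \<zero>\<^bsub>X\<^esub>"
  proof -
    have "tensor (\<zero>\<^bsub>F\<^esub> \<odot>\<^bsub>V\<^esub> \<zero>\<^bsub>V\<^esub>) = \<zero>\<^bsub>E\<^esub> \<odot>\<^bsub>X\<^esub> tensor \<zero>\<^bsub>V\<^esub>"
      unfolding tensor_def by (subst csd_sm) (simp_all add: hzero)
    thus ?thesis using X.lmult_0[OF tensor_closed] by simp
  qed
  show ?thesis using assms
    by (induction xs bs rule: list_induct2')
      (auto simp: t0 csd_add csd_sm tensor_def[symmetric] csd_add[folded tensor_def]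
        csd_sm[folded tensor_def] f.lcomb_closed)
qed

text \<open>For the independence of the tensors \<open>1 \<otimes> b\<^sub>i\<close> suppose that \<open>\<Sum> x\<^sub>i \<otimes> b\<^sub>i = 0\<close>, and let \<open>\<chi>\<close> be the
  square of the \<open>i\<close>-th coordinate on \<open>V\<close>.  The extension of the form \<open>\<chi>\<close> to \<open>E \<otimes> V\<close> takes the value
  \<open>x\<^sub>i\<^sup>2\<close> on the left-hand side, so \<open>x\<^sub>i = 0\<close>.\<close>

lemma tensor_list_basis:
  assumes b: "list_basis F V bs"
  shows "list_basis E X (map tensor bs)"
proof -
  interpret XV: vectorspace E X by (rule vsX)
  note bc = list_basis_carrier[OF b]
  have tc: "set (map tensor bs) \<subseteq> carrier X" using tensor_closed by auto
  let ?n = "length (map tensor bs)"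
  have span: "\<exists>xs\<in>coefs E ?n. cs m = lcomb X xs (map tensor bs)" if "m \<in> carrier M" for m
    using that
  proof (induction rule: M_induct)
    case (1 m m')
    then obtain xs ys where "xs \<in> coefs E ?n" "cs m = lcomb X xs (map tensor bs)"
      "ys \<in> coefs E ?n" "cs m' = lcomb X ys (map tensor bs)" by blast
    thus ?case using XV.lcomb_add[of xs "map tensor bs" ys] tc cs_add[OF 1(1,2)]
        coefs_add[OF E.is_ring, of xs ?n ys]
      by (intro bexI[of _ "map2 (\<oplus>\<^bsub>E\<^esub>) xs ys"]) simp_all
  next
    case (2 c v)
    obtain xs where xs: "xs \<in> coefs F (length bs)" "v = lcomb V xs bs" using list_basis_spans[OF b 2(2)] .
    have hx: "set (map h xs) \<subseteq> carrier E" using xs by (auto simp: coefs_def)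
    have "cs (c \<odot>\<^bsub>M\<^esub> \<delta> v) = c \<odot>\<^bsub>X\<^esub> tensor v" unfolding tensor_def using cs_smult[OF dM 2(1)] by simp
    also have "\<dots> = c \<odot>\<^bsub>X\<^esub> lcomb X (map h xs) (map tensor bs)"
      unfolding xs(2) using tensor_lcomb[of xs bs] xs(1) bc by (simp add: coefs_def)
    also have "\<dots> = lcomb X (map ((\<otimes>\<^bsub>E\<^esub>) c) (map h xs)) (map tensor bs)"
      using XV.lcomb_smult[OF 2(1) hx tc] by simp
    finally show ?case using hx 2(1) xs(1)
      by (intro bexI[of _ "map ((\<otimes>\<^bsub>E\<^esub>) c) (map h xs)"]) (auto simp: coefs_def)
  qed
  have ind: "xs = replicate ?n \<zero>\<^bsub>E\<^esub>"
    if xs: "xs \<in> coefs E ?n" "lcomb X xs (map tensor bs) = \<zero>\<^bsub>X\<^esub>" for xs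
  proof (rule nth_equalityI)
    have xl: "set xs \<subseteq> carrier E" "length xs = length bs" using xs(1) by (auto simp: coefs_def)
    fix i assume i: "i < length xs"
    let ?u = "unit_coefs F (length bs) i"
    have uc: "?u \<in> coefs F (length bs)" by (rule unit_coefs_closed[OF f.is_ring])
    obtain \<chi> where \<chi>: "ts_form F V \<chi>" "map \<chi> bs = ?u" using f.form_with_values[OF b uc] .
    interpret q: ts_form E X "ext_form E h F V \<chi>" by (rule ext_form(1)[OF \<chi>(1) E.field_axioms h])
    have "map (ext_form E h F V \<chi>) (map tensor bs) = map (\<lambda>v. h (\<chi> v)) bs"
      using ext_form_tensor[OF \<chi>(1)] bc by auto
    also have "\<dots> = map h (map \<chi> bs)" by simp
    also have "\<dots> = unit_coefs E (length bs) i"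
      unfolding \<chi>(2) by (simp add: map_update hzero hone)
    finally have v: "map (ext_form E h F V \<chi>) (map tensor bs) = unit_coefs E (length bs) i" .
    let ?s = "map (\<lambda>x. x \<otimes>\<^bsub>E\<^esub> x) xs"
    have "\<zero>\<^bsub>E\<^esub> = E.combine ?s (unit_coefs E (length ?s) i)"
      using q.form_lcomb[OF xl(1) tc] q.form_zero xs(2) v xl(2) by simp
    also have "\<dots> = ?s ! i" using xl i by (intro E.combine_unit_coefs) auto
    finally have "xs ! i \<otimes>\<^bsub>E\<^esub> xs ! i = \<zero>\<^bsub>E\<^esub>" using i by simp
    moreover have "xs ! i \<in> carrier E" using xl(1) i by auto
    ultimately have "xs ! i = \<zero>\<^bsub>E\<^esub>" using E.integral by blast
    thus "xs ! i = replicate ?n \<zero>\<^bsub>E\<^esub> ! i" using i xl(2) by simp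
  qed (use xs in \<open>simp add: coefs_def\<close>)
  show ?thesis unfolding list_basis_def using tc span ind cs_rep by metis
qed

text \<open>\<open>r\<close> is the dimension over \<open>E\<^sup>2\<close> of the value space of \<open>\<phi>\<^sub>E\<close>, which is spanned by the image of a
  basis \<open>ds\<close> of the value space of \<open>\<phi>\<close>.\<close>

lemma defect_ext_form:
  assumes ds: "f.independent (squares F) ds" "f.Span (squares F) ds = \<phi> ` carrier V"
  obtains r where "defect E X (ext_form E h F V \<phi>) = f.dim - r" "r \<le> f.dim" "r \<le> length ds"
    "r = length ds \<longleftrightarrow> E.independent (squares E) (map h ds)"
proof -
  obtain us ks where b: "list_basis F V (us @ ks)" "map \<phi> us = ds" "map \<phi> ks = replicate (length ks) \<zero>\<^bsub>F\<^esub>"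
    using f.adapted_list_basis[OF ds] .
  note bc = list_basis_carrier[OF b(1)]
  have dc: "set ds \<subseteq> carrier F" by (rule f.independent_in_carrier[OF ds(1)])
  hence hd: "set (map h ds) \<subseteq> carrier E" by auto
  interpret q: ts_form E X "ext_form E h F V \<phi>"
    by (rule ext_form(1)[OF f.ts_form_axioms E.field_axioms h])
  note tb = tensor_list_basis[OF b(1)]
  have dimX: "q.dim = f.dim" using q.list_basis_dim(2)[OF tb] f.list_basis_dim(2)[OF b(1)] by simp
  have "map (ext_form E h F V \<phi>) (map tensor (us @ ks)) = map (\<lambda>v. h (\<phi> v)) (us @ ks)"
    using ext_form_tensor[OF f.ts_form_axioms] bc by auto
  also have "\<dots> = map h (map \<phi> us @ map \<phi> ks)" by simp
  also have "\<dots> = map h ds @ replicate (length ks) \<zero>\<^bsub>E\<^esub>" unfolding b(2,3) by (simp add: hzero)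
  finally have vals: "ext_form E h F V \<phi> ` carrier X = E.Span (squares E) (map h ds @ replicate (length ks) \<zero>\<^bsub>E\<^esub>)"
    using q.values_eq_Span[OF tb] by simp
  note K = q.C.squares_subfield
  have zc: "set (replicate (length ks) \<zero>\<^bsub>E\<^esub>) \<subseteq> {\<zero>\<^bsub>E\<^esub>}" by (auto simp: set_replicate_conv_if)
  have "E.Span (squares E) (map h ds @ replicate (length ks) \<zero>\<^bsub>E\<^esub>) = E.Span (squares E) (map h ds)"
  proof
    have "set (map h ds @ replicate (length ks) \<zero>\<^bsub>E\<^esub>) \<subseteq> E.Span (squares E) (map h ds)"
      using E.Span_base_incl[OF K hd] E.Span_subgroup_props(2)[OF K hd] zc by auto
    thus "E.Span (squares E) (map h ds @ replicate (length ks) \<zero>\<^bsub>E\<^esub>) \<subseteq> E.Span (squares E) (map h ds)"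
      by (rule E.mono_Span_subset[OF K _ hd])
    show "E.Span (squares E) (map h ds) \<subseteq> E.Span (squares E) (map h ds @ replicate (length ks) \<zero>\<^bsub>E\<^esub>)"
      by (rule E.mono_Span_append(1)[OF K hd]) (use zc in auto)
  qed
  moreover obtain r where r: "r \<le> length (map h ds)" "E.dimension r (squares E) (E.Span (squares E) (map h ds))"
    "r = length (map h ds) \<longleftrightarrow> E.independent (squares E) (map h ds)"
    using q.C.Span_dimension[OF K hd] by blast
  ultimately have "E.dimension r (squares E) (ext_form E h F V \<phi> ` carrier X)" using vals by simp
  from q.defect_eq[OF this] show thesis using that[of r] r dimX by simp
qed

end

section \<open>Quadratic extensions\<close>

context field_char_two
begin

text \<open>\<open>(s + t\<surd>a)\<^sup>2 = s\<^sup>2 + at\<^sup>2\<close> in characteristic 2.\<close>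

lemma squares_adjoin_sqrt:
  assumes "a \<in> carrier R" "z \<in> squares (adjoin_sqrt R a)"
  shows "\<exists>x\<in>sqs. \<exists>y\<in>sqs. z = (x \<oplus> a \<otimes> y, \<zero>)"
proof -
  obtain s t where st: "(s, t) \<in> carrier (adjoin_sqrt R a)" "z = (s, t) \<otimes>\<^bsub>adjoin_sqrt R a\<^esub> (s, t)"
    using assms(2) by (auto simp: squares_def)
  hence c: "s \<in> carrier R" "t \<in> carrier R" by (auto simp: adjoin_sqrt_def split: if_splits)
  have "z = (s \<otimes> s \<oplus> a \<otimes> (t \<otimes> t), \<zero>)"
    using st(2) c m_comm[of t s] by (simp add: adjoin_sqrt_def)
  thus ?thesis using square_in c by blast
qed

lemma square_in_adjoin_sqrt:
  assumes "a \<in> carrier R" "a \<notin> sqs" "x \<in> sqs" "y \<in> sqs"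
  shows "(x \<oplus> a \<otimes> y, \<zero>) \<in> squares (adjoin_sqrt R a)"
proof -
  obtain s t where st: "s \<in> carrier R" "t \<in> carrier R" "x = s \<otimes> s" "y = t \<otimes> t"
    using assms(3,4) by (auto simp: squares_def)
  hence "(x \<oplus> a \<otimes> y, \<zero>) = (s, t) \<otimes>\<^bsub>adjoin_sqrt R a\<^esub> (s, t)"
    using m_comm[of t s] by (simp add: adjoin_sqrt_def)
  moreover have "(s, t) \<in> carrier (adjoin_sqrt R a)" using st assms(2) by (simp add: adjoin_sqrt_def)
  ultimately show ?thesis unfolding squares_def by blast
qed

lemma squares_adjoin_sqrt_list:
  assumes "a \<in> carrier R" "set ks \<subseteq> squares (adjoin_sqrt R a)"
  obtains xs ys where "set xs \<subseteq> sqs" "set ys \<subseteq> sqs" "length xs = length ks" "length ys = length ks"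
    "ks = map2 (\<lambda>x y. (x \<oplus> a \<otimes> y, \<zero>)) xs ys"
proof -
  have "\<exists>xs ys. set xs \<subseteq> sqs \<and> set ys \<subseteq> sqs \<and> length xs = length ks \<and> length ys = length ks \<and>
    ks = map2 (\<lambda>x y. (x \<oplus> a \<otimes> y, \<zero>)) xs ys"
    using assms(2)
  proof (induction ks)
    case (Cons k ks)
    have "set ks \<subseteq> squares (adjoin_sqrt R a)" using Cons.prems by simp
    from Cons.IH[OF this]
    obtain xs ys where i: "set xs \<subseteq> sqs" "set ys \<subseteq> sqs" "length xs = length ks" "length ys = length ks"
      "ks = map2 (\<lambda>x y. (x \<oplus> a \<otimes> y, \<zero>)) xs ys" by blast
    obtain x y where "x \<in> sqs" "y \<in> sqs" "k = (x \<oplus> a \<otimes> y, \<zero>)"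
      using squares_adjoin_sqrt[OF assms(1)] Cons.prems by (metis list.set_intros(1) subsetD)
    hence "set (x # xs) \<subseteq> sqs" "set (y # ys) \<subseteq> sqs"
      "k # ks = map2 (\<lambda>x y. (x \<oplus> a \<otimes> y, \<zero>)) (x # xs) (y # ys)"
      using i(1,2,5) by (simp_all only: list.set insert_subset zip_Cons_Cons list.map prod.case)
    moreover have "length (x # xs) = length (k # ks)" "length (y # ys) = length (k # ks)"
      using i(3,4) by (simp_all only: list.size)
    ultimately show ?case by - (rule exI[of _ "x # xs"], rule exI[of _ "y # ys"], intro conjI)
  qed simp
  thus thesis using that by blast
qed

lemma combine_adjoin_sqrt:
  assumes a: "a \<in> carrier R" and l: "length xs = length ds" "length ys = length ds"
    and c: "set xs \<subseteq> carrier R" "set ys \<subseteq> carrier R" "set ds \<subseteq> carrier R"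
  shows "ring.combine (adjoin_sqrt R a) (map2 (\<lambda>x y. (x \<oplus> a \<otimes> y, \<zero>)) xs ys) (map (sqrt_embed R) ds) =
    (combine xs ds \<oplus> a \<otimes> combine ys ds, \<zero>)"
proof -
  interpret E: field "adjoin_sqrt R a" by (rule adjoin_sqrt_field[OF one_plus_one a])
  show ?thesis using l c
  proof (induction ds arbitrary: xs ys)
    case Nil
    have "\<zero>\<^bsub>adjoin_sqrt R a\<^esub> = (\<zero>, \<zero>)" by (simp add: adjoin_sqrt_def)
    thus ?case using Nil a by simp
  next
    case (Cons d ds)
    then obtain x xs' y ys' where e: "xs = x # xs'" "ys = y # ys'"
      by (metis length_Suc_conv)
    have cc: "x \<in> carrier R" "y \<in> carrier R" "d \<in> carrier R" "combine xs' ds \<in> carrier R" "combine ys' ds \<in> carrier R"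
      using Cons.prems e by auto
    have "(x \<oplus> a \<otimes> y, \<zero>) \<otimes>\<^bsub>adjoin_sqrt R a\<^esub> sqrt_embed R d = ((x \<oplus> a \<otimes> y) \<otimes> d, \<zero>)"
      using cc a by (simp add: adjoin_sqrt_def sqrt_embed_def)
    moreover have "E.combine (map2 (\<lambda>x y. (x \<oplus> a \<otimes> y, \<zero>)) xs' ys') (map (sqrt_embed R) ds) =
      (combine xs' ds \<oplus> a \<otimes> combine ys' ds, \<zero>)" using Cons e by auto
    moreover have "(p, \<zero>) \<oplus>\<^bsub>adjoin_sqrt R a\<^esub> (q, \<zero>) = (p \<oplus> q, \<zero>)" for p q
      by (simp add: adjoin_sqrt_def)
    ultimately have "E.combine (map2 (\<lambda>x y. (x \<oplus> a \<otimes> y, \<zero>)) xs ys) (map (sqrt_embed R) (d # ds)) =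
      ((x \<oplus> a \<otimes> y) \<otimes> d \<oplus> (combine xs' ds \<oplus> a \<otimes> combine ys' ds), \<zero>)"
      unfolding e by simp
    also have "(x \<oplus> a \<otimes> y) \<otimes> d \<oplus> (combine xs' ds \<oplus> a \<otimes> combine ys' ds) =
      combine xs (d # ds) \<oplus> a \<otimes> combine ys (d # ds)"
      unfolding e using cc a by (simp add: l_distr r_distr m_assoc a_ac)
    finally show ?case .
  qed
qed

lemma map_sqrt_embed_carrier:
  "set ds \<subseteq> carrier R \<Longrightarrow> set (map (sqrt_embed R) ds) \<subseteq> carrier (adjoin_sqrt R a)"
  by (auto simp: sqrt_embed_def adjoin_sqrt_def)

lemma adjoin_sqrt_char_two:
  assumes "a \<in> carrier R"
  shows "field_char_two (adjoin_sqrt R a)"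
  using adjoin_sqrt_field[OF one_plus_one assms] one_plus_one
  by (intro field_char_two.intro field_char_two_axioms.intro) (auto simp: adjoin_sqrt_def)

text \<open>Here \<open>F(\<surd>0) = F\<close>.\<close>

lemma independent_adjoin_sqrt_zero:
  assumes ds: "independent sqs ds"
  shows "ring.independent (adjoin_sqrt R \<zero>) (squares (adjoin_sqrt R \<zero>)) (map (sqrt_embed R) ds)"
proof -
  interpret E: field_char_two "adjoin_sqrt R \<zero>" by (rule adjoin_sqrt_char_two) simp
  have dc: "set ds \<subseteq> carrier R" by (rule independent_in_carrier[OF ds])
  show ?thesis
    unfolding E.independent_iff_combine[OF E.squares_subfield map_sqrt_embed_carrier[OF dc]]
  proof (intro allI impI)
    fix ks assume ks: "set ks \<subseteq> squares (adjoin_sqrt R \<zero>)" "length ks = length (map (sqrt_embed R) ds)"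
      "E.combine ks (map (sqrt_embed R) ds) = \<zero>\<^bsub>adjoin_sqrt R \<zero>\<^esub>"
    obtain xs ys where xy: "set xs \<subseteq> sqs" "set ys \<subseteq> sqs" "length xs = length ks" "length ys = length ks"
      "ks = map2 (\<lambda>x y. (x \<oplus> \<zero> \<otimes> y, \<zero>)) xs ys"
      using squares_adjoin_sqrt_list[OF zero_closed ks(1)] .
    have c: "set xs \<subseteq> carrier R" "set ys \<subseteq> carrier R" using xy(1,2) sqs_carrier by auto
    have l: "length xs = length ds" "length ys = length ds" using xy(3,4) ks(2) by auto
    have "combine xs ds \<in> carrier R" "combine ys ds \<in> carrier R" using c dc by auto
    moreover have "combine xs ds \<oplus> \<zero> \<otimes> combine ys ds = \<zero>"
      using combine_adjoin_sqrt[OF zero_closed l c dc] ks(3) unfolding xy(5) by (simp add: adjoin_sqrt_def)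
    ultimately have "combine xs ds = \<zero>" by simp
    hence x0: "xs = replicate (length ds) \<zero>"
      using independent_iff_combine[OF squares_subfield dc] ds xy(1,3) ks(2) by simp
    show "ks = replicate (length (map (sqrt_embed R) ds)) \<zero>\<^bsub>adjoin_sqrt R \<zero>\<^esub>"
    proof (rule nth_equalityI)
      fix i assume i: "i < length ks"
      have "ys ! i \<in> carrier R" using c(2) i xy(4) by auto
      moreover have "map2 (\<lambda>x y. (x \<oplus> \<zero> \<otimes> y, \<zero>)) xs ys ! i = (xs ! i \<oplus> \<zero> \<otimes> ys ! i, \<zero>)"
        using i xy(3,4) by simp
      ultimately have "ks ! i = (\<zero>, \<zero>)" unfolding xy(5)[symmetric] using i x0 ks(2) by simp
      thus "ks ! i = replicate (length (map (sqrt_embed R) ds)) \<zero>\<^bsub>adjoin_sqrt R \<zero>\<^esub> ! i"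
        using i ks(2) by (simp add: adjoin_sqrt_def)
    qed (simp add: ks(2))
  qed
qed

text \<open>A relation among \<open>ds\<close> with coefficients in \<open>F(\<surd>a)\<^sup>2 = F\<^sup>2 + aF\<^sup>2\<close> is an equation \<open>d + ad' = 0\<close>
  with \<open>d\<close> and \<open>d'\<close> in the \<open>F\<^sup>2\<close>-span of \<open>ds\<close>.\<close>

lemma independent_adjoin_sqrt_iff:
  assumes a: "a \<in> carrier R" "a \<notin> sqs" and ds: "independent sqs ds"
  shows "ring.independent (adjoin_sqrt R a) (squares (adjoin_sqrt R a)) (map (sqrt_embed R) ds) \<longleftrightarrow>
    \<not> (\<exists>d\<in>Span sqs ds - {\<zero>}. \<exists>d'\<in>Span sqs ds - {\<zero>}. a = d \<otimes> inv d')"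
proof -
  interpret E: field_char_two "adjoin_sqrt R a" by (rule adjoin_sqrt_char_two[OF a(1)])
  have dc: "set ds \<subseteq> carrier R" by (rule independent_in_carrier[OF ds])
  note iff = E.independent_iff_combine[OF E.squares_subfield map_sqrt_embed_carrier[OF dc]]
  note span = Span_mem_iff_length_version[OF squares_subfield dc]
  note ind = independent_iff_combine[OF squares_subfield dc]
  have z: "\<zero> \<in> sqs" using square_in[of \<zero>] by simp
  show ?thesis
  proof
    assume i: "E.independent (squares (adjoin_sqrt R a)) (map (sqrt_embed R) ds)"
    show "\<not> (\<exists>d\<in>Span sqs ds - {\<zero>}. \<exists>d'\<in>Span sqs ds - {\<zero>}. a = d \<otimes> inv d')"
    proof
      assume "\<exists>d\<in>Span sqs ds - {\<zero>}. \<exists>d'\<in>Span sqs ds - {\<zero>}. a = d \<otimes> inv d'"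
      then obtain d d' where d: "d \<in> Span sqs ds" "d' \<in> Span sqs ds" "d' \<noteq> \<zero>" "a = d \<otimes> inv d'" by blast
      obtain xs where xs: "set xs \<subseteq> sqs" "length xs = length ds" "d = combine xs ds" using d(1) span by auto
      obtain ys where ys: "set ys \<subseteq> sqs" "length ys = length ds" "d' = combine ys ds" using d(2) span by auto
      have c: "set xs \<subseteq> carrier R" "set ys \<subseteq> carrier R" using xs(1) ys(1) sqs_carrier by auto
      have dd: "d \<in> carrier R" "d' \<in> carrier R" using c dc xs(3) ys(3) by auto
      have "a \<otimes> d' = d" unfolding d(4) using inv_nz[OF dd(2) d(3)] dd by (simp add: m_assoc m_comm[of "inv d'"])
      hence sum: "combine xs ds \<oplus> a \<otimes> combine ys ds = \<zero>" using xs(3) ys(3) dd by simp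
      let ?ks = "map2 (\<lambda>x y. (x \<oplus> a \<otimes> y, \<zero>)) xs ys"
      have "set ?ks \<subseteq> squares (adjoin_sqrt R a)"
        using xs(1) ys(1)
        by (auto dest: set_zip_leftD set_zip_rightD intro!: square_in_adjoin_sqrt[OF a])
      moreover have "E.combine ?ks (map (sqrt_embed R) ds) = \<zero>\<^bsub>adjoin_sqrt R a\<^esub>"
        using combine_adjoin_sqrt[OF a(1) xs(2) ys(2) c dc] sum by (simp add: adjoin_sqrt_def)
      ultimately have ks: "?ks = replicate (length ds) \<zero>\<^bsub>adjoin_sqrt R a\<^esub>"
        using i unfolding iff using xs(2) ys(2) by simp
      have "ys = replicate (length ds) \<zero>"
      proof (rule nth_equalityI)
        fix i assume i: "i < length ys"
        have m: "xs ! i \<in> sqs" "ys ! i \<in> sqs" using i xs ys by auto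
        then obtain s t where st: "s \<in> carrier R" "t \<in> carrier R" "xs ! i = s \<otimes> s" "ys ! i = t \<otimes> t"
          by (auto simp: squares_def)
        have "?ks ! i = (\<zero>, \<zero>)" unfolding ks using i ys(2) by (simp add: adjoin_sqrt_def)
        hence "s \<otimes> s \<oplus> a \<otimes> (t \<otimes> t) = \<zero>" using i xs(2) ys(2) st(3,4) by simp
        hence "t = \<zero>" using adjoin_sqrt_aux(1)[OF one_plus_one a st(1,2)] by blast
        thus "ys ! i = replicate (length ds) \<zero> ! i" using st i ys(2) by simp
      qed (simp add: ys(2))
      hence "d' = \<zero>" unfolding ys(3) using combine_replicate[OF dc] by simp
      thus False using d(3) by simp
    qed
  next
    assume no: "\<not> (\<exists>d\<in>Span sqs ds - {\<zero>}. \<exists>d'\<in>Span sqs ds - {\<zero>}. a = d \<otimes> inv d')"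
    show "E.independent (squares (adjoin_sqrt R a)) (map (sqrt_embed R) ds)"
      unfolding iff
    proof (intro allI impI)
      fix ks assume ks: "set ks \<subseteq> squares (adjoin_sqrt R a)" "length ks = length (map (sqrt_embed R) ds)"
        "E.combine ks (map (sqrt_embed R) ds) = \<zero>\<^bsub>adjoin_sqrt R a\<^esub>"
      obtain xs ys where xy: "set xs \<subseteq> sqs" "set ys \<subseteq> sqs" "length xs = length ks" "length ys = length ks"
        "ks = map2 (\<lambda>x y. (x \<oplus> a \<otimes> y, \<zero>)) xs ys"
        using squares_adjoin_sqrt_list[OF a(1) ks(1)] .
      have c: "set xs \<subseteq> carrier R" "set ys \<subseteq> carrier R" using xy(1,2) sqs_carrier by auto
      let ?p = "combine xs ds" and ?q = "combine ys ds"
      have pq: "?p \<in> carrier R" "?q \<in> carrier R" using c dc by auto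
      have l: "length xs = length ds" "length ys = length ds" using xy(3,4) ks(2) by auto
      have S: "?p \<in> Span sqs ds" "?q \<in> Span sqs ds" using span xy(1,2) l by auto
      have sum: "?p \<oplus> a \<otimes> ?q = \<zero>"
        using combine_adjoin_sqrt[OF a(1) l c dc] ks(3) unfolding xy(5) by (simp add: adjoin_sqrt_def)
      hence p: "?p = a \<otimes> ?q" using add_eq_zero_iff pq a(1) by simp
      have q0: "?q = \<zero>"
      proof (rule ccontr)
        assume q: "?q \<noteq> \<zero>"
        have "a \<noteq> \<zero>" using a(2) z by auto
        hence "?p \<noteq> \<zero>" using p q pq a(1) integral[of a ?q] by auto
        moreover have "a = ?p \<otimes> inv ?q" unfolding p using inv_nz[OF pq(2) q] a(1) pq(2) by (simp add: m_assoc)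
        ultimately show False using no S q by blast
      qed
      hence "?p = \<zero>" using p a(1) by simp
      hence "xs = replicate (length ds) \<zero>" "ys = replicate (length ds) \<zero>"
        using ind ds xy(1,2) l q0 by auto
      hence "ks = replicate (length ds) (\<zero> \<oplus> a \<otimes> \<zero>, \<zero>)"
        unfolding xy(5) by (simp add: zip_replicate)
      thus "ks = replicate (length (map (sqrt_embed R) ds)) \<zero>\<^bsub>adjoin_sqrt R a\<^esub>"
        using a(1) by (simp add: adjoin_sqrt_def)
    qed
  qed
qed

text \<open>As \<open>st = (s/t) t\<^sup>2\<close>, a nonsquare product is a nonsquare ratio up to a square factor, which \<open>D\<close>
  absorbs.  A square \<open>q\<close> is the product of \<open>qd\<close> and \<open>1/d\<close>, both in \<open>D\<close>.\<close>

lemma products_if_ratios: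
  assumes D: "space D" "d \<in> D" "d \<noteq> \<zero>" and D': "space D'"
    and ratios: "\<And>x y. \<lbrakk>x \<in> D' - {\<zero>}; y \<in> D' - {\<zero>}; x \<otimes> inv y \<notin> sqs\<rbrakk> \<Longrightarrow>
      \<exists>a\<in>D - {\<zero>}. \<exists>b\<in>D - {\<zero>}. x \<otimes> inv y = a \<otimes> inv b"
    and st: "s \<in> D'" "t \<in> D'"
  shows "\<exists>a\<in>D. \<exists>b\<in>D. s \<otimes> t = a \<otimes> b"
proof -
  have dc: "d \<in> carrier R" using space_carrier[OF D(1,2)] .
  have sc: "s \<in> carrier R" "t \<in> carrier R" using st space_carrier[OF D'] by auto
  have ratio: "p \<otimes> q = (p \<otimes> inv q) \<otimes> (q \<otimes> q)" if "p \<in> carrier R" "q \<in> carrier R" "q \<noteq> \<zero>" for p q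
    using that inv_nz[OF that(2,3)] by (simp add: m_assoc inv_cancel)
  consider "s \<otimes> t \<in> sqs" | "s \<otimes> t \<notin> sqs" by blast
  thus ?thesis
  proof cases
    case 1
    have i: "inv d \<in> D" using inv_square_mult[OF dc D(3)] space_smult[OF D(1) _ D(2)] by metis
    have "s \<otimes> t = ((s \<otimes> t) \<otimes> d) \<otimes> inv d" using sc dc inv_nz[OF dc D(3)] by (simp add: m_assoc)
    thus ?thesis using space_smult[OF D(1) 1 D(2)] i by blast
  next
    case 2
    have nz: "s \<noteq> \<zero>" "t \<noteq> \<zero>" using 2 sc square_in[of \<zero>] by auto
    note i = inv_nz[OF sc(2) nz(2)]
    have "s \<otimes> inv t \<notin> sqs"
    proof
      assume "s \<otimes> inv t \<in> sqs"
      hence "(s \<otimes> inv t) \<otimes> (t \<otimes> t) \<in> sqs"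
        using subringE(6)[OF subfieldE(1)[OF squares_subfield]] square_in[OF sc(2)] by blast
      thus False using 2 ratio[OF sc nz(2)] by simp
    qed
    then obtain a b where ab: "a \<in> D" "b \<in> D" "b \<noteq> \<zero>" "s \<otimes> inv t = a \<otimes> inv b"
      using ratios[of s t] st nz by blast
    have c: "a \<in> carrier R" "b \<in> carrier R" using ab space_carrier[OF D(1)] by auto
    have ib: "inv b \<in> D" using inv_square_mult[OF c(2) ab(3)] space_smult[OF D(1) _ ab(2)] by metis
    have "s \<otimes> t = ((t \<otimes> t) \<otimes> a) \<otimes> inv b"
      unfolding ratio[OF sc nz(2)] ab(4) using c sc inv_nz[OF c(2) ab(3)] by (simp add: m_ac)
    thus ?thesis using space_smult[OF D(1) square_in[OF sc(2)] ab(1)] ib by blast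
  qed
qed

end

section \<open>Weak Vishik equivalence of minimal forms\<close>

lemma defect_at_sqrt:
  assumes \<phi>: "ts_form F V \<phi>" and a: "a \<in> carrier F"
    and ds: "ring.independent F (squares F) ds" "ring.Span F (squares F) ds = \<phi> ` carrier V"
  obtains r where
    "defect (adjoin_sqrt F a) (ext_space (adjoin_sqrt F a) (sqrt_embed F) F V)
      (ext_form (adjoin_sqrt F a) (sqrt_embed F) F V \<phi>) = vectorspace.dim F V - r"
    "r \<le> vectorspace.dim F V" "r \<le> length ds"
    "r = length ds \<longleftrightarrow>
      ring.independent (adjoin_sqrt F a) (squares (adjoin_sqrt F a)) (map (sqrt_embed F) ds)"
proof -
  interpret f: ts_form F V \<phi> by fact
  interpret S: scalar_extension F V \<phi> "adjoin_sqrt F a" "sqrt_embed F"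
    by (intro scalar_extension.intro scalar_extension_axioms.intro \<phi>
        f.adjoin_sqrt_field[OF f.char_two a] f.sqrt_embed_hom[OF a])
  show thesis using S.defect_ext_form[OF ds] that by blast
qed

theorem theorem4p6:
  fixes F :: "('k, 'm) ring_scheme" (structure)
    and V :: "('k, 'v, 'n) module_scheme" and \<phi> :: "'v \<Rightarrow> 'k"
    and W :: "('k, 'w, 'p) module_scheme" and \<psi> :: "'w \<Rightarrow> 'k"
    and U :: "('k, 'u, 'q) module_scheme" and \<sigma> :: "'u \<Rightarrow> 'k"
  assumes "field F" and "\<one> \<oplus> \<one> = \<zero>"
    and "ts_form F V \<phi>" and "ts_form F W \<psi>"
    and "anisotropic_part F V \<phi> U \<sigma>" and "minimal_form F U \<sigma>"
    and "weakly_vishik_equivalent F V \<phi> W \<psi>"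
  shows "similar F V \<phi> W \<psi>"
proof -
  interpret C: field_char_two F
    using assms(1,2) by (intro field_char_two.intro field_char_two_axioms.intro)
  interpret f: ts_form F V \<phi> by fact
  interpret g: ts_form F W \<psi> by fact
  define D D' m where "D = \<phi> ` carrier V" and "D' = \<psi> ` carrier W" and "m = vectorspace.dim F U"
  obtain k where k: "an_decomposition F V \<phi> U \<sigma> k" using assms(5) by (auto simp: anisotropic_part_def)
  have D: "\<sigma> ` carrier U = D" "C.dimension m (squares F) D"
    using an_decomposition_dims(2,3)[OF assms(3) k] by (simp_all add: D_def m_def)
  have mD: "C.minimal_space m D"
    using assms(6) D unfolding C.minimal_space_def minimal_form_def norm_degree_def norm_field_def
      nonzero_values_def C.ratio_field_def m_def by simp
  obtain ds where ds: "C.independent (squares F) ds" "length ds = m" "C.Span (squares F) ds = D"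
    using C.exists_base[OF C.squares_subfield D(2)] by blast
  obtain bs where bs: "list_basis F W bs" using g.list_basis_exists[OF g.finite_dim] .
  obtain ds' where ds': "C.independent (squares F) ds'" "C.Span (squares F) ds' = D'"
    using C.filter_base[OF C.squares_subfield g.map_form_carrier[OF list_basis_carrier[OF bs]]]
      g.values_eq_Span[OF bs] unfolding D'_def by metis
  have dims: "f.dim = g.dim"
    and wv: "\<And>a. a \<in> carrier F \<Longrightarrow>
      defect (adjoin_sqrt F a) (ext_space (adjoin_sqrt F a) (sqrt_embed F) F V)
        (ext_form (adjoin_sqrt F a) (sqrt_embed F) F V \<phi>) =
      defect (adjoin_sqrt F a) (ext_space (adjoin_sqrt F a) (sqrt_embed F) F W)
        (ext_form (adjoin_sqrt F a) (sqrt_embed F) F W \<psi>)"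
    using assms(7) by (simp_all add: weakly_vishik_equivalent_def Let_def)
  have rank: "\<exists>r\<le>length ds. r \<le> length ds' \<and>
      (r = length ds \<longleftrightarrow> ring.independent (adjoin_sqrt F a) (squares (adjoin_sqrt F a)) (map (sqrt_embed F) ds)) \<and>
      (r = length ds' \<longleftrightarrow> ring.independent (adjoin_sqrt F a) (squares (adjoin_sqrt F a)) (map (sqrt_embed F) ds'))"
    if a: "a \<in> carrier F" for a
  proof -
    obtain r where r: "defect (adjoin_sqrt F a) (ext_space (adjoin_sqrt F a) (sqrt_embed F) F V)
        (ext_form (adjoin_sqrt F a) (sqrt_embed F) F V \<phi>) = f.dim - r" "r \<le> f.dim" "r \<le> length ds"
      "r = length ds \<longleftrightarrow> ring.independent (adjoin_sqrt F a) (squares (adjoin_sqrt F a)) (map (sqrt_embed F) ds)"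
      using defect_at_sqrt[OF assms(3) a ds(1)] ds(3) unfolding D_def by blast
    obtain r' where r': "defect (adjoin_sqrt F a) (ext_space (adjoin_sqrt F a) (sqrt_embed F) F W)
        (ext_form (adjoin_sqrt F a) (sqrt_embed F) F W \<psi>) = g.dim - r'" "r' \<le> g.dim" "r' \<le> length ds'"
      "r' = length ds' \<longleftrightarrow> ring.independent (adjoin_sqrt F a) (squares (adjoin_sqrt F a)) (map (sqrt_embed F) ds')"
      using defect_at_sqrt[OF assms(4) a ds'(1)] ds'(2) unfolding D'_def by blast
    have "r = r'" using wv[OF a] r(1,2) r'(1,2) dims by simp
    thus ?thesis using r r' by blast
  qed
  \<comment> \<open>for \<open>a = 0\<close> both bases stay independent, so the common rank is the length of each\<close>
  have m': "length ds' = m"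
    using rank[OF C.zero_closed] C.independent_adjoin_sqrt_zero[OF ds(1)]
      C.independent_adjoin_sqrt_zero[OF ds'(1)] ds(2) by auto
  have dimD': "C.dimension m (squares F) D'"
    using C.dimension_independent[OF ds'(1)] ds'(2) m' by simp
  have Dc: "D \<subseteq> carrier F" "D' \<subseteq> carrier F" using f.form_closed g.form_closed by (auto simp: D_def D'_def)
  have ratio_iff: "(\<exists>d\<in>D - {\<zero>}. \<exists>d'\<in>D - {\<zero>}. a = d \<otimes> inv d') \<longleftrightarrow> (\<exists>d\<in>D' - {\<zero>}. \<exists>d'\<in>D' - {\<zero>}. a = d \<otimes> inv d')"
    if a: "a \<in> carrier F" "a \<notin> squares F" for a
    using rank[OF a(1)] C.independent_adjoin_sqrt_iff[OF a ds(1)] C.independent_adjoin_sqrt_iff[OF a ds'(1)]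
      ds(2,3) ds'(2) m' by auto
  \<comment> \<open>the norm field is generated by the squares and the nonsquare ratios, so it is the same for \<open>\<phi>\<close>
    and \<open>\<psi>\<close>, and the value space of \<open>\<psi>\<close> is minimal as well\<close>
  have "squares F \<union> {a \<otimes> inv b |a b. a \<in> D - {\<zero>} \<and> b \<in> D - {\<zero>}} =
      squares F \<union> {a \<otimes> inv b |a b. a \<in> D' - {\<zero>} \<and> b \<in> D' - {\<zero>}}" (is "?A = ?B")
  proof (rule Set.set_eqI)
    fix x
    show "x \<in> ?A \<longleftrightarrow> x \<in> ?B"
    proof (cases "x \<in> carrier F \<and> x \<notin> squares F")
      case True
      thus ?thesis using ratio_iff[of x] by blast
    next
      case False
      thus ?thesis using C.ratio_field_carrier[OF Dc(1)] C.ratio_field_carrier[OF Dc(2)] by blast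
    qed
  qed
  hence "C.ratio_field D = C.ratio_field D'" by (simp add: C.ratio_field_def)
  hence mD': "C.minimal_space m D'" using mD dimD' by (simp add: C.minimal_space_def)
  have sp: "C.space D" "C.space D'" using C.dimension_space D(2) dimD' by auto
  have "1 \<le> m" using mD by (simp add: C.minimal_space_def)
  then obtain d where d: "d \<in> D" "d \<noteq> \<zero>"
    using C.independent_outside[OF D(2), of "[]"] by (auto simp: C.independent_Cons C.Span_Nil)
  have "\<exists>a\<in>D. \<exists>b\<in>D. s \<otimes> t = a \<otimes> b" if st: "s \<in> D'" "t \<in> D'" for s t
  proof (rule C.products_if_ratios[OF sp(1) d sp(2) _ st])
    fix x y assume "x \<in> D' - {\<zero>}" "y \<in> D' - {\<zero>}" "x \<otimes> inv y \<notin> squares F"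
    thus "\<exists>a\<in>D - {\<zero>}. \<exists>b\<in>D - {\<zero>}. x \<otimes> inv y = a \<otimes> inv b"
      using ratio_iff[of "x \<otimes> inv y"] C.inv_nz[of y] Dc(2) by blast
  qed
  from C.minimal_spaces_proportional[OF mD mD' this]
  obtain c where c: "c \<in> carrier F" "c \<noteq> \<zero>" "D' = (\<otimes>) c ` D" by blast
  note i = C.inv_nz[OF c(1,2)]
  let ?\<chi> = "\<lambda>w. inv c \<otimes> \<psi> w"
  have \<chi>: "ts_form F W ?\<chi>"
  proof (intro ts_form.intro ts_form_axioms.intro g.vectorspace_axioms assms(2) g.finite_dim)
    show "?\<chi> w \<in> carrier F" if "w \<in> carrier W" for w using that i g.form_closed by simp
    show "?\<chi> (a \<odot>\<^bsub>W\<^esub> w) = (a \<otimes> a) \<otimes> ?\<chi> w" if "a \<in> carrier F" "w \<in> carrier W" for a w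
      using that i g.form_closed by (simp add: g.form_smult C.m_ac)
    show "?\<chi> (v \<oplus>\<^bsub>W\<^esub> w) = ?\<chi> v \<oplus> ?\<chi> w" if "v \<in> carrier W" "w \<in> carrier W" for v w
      using that i g.form_closed by (simp add: g.form_add C.r_distr)
  qed
  have "?\<chi> ` carrier W = (\<otimes>) (inv c) ` (\<otimes>) c ` D"
    using c(3) unfolding D'_def by (simp add: image_image[symmetric])
  also have "\<dots> = (\<otimes>) (inv c \<otimes> c) ` D" using C.scale_scale[OF Dc(1), of "inv c" c] i c by blast
  also have "\<dots> = D" using C.scale_one[OF Dc(1)] i c C.m_comm[of c "inv c"] by simp
  finally have "isometric F V \<phi> W ?\<chi>"
    using isometric_if_same_values[OF assms(3) \<chi> dims] by (simp add: D_def)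
  thus ?thesis using i unfolding similar_def by blast
qed

end
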